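(* For the class of all finite groups, the partitions $P_1,\dots,P_6$ induced by the equivalence relations $\sim_1,\dots,\sim_6$ satisfy $$P_1<P_2=P_3=P_4\leq P_5<P_6.$$
   Context: For a finite group $G$, $\# G$ is its order, $1_G$ its identity and $\mathrm{ord}(g)$ the order of $g\in G$. - $\mathcal O(G)$ is the multiset $\{\mathrm{ord}(g): g\in G\}$ of orders of elements of $G$ (counted with multiplicity). - $\mathcal C_G$ is the set of all cyclic subgroups of $G$. $\Lambda(G)$ is the vertex-weighted digraph with vertex set $\mathcal C_G$, each vertex $C$ weighted by its order $\# C$, with a directed edge $C_1\to C_2$ whenever $C_2\subsetneq C_1$. - The power graph $\Gamma(G)$ is the undirected graph with vertex set $G$ in which $g,h$ are connected if $g\neq h$ and $g=h^k$ or $h=g^k$ for some integer $k$. - For $t\in\mathbb Z$, $\Gamma_t(G)$ is the directed graph with vertex set $G$ and edge set $\{g\to g^t: g\in G\}$ (loops allowed). Equivalence relations on finite groups $G,H$: (1) $G\sim_1 H$ if $G\cong H$ as groups; (2) $G\sim_2 H$ if there is a bijection $\varphi:G\to H$ with $\varphi(g^t)=\varphi(g)^t$ for all $g\in G$, $t\in\mathbb Z$; (3) $G\sim_3 H$ if $\Lambda(G)\cong\Lambda(H)$ as vertex-weighted digraphs; (4) $G\sim_4 H$ if $\Gamma(G)\cong\Gamma(H)$; (5) $G\sim_5 H$ if $\Gamma_t(G)\cong\Gamma_t(H)$ for every $t\in\mathbb Z$; (6) $G\sim_6 H$ if $\mathcal O(G)=\mathcal O(H)$. $P_j$ is the partition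 of the set of isomorphism classes of finite groups induced by $\sim_j$. $P_j\le P_k$ means that $G\sim_j H$ implies $G\sim_k H$ for all groups $G,H$ in the class considered; $P_j=P_k$ means the two relations coincide on the class; $P_j<P_k$ means $P_j\le P_k$ and $P_j\ne P_k$. *)

theory Defs
  imports
    "HOL-Algebra.Algebra"
    "HOL-Library.Multiset"
    "Graph_Theory.Graph_Theory"
begin

definition finite_group :: "('a, 'm) monoid_scheme \<Rightarrow> bool" where
  "finite_group G \<longleftrightarrow> group G \<and> finite (carrier G)"


section \<open>Invariants of a finite group\<close>

definition order_multiset :: "('a, 'm) monoid_scheme \<Rightarrow> nat multiset" where
  "order_multiset G = image_mset (group.ord G) (mset_set (carrier G))"

definition cyclic_subgroups :: "('a, 'm) monoid_scheme \<Rightarrow> 'a set set" where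
  "cyclic_subgroups G = {C. subgroup C G \<and> cyclic_group (G\<lparr>carrier := C\<rparr>)}"

text \<open>The vertex weight of \<open>\<Lambda>(G)\<close>, which is \<^const>\<open>card\<close>, is supplied separately,
  in \<open>sim3\<close> below.\<close>

definition cyclic_subgroup_digraph :: "('a, 'm) monoid_scheme \<Rightarrow> 'a set pair_pre_digraph" where
  "cyclic_subgroup_digraph G =
     \<lparr> pverts = cyclic_subgroups G,
       parcs = {(C1, C2). C1 \<in> cyclic_subgroups G \<and> C2 \<in> cyclic_subgroups G \<and> C2 \<subset> C1} \<rparr>"

text \<open>The undirected graph \<open>\<Gamma>(G)\<close> is encoded, as usual in \<^theory>\<open>Graph_Theory.Graph_Theory\<close>,
  by a symmetric loop-free digraph: an undirected edge is the pair of opposite arcs.\<close>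

definition power_graph :: "('a, 'm) monoid_scheme \<Rightarrow> 'a pair_pre_digraph" where
  "power_graph G =
     \<lparr> pverts = carrier G,
       parcs = {(g, h). g \<in> carrier G \<and> h \<in> carrier G \<and> g \<noteq> h \<and>
                  (\<exists>k::int. g = h [^]\<^bsub>G\<^esub> k \<or> h = g [^]\<^bsub>G\<^esub> k)} \<rparr>"

definition power_map_digraph :: "int \<Rightarrow> ('a, 'm) monoid_scheme \<Rightarrow> 'a pair_pre_digraph" where
  "power_map_digraph t G =
     \<lparr> pverts = carrier G, parcs = {(g, g [^]\<^bsub>G\<^esub> t) | g. g \<in> carrier G} \<rparr>"

text \<open>\<^const>\<open>digraph_iso\<close> with the additional requirement that the vertex map preserves the
  weights \<open>w\<close> and \<open>w'\<close>.\<close>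

definition weighted_digraph_iso ::
    "('v, 'e) pre_digraph \<Rightarrow> ('v \<Rightarrow> 'w) \<Rightarrow> ('u, 'd) pre_digraph \<Rightarrow> ('u \<Rightarrow> 'w) \<Rightarrow> bool" where
  "weighted_digraph_iso D w E w' \<longleftrightarrow>
     (\<exists>f. pre_digraph.digraph_isomorphism D f \<and> E = app_iso f D \<and>
          (\<forall>v \<in> verts D. w' (iso_verts f v) = w v))"


section \<open>The six equivalence relations\<close>

definition sim1 :: "'a monoid \<Rightarrow> 'b monoid \<Rightarrow> bool" where
  "sim1 G H \<longleftrightarrow> G \<cong> H"

definition sim2 :: "'a monoid \<Rightarrow> 'b monoid \<Rightarrow> bool" where
  "sim2 G H \<longleftrightarrow>
     (\<exists>\<phi>. bij_betw \<phi> (carrier G) (carrier H) \<and>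
          (\<forall>g \<in> carrier G. \<forall>t::int. \<phi> (g [^]\<^bsub>G\<^esub> t) = \<phi> g [^]\<^bsub>H\<^esub> t))"

definition sim3 :: "'a monoid \<Rightarrow> 'b monoid \<Rightarrow> bool" where
  "sim3 G H \<longleftrightarrow>
     weighted_digraph_iso (with_proj (cyclic_subgroup_digraph G)) card
                          (with_proj (cyclic_subgroup_digraph H)) card"

definition sim4 :: "'a monoid \<Rightarrow> 'b monoid \<Rightarrow> bool" where
  "sim4 G H \<longleftrightarrow> digraph_iso (with_proj (power_graph G)) (with_proj (power_graph H))"

definition sim5 :: "'a monoid \<Rightarrow> 'b monoid \<Rightarrow> bool" where
  "sim5 G H \<longleftrightarrow>
     (\<forall>t::int. digraph_iso (with_proj (power_map_digraph t G)) (with_proj (power_map_digraph t H)))"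

definition sim6 :: "'a monoid \<Rightarrow> 'b monoid \<Rightarrow> bool" where
  "sim6 G H \<longleftrightarrow> order_multiset G = order_multiset H"


section \<open>Comparison of the induced partitions\<close>

text \<open>The induced partitions are compared through the relations that induce them, on the class of
  all finite groups. The two groups may have carriers in different types.\<close>

definition P_le ::
    "('a monoid \<Rightarrow> 'b monoid \<Rightarrow> bool) \<Rightarrow> ('a monoid \<Rightarrow> 'b monoid \<Rightarrow> bool) \<Rightarrow> bool" where
  "P_le R S \<longleftrightarrow> (\<forall>G H. finite_group G \<longrightarrow> finite_group H \<longrightarrow> R G H \<longrightarrow> S G H)"

definition P_eq ::
    "('a monoid \<Rightarrow> 'b monoid \<Rightarrow> bool) \<Rightarrow> ('a monoid \<Rightarrow> 'b monoid \<Rightarrow> bool) \<Rightarrow> bool" where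
  "P_eq R S \<longleftrightarrow> (\<forall>G H. finite_group G \<longrightarrow> finite_group H \<longrightarrow> (R G H \<longleftrightarrow> S G H))"

text \<open>Strictness depends on the carrier types being large enough to contain a separating pair of
  groups. Every finite group is isomorphic to one with carrier in \<^typ>\<open>nat\<close>, so \<^typ>\<open>nat\<close> is where
  strictness is to be asserted.\<close>

definition P_less ::
    "('a monoid \<Rightarrow> 'b monoid \<Rightarrow> bool) \<Rightarrow> ('a monoid \<Rightarrow> 'b monoid \<Rightarrow> bool) \<Rightarrow> bool" where
  "P_less R S \<longleftrightarrow> P_le R S \<and> \<not> P_eq R S"

end

theory Submission
  imports Defs "HOL-Number_Theory.Totient" "HOL-Library.Countable"
begin

text \<open>
  All comparisons run through the directed power graph, in which \<open>x\<close> lies below \<open>y\<close> if \<open>x\<close> is a power of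
  \<open>y\<close>, that is, \<open>x \<in> \<langle>y\<rangle>\<close>. An isomorphism of directed power graphs (\<open>cyc_iso\<close>) is immediate from a
  bijection that commutes with powers, and immediately yields isomorphisms of the weighted digraphs
  of cyclic subgroups and of the power graphs. Two implications remain for
  \<open>\<sim>\<^sub>2 = \<sim>\<^sub>3 = \<sim>\<^sub>4\<close>.

  \<^item> From the cyclic subgroups back to powers (\<open>sim3_imp_sim2\<close>): an isomorphism \<open>F\<close> of the posets of
    cyclic subgroups preserving orders gives isomorphic groups \<open>C\<close> and \<open>F C\<close>, but the isomorphisms
    have to be chosen so that they agree on intersections. It suffices to choose in each
    group a generator \<open>\<gamma>(C)\<close> of every cyclic subgroup \<open>C\<close> so that \<open>\<gamma>(D)\<close> is the power of \<open>\<gamma>(C)\<close> with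
    exponent \<open>[C : D]\<close> whenever \<open>D \<subseteq> C\<close>. Such generators are built by induction on the order of
    \<open>C\<close> (\<open>ex_compatible_generator\<close>), by a Bezout argument.

  \<^item> From the undirected to the directed power graph (\<open>sim4_imp_cyc_iso\<close>), a theorem of Cameron. The
    direction of an edge is known once element orders are, so the isomorphism has to be
    turned into one that preserves orders. Call two vertices twins if they have the same closed
    neighbourhood; permuting within a twin class changes no edges, so it suffices to recover from
    the graph how many elements of each order a twin class contains. Apart from the class of the
    identity (the hub), a class is either plain, consisting of the generators of one
    cyclic group, or compound, consisting of the elements of orders \<open>p\<^sup>s, \<dots>, p\<^sup>r\<close> with \<open>1 \<le> s < r\<close> of
    one cyclic group of order \<open>p\<^sup>r\<close> (\<open>compound_twinsE\<close>). The two types and the parameters of compound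
    classes can be read off from cardinalities (\<open>compound_shape_of_not_plain\<close>,
    \<open>plain_imp_not_compound_shape\<close>). For plain \<open>x\<close> the set \<open>\<langle>x\<rangle>\<close> itself, hence the
    order of \<open>x\<close>, is visible in the graph (\<open>image_below_plain\<close>). The hub is \<open>{\<one>}\<close> unless the
    group is cyclic or of prime power order, and its orders are then
    determined by its size and that of the group.

  If \<open>\<phi>\<close> commutes with all powers, it is an isomorphism of the digraphs of all power maps. Conversely
  the loops of the digraph of \<open>g \<mapsto> g\<^bsup>n + 1\<^esup>\<close> count the elements of order dividing \<open>n\<close>
  (\<open>sim5_imp_sim6\<close>).

  For strictness, the Heisenberg group modulo 3 and the elementary abelian group of order 27 have the
  same powers in suitable coordinates; and the direct product of two cyclic groups of order 4 and their
  nontrivial semidirect product have the same element orders but 4 and 3 squares,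
  respectively.
\<close>

section \<open>Cyclic subgroups of a finite group\<close>

locale finite_grp = group G for G (structure) +
  assumes fin: "finite (carrier G)"

lemma finite_group_iff: "finite_group G \<longleftrightarrow> finite_grp G"
  by (simp add: finite_group_def finite_grp_def finite_grp_axioms_def)

abbreviation cyc :: "('a, 'm) monoid_scheme \<Rightarrow> 'a \<Rightarrow> 'a set" where
  "cyc G x \<equiv> generate G {x}"

context finite_grp
begin

lemma ord_pos: "x \<in> carrier G \<Longrightarrow> ord x > 0"
  using ord_ge_1[OF fin] by force

lemma cyc_iff: "y \<in> carrier G \<Longrightarrow> x \<in> cyc G y \<longleftrightarrow> (\<exists>k::int. x = y [^] k)"
  using generate_pow by auto

lemma cyc_carrier: "x \<in> cyc G y \<Longrightarrow> y \<in> carrier G \<Longrightarrow> x \<in> carrier G"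
  by (auto simp: cyc_iff)

lemma cyc_subset: "y \<in> carrier G \<Longrightarrow> cyc G y \<subseteq> carrier G"
  using cyc_carrier by blast

lemma finite_cyc: "y \<in> carrier G \<Longrightarrow> finite (cyc G y)"
  using cyc_subset fin finite_subset by blast

lemma cyc_refl [simp]: "x \<in> cyc G x"
  by (simp add: generate.incl)

lemma cyc_one [simp]: "\<one> \<in> cyc G x"
  by (simp add: generate.one)

lemma cyc_mono: "x \<in> cyc G y \<Longrightarrow> y \<in> carrier G \<Longrightarrow> cyc G x \<subseteq> cyc G y"
  by (metis cyc_subset empty_subsetI generate_is_subgroup generate_subgroup_incl insert_subset)

lemma cyc_trans: "x \<in> cyc G y \<Longrightarrow> y \<in> cyc G z \<Longrightarrow> z \<in> carrier G \<Longrightarrow> x \<in> cyc G z"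
  using cyc_mono by blast

lemma cyc_int_pow: "x \<in> carrier G \<Longrightarrow> x [^] (k::int) \<in> cyc G x"
  by (auto simp: cyc_iff)

lemma cyc_nat_pow: "x \<in> carrier G \<Longrightarrow> x [^] (k::nat) \<in> cyc G x"
  by (metis cyc_int_pow int_pow_int)

lemma card_cyc: "x \<in> carrier G \<Longrightarrow> card (cyc G x) = ord x"
  using generate_pow_card by simp

lemma cyc_ord_dvd: "x \<in> cyc G y \<Longrightarrow> y \<in> carrier G \<Longrightarrow> ord x dvd ord y"
  by (metis cyc_carrier cyc_iff int_dvd_int_iff int_pow_eq_id int_pow_int int_pow_pow mult.commute
      int_pow_closed pow_ord_eq_1 int_pow_one)

lemma cyc_cardD: "cyc G x = cyc G y \<Longrightarrow> x \<in> carrier G \<Longrightarrow> y \<in> carrier G \<Longrightarrow> ord x = ord y"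
  by (metis card_cyc)

text \<open>A cyclic group has at most one subgroup of each order, and inclusion between its subgroups
  is divisibility of orders: if \<open>x = y\<^sup>a\<close> and \<open>z = y\<^sup>b\<close>, then \<open>x\<^bsup>ord z\<^esup> = \<one>\<close> forces
  \<open>gcd b (ord y)\<close> to divide \<open>a\<close>, and Bezout makes \<open>x\<close> a power of \<open>z\<close>.\<close>
lemma cyc_of_ord_dvd:
  assumes y: "y \<in> carrier G" and x: "x \<in> cyc G y" and z: "z \<in> cyc G y"
    and dvd: "ord x dvd ord z"
  shows "x \<in> cyc G z"
proof -
  have zc: "z \<in> carrier G" and xc: "x \<in> carrier G" using x z y cyc_carrier by auto
  obtain a :: int where a: "x = y [^] a" using x y cyc_iff by auto
  obtain b0 :: int where b0: "z = y [^] b0" using z y cyc_iff by auto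
  define n where "n = ord y"
  define b where "b = nat (b0 mod int n)"
  have n0: "n > 0" using ord_pos y n_def by auto
  have b: "z = y [^] (int b)"
    unfolding b0 b_def using y n0 by (simp add: int_pow_eq n_def mod_eq_dvd_iff[symmetric])
  have ordz: "ord z * gcd n b = n"
  proof (cases "b = 0")
    case True
    then show ?thesis using b by simp
  next
    case False
    then show ?thesis using b y by (simp add: int_pow_int ord_pow_gen n_def)
  qed
  have "x [^] ord z = \<one>" using dvd xc pow_eq_id by simp
  then have "y [^] (a * int (ord z)) = \<one>"
    by (metis a y int_pow_int int_pow_pow)
  then have "int (ord z * gcd n b) dvd a * int (ord z)"
    using y int_pow_eq_id ordz n_def by simp
  moreover have "ord z > 0" using ord_pos zc by simp
  ultimately have "int (gcd n b) dvd a" by (simp add: mult.commute)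
  then have "gcd (int n) (int b) dvd a" by simp
  then obtain u v where uv: "a = u * int n + v * int b"
    by (metis bezout_int dvd_def mult.commute distrib_left mult.assoc)
  have "y [^] a = y [^] (int b * v)"
    using y uv by (simp add: int_pow_eq n_def algebra_simps)
  then have "x = z [^] v" using a b y by (simp add: int_pow_pow)
  then show ?thesis using zc cyc_iff by auto
qed

lemma cyc_eq_of_ord:
  assumes y: "y \<in> carrier G" and x: "x \<in> cyc G y" and z: "z \<in> cyc G y" and "ord x = ord z"
  shows "cyc G x = cyc G z"
  using cyc_of_ord_dvd[OF y x z] cyc_of_ord_dvd[OF y z x] assms cyc_carrier cyc_mono
  by (metis dvd_refl subset_antisym)

lemma ex_in_cyc_of_ord:
  assumes y: "y \<in> carrier G" and d: "d dvd ord y"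
  obtains x where "x \<in> cyc G y" "ord x = d"
proof
  have pos: "ord y > 0" using ord_pos y by auto
  show "y [^] (ord y div d) \<in> cyc G y" using cyc_nat_pow y by auto
  have "ord y div d dvd ord y" "ord y div d \<noteq> 0" using d pos
    by (auto simp: dvd_div_eq_0_iff)
  then show "ord (y [^] (ord y div d)) = d" using ord_pow[OF y] d pos by (auto elim!: dvdE)
qed

lemma card_ord_dvd_in_cyc:
  assumes y: "y \<in> carrier G" and d: "d dvd ord y"
  shows "card {x \<in> cyc G y. ord x dvd d} = d"
proof -
  obtain z where z: "z \<in> cyc G y" "ord z = d" using ex_in_cyc_of_ord[OF y d] .
  have "{x \<in> cyc G y. ord x dvd d} = cyc G z"
    using cyc_of_ord_dvd[OF y _ z(1)] z cyc_trans[OF _ z(1) y] cyc_ord_dvd[of _ z] y cyc_carrier by blast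
  then show ?thesis using z card_cyc cyc_carrier y by simp
qed

lemma card_ord_eq_in_cyc:
  assumes y: "y \<in> carrier G" and d: "d dvd ord y"
  shows "card {x \<in> cyc G y. ord x = d} = totient d"
proof -
  obtain z where z: "z \<in> cyc G y" "ord z = d" using ex_in_cyc_of_ord[OF y d] .
  have zc: "z \<in> carrier G" using z y cyc_carrier by auto
  have "{x \<in> cyc G y. ord x = d} = (\<lambda>k. z [^] k) ` totatives d" (is "?L = ?R")
  proof
    show "?R \<subseteq> ?L"
    proof clarify
      fix k assume "k \<in> totatives d"
      then have "coprime k (ord z)" using z by (simp add: totatives_def)
      then show "z [^] k \<in> cyc G y \<and> ord (z [^] k) = d"
        using pow_ord_eq_ord_iff[OF fin zc] z cyc_nat_pow[OF zc] cyc_trans[OF _ z(1) y] by auto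
    qed
    show "?L \<subseteq> ?R"
    proof clarify
      fix x assume x: "x \<in> cyc G y" and d: "d = ord x"
      then have "x \<in> cyc G z" using cyc_of_ord_dvd[OF y x z(1)] z by simp
      then obtain j :: int where j: "x = z [^] j" using cyc_iff zc by auto
      have pos: "d > 0" using z zc ord_pos by auto
      define k where "k = (if j mod int d = 0 then d else nat (j mod int d))"
      have "x = z [^] int k" unfolding j k_def using zc pos z
        by (auto simp: int_pow_eq mod_eq_dvd_iff[symmetric] mod_eq_0_iff_dvd dvd_diff)
      then have xk: "x = z [^] k" by (simp add: int_pow_int)
      have "j mod int d < int d" "j mod int d \<ge> 0" using pos by auto
      then have "0 < k" "k \<le> d" using pos unfolding k_def by (auto simp: nat_le_iff intro: less_imp_le)
      moreover have "coprime k d" using pow_ord_eq_ord_iff[OF fin zc, of k] xk d z(2) by simp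
      ultimately show "x \<in> (\<lambda>k. z [^] k) ` totatives (ord x)"
        using xk d by (auto simp: totatives_def)
    qed
  qed
  moreover have "inj_on (\<lambda>k. z [^] k) (totatives d)"
    by (rule inj_on_subset[OF ord_inj'[OF zc]]) (auto simp: totatives_def z)
  ultimately show ?thesis by (simp add: card_image totient_def)
qed

end

section \<open>Isomorphisms of digraphs without parallel arcs\<close>

text \<open>An isomorphism of digraphs in general also carries maps of arcs, heads and tails. Without parallel
  arcs these are determined by the vertex map \<open>f\<close>; the predicate \<open>\<Phi>\<close> allows for conditions on \<open>f\<close> such as
  the preservation of weights.\<close>
lemma digraph_isomorphism_with_proj_iff:
  assumes P: "parcs P \<subseteq> pverts P \<times> pverts P" and Q: "parcs Q \<subseteq> pverts Q \<times> pverts Q"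
  shows "(\<exists>h. pre_digraph.digraph_isomorphism (with_proj P) h \<and>
              with_proj Q = app_iso h (with_proj P) \<and> \<Phi> (iso_verts h)) \<longleftrightarrow>
         (\<exists>f. bij_betw f (pverts P) (pverts Q) \<and>
              (\<forall>x\<in>pverts P. \<forall>y\<in>pverts P. (x, y) \<in> parcs P \<longleftrightarrow> (f x, f y) \<in> parcs Q) \<and> \<Phi> f)"
    (is "?L \<longleftrightarrow> ?R")
proof
  assume ?L
  then obtain h where iso: "pre_digraph.digraph_isomorphism (with_proj P) h"
    and Qh: "with_proj Q = app_iso h (with_proj P)" and \<Phi>: "\<Phi> (iso_verts h)" by blast
  define f where "f = iso_verts h"
  have verts: "pverts Q = f ` pverts P" and arcs: "parcs Q = iso_arcs h ` parcs P"
    and tl: "iso_tail h = fst" and hd: "iso_head h = snd"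
    using arg_cong[OF Qh, of verts] arg_cong[OF Qh, of arcs] arg_cong[OF Qh, of tail]
      arg_cong[OF Qh, of head] by (auto simp: f_def)
  have inj: "inj_on f (pverts P)"
    using iso by (simp add: pre_digraph.digraph_isomorphism_def f_def)
  have "iso_arcs h a = map_prod f f a" if "a \<in> parcs P" for a
    using iso that tl hd
    by (auto simp: pre_digraph.digraph_isomorphism_def f_def prod_eq_iff)
  then have arcs': "parcs Q = map_prod f f ` parcs P" using arcs by simp
  have "(x, y) \<in> parcs P \<longleftrightarrow> (f x, f y) \<in> parcs Q" if "x \<in> pverts P" "y \<in> pverts P" for x y
  proof
    show "(f x, f y) \<in> parcs Q" if "(x, y) \<in> parcs P" using that arcs' by force
    assume "(f x, f y) \<in> parcs Q"
    then obtain x' y' where "(x', y') \<in> parcs P" "f x = f x'" "f y = f y'" using arcs' by auto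
    then show "(x, y) \<in> parcs P" using inj that P by (metis inj_on_def mem_Sigma_iff subsetD)
  qed
  then show ?R using inj verts \<Phi> f_def by (auto simp: bij_betw_def)
next
  assume ?R
  then obtain f where bij: "bij_betw f (pverts P) (pverts Q)"
    and arc: "\<And>x y. x \<in> pverts P \<Longrightarrow> y \<in> pverts P \<Longrightarrow> (x, y) \<in> parcs P \<longleftrightarrow> (f x, f y) \<in> parcs Q"
    and \<Phi>: "\<Phi> f" by blast
  define h where "h = \<lparr>iso_verts = f, iso_arcs = map_prod f f, iso_head = snd, iso_tail = fst\<rparr>"
  have inj: "inj_on f (pverts P)" and im: "f ` pverts P = pverts Q"
    using bij by (auto simp: bij_betw_def)
  have "map_prod f f ` parcs P = parcs Q"
  proof
    show "map_prod f f ` parcs P \<subseteq> parcs Q" using arc P by auto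
    show "parcs Q \<subseteq> map_prod f f ` parcs P"
    proof clarify
      fix u v assume uv: "(u, v) \<in> parcs Q"
      then have "u \<in> f ` pverts P" "v \<in> f ` pverts P" using Q im by auto
      then obtain x y where "x \<in> pverts P" "u = f x" "y \<in> pverts P" "v = f y" by blast
      then show "(u, v) \<in> map_prod f f ` parcs P" using arc uv by force
    qed
  qed
  then have "with_proj Q = app_iso h (with_proj P)"
    using im by (simp add: app_iso_def with_proj_def h_def)
  moreover have "wf_digraph (with_proj P)" using P by unfold_locales auto
  moreover have "inj_on (map_prod f f) (parcs P)"
    by (rule inj_on_subset[OF map_prod_inj_on[OF inj inj] P])
  ultimately show ?L using inj \<Phi>
    by (intro exI[of _ h]) (auto simp: pre_digraph.digraph_isomorphism_def h_def)
qed

lemma digraph_iso_with_proj_iff: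
  assumes "parcs P \<subseteq> pverts P \<times> pverts P" and "parcs Q \<subseteq> pverts Q \<times> pverts Q"
  shows "digraph_iso (with_proj P) (with_proj Q) \<longleftrightarrow>
         (\<exists>f. bij_betw f (pverts P) (pverts Q) \<and>
              (\<forall>x\<in>pverts P. \<forall>y\<in>pverts P. (x, y) \<in> parcs P \<longleftrightarrow> (f x, f y) \<in> parcs Q))"
  using digraph_isomorphism_with_proj_iff[OF assms, of "\<lambda>_. True"]
  by (simp add: digraph_iso_def)

lemma weighted_digraph_iso_with_proj_iff:
  assumes "parcs P \<subseteq> pverts P \<times> pverts P" and "parcs Q \<subseteq> pverts Q \<times> pverts Q"
  shows "weighted_digraph_iso (with_proj P) w (with_proj Q) w' \<longleftrightarrow>
         (\<exists>f. bij_betw f (pverts P) (pverts Q) \<and>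
              (\<forall>x\<in>pverts P. \<forall>y\<in>pverts P. (x, y) \<in> parcs P \<longleftrightarrow> (f x, f y) \<in> parcs Q) \<and>
              (\<forall>x\<in>pverts P. w' (f x) = w x))"
  using digraph_isomorphism_with_proj_iff[OF assms, of "\<lambda>f. \<forall>x\<in>pverts P. w' (f x) = w x"]
  by (simp add: weighted_digraph_iso_def)

section \<open>The relations in terms of cyclic subgroups\<close>

lemma (in finite_grp) cyclic_subgroups_eq: "cyclic_subgroups G = cyc G ` carrier G"
proof
  show "cyclic_subgroups G \<subseteq> cyc G ` carrier G"
  proof
    fix C assume "C \<in> cyclic_subgroups G"
    then have C: "subgroup C G" and cy: "cyclic_group (G\<lparr>carrier := C\<rparr>)"
      by (auto simp: cyclic_subgroups_def)
    obtain x where x: "x \<in> C" and "C = range (\<lambda>n::int. x [^]\<^bsub>G\<lparr>carrier := C\<rparr>\<^esub> n)"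
      using cy group.cyclic_group[OF subgroup_imp_group[OF C]] by auto
    then have "C = range (\<lambda>n::int. x [^] n)" using int_pow_consistent[OF C x] by simp
    moreover have xc: "x \<in> carrier G" using x C subgroup.subset by blast
    ultimately have "C = cyc G x" using generate_pow[OF xc] by blast
    then show "C \<in> cyc G ` carrier G" using xc by blast
  qed
  show "cyc G ` carrier G \<subseteq> cyclic_subgroups G"
  proof clarify
    fix x assume xc: "x \<in> carrier G"
    have C: "subgroup (cyc G x) G" using generate_is_subgroup xc by simp
    have "cyc G x = range (\<lambda>n::int. x [^]\<^bsub>G\<lparr>carrier := cyc G x\<rparr>\<^esub> n)"
      by (simp flip: int_pow_consistent[OF C cyc_refl]) (use generate_pow[OF xc] in blast)
    moreover have "carrier (G\<lparr>carrier := cyc G x\<rparr>) = cyc G x" by simp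
    ultimately have "cyclic_group (G\<lparr>carrier := cyc G x\<rparr>)"
      unfolding group.cyclic_group[OF subgroup_imp_group[OF C]]
      by (metis cyc_refl)
    then show "cyc G x \<in> cyclic_subgroups G" using C by (simp add: cyclic_subgroups_def)
  qed
qed

lemma (in finite_grp) power_graph_arc_iff:
  assumes "x \<in> carrier G" "y \<in> carrier G"
  shows "(x, y) \<in> parcs (power_graph G) \<longleftrightarrow> x \<noteq> y \<and> (x \<in> cyc G y \<or> y \<in> cyc G x)"
  using assms by (auto simp: power_graph_def cyc_iff)

text \<open>\<open>\<phi>\<close> is an isomorphism of the directed power graphs.\<close>
definition cyc_iso ::
    "('a, 'm) monoid_scheme \<Rightarrow> ('b, 'n) monoid_scheme \<Rightarrow> ('a \<Rightarrow> 'b) \<Rightarrow> bool" where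
  "cyc_iso G H \<phi> \<longleftrightarrow> bij_betw \<phi> (carrier G) (carrier H) \<and>
     (\<forall>x\<in>carrier G. \<forall>y\<in>carrier G. x \<in> cyc G y \<longleftrightarrow> \<phi> x \<in> cyc H (\<phi> y))"

lemma sim3_iff:
  assumes "finite_grp G" "finite_grp H"
  shows "sim3 G H \<longleftrightarrow> (\<exists>F. bij_betw F (cyclic_subgroups G) (cyclic_subgroups H) \<and>
     (\<forall>C\<in>cyclic_subgroups G. \<forall>D\<in>cyclic_subgroups G. D \<subset> C \<longleftrightarrow> F D \<subset> F C) \<and>
     (\<forall>C\<in>cyclic_subgroups G. card (F C) = card C))" (is "_ \<longleftrightarrow> (\<exists>F. ?P F)")
proof -
  have "sim3 G H \<longleftrightarrow> (\<exists>F. bij_betw F (cyclic_subgroups G) (cyclic_subgroups H) \<and>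
     (\<forall>C\<in>cyclic_subgroups G. \<forall>D\<in>cyclic_subgroups G.
        D \<subset> C \<longleftrightarrow> F C \<in> cyclic_subgroups H \<and> F D \<in> cyclic_subgroups H \<and> F D \<subset> F C) \<and>
     (\<forall>C\<in>cyclic_subgroups G. card (F C) = card C))"
    unfolding sim3_def
    by (subst weighted_digraph_iso_with_proj_iff) (auto simp: cyclic_subgroup_digraph_def)
  also have "\<dots> \<longleftrightarrow> (\<exists>F. ?P F)"
    by (intro ex_cong1 conj_cong refl ball_cong) (simp_all add: bij_betw_apply)
  finally show ?thesis .
qed

lemma sim4_iff:
  assumes "finite_grp G" "finite_grp H"
  shows "sim4 G H \<longleftrightarrow> (\<exists>f. bij_betw f (carrier G) (carrier H) \<and>
     (\<forall>x\<in>carrier G. \<forall>y\<in>carrier G.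
        x \<in> cyc G y \<or> y \<in> cyc G x \<longleftrightarrow> f x \<in> cyc H (f y) \<or> f y \<in> cyc H (f x)))"
    (is "_ \<longleftrightarrow> (\<exists>f. ?P f)")
proof -
  interpret G: finite_grp G by fact
  interpret H: finite_grp H by fact
  have pv: "pverts (power_graph G) = carrier G" "pverts (power_graph H) = carrier H"
    by (auto simp: power_graph_def)
  have "sim4 G H \<longleftrightarrow> (\<exists>f. bij_betw f (carrier G) (carrier H) \<and>
     (\<forall>x\<in>carrier G. \<forall>y\<in>carrier G.
        (x, y) \<in> parcs (power_graph G) \<longleftrightarrow> (f x, f y) \<in> parcs (power_graph H)))"
    unfolding sim4_def
    by (subst digraph_iso_with_proj_iff) (auto simp: pv power_graph_def)
  also have "\<dots> \<longleftrightarrow> (\<exists>f. ?P f)"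
  proof (intro ex_cong1 conj_cong refl ball_cong)
    fix f x y assume f: "bij_betw f (carrier G) (carrier H)"
      and xy: "x \<in> carrier G" "y \<in> carrier G"
    have "f x = f y \<longleftrightarrow> x = y" using f xy by (auto simp: bij_betw_def inj_on_def)
    then show "((x, y) \<in> parcs (power_graph G) \<longleftrightarrow> (f x, f y) \<in> parcs (power_graph H)) \<longleftrightarrow>
        (x \<in> cyc G y \<or> y \<in> cyc G x \<longleftrightarrow> f x \<in> cyc H (f y) \<or> f y \<in> cyc H (f x))"
      using xy f G.power_graph_arc_iff H.power_graph_arc_iff
      by (cases "x = y") (auto simp: bij_betw_apply)
  qed
  finally show ?thesis .
qed

lemma sim1_imp_sim2:
  assumes "finite_grp G" "finite_grp H" "sim1 G H"
  shows "sim2 G H"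
proof -
  interpret G: finite_grp G by fact
  interpret H: finite_grp H by fact
  obtain h where "h \<in> iso G H" using assms(3) by (auto simp: sim1_def is_iso_def)
  then have h: "h \<in> hom G H" "bij_betw h (carrier G) (carrier H)" by (auto simp: iso_def)
  show ?thesis unfolding sim2_def
    using h hom_int_pow[OF h(1) _ G.is_group H.is_group] by blast
qed

lemma sim2_imp_cyc_iso:
  assumes "finite_grp G" "finite_grp H" "sim2 G H"
  shows "\<exists>\<phi>. cyc_iso G H \<phi>"
proof -
  interpret G: finite_grp G by fact
  interpret H: finite_grp H by fact
  obtain \<phi> where bij: "bij_betw \<phi> (carrier G) (carrier H)"
    and pw: "\<And>g t. g \<in> carrier G \<Longrightarrow> \<phi> (g [^]\<^bsub>G\<^esub> (t::int)) = \<phi> g [^]\<^bsub>H\<^esub> t"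
    using assms(3) by (auto simp: sim2_def)
  have "x \<in> cyc G y \<longleftrightarrow> \<phi> x \<in> cyc H (\<phi> y)" if "x \<in> carrier G" "y \<in> carrier G" for x y
  proof -
    have "\<phi> x \<in> cyc H (\<phi> y) \<longleftrightarrow> (\<exists>k::int. \<phi> x = \<phi> (y [^]\<^bsub>G\<^esub> k))"
      using that bij pw by (simp add: H.cyc_iff bij_betw_apply)
    also have "\<dots> \<longleftrightarrow> (\<exists>k::int. x = y [^]\<^bsub>G\<^esub> k)"
      using that bij by (auto simp: bij_betw_def inj_on_def)
    finally show ?thesis using that by (simp add: G.cyc_iff)
  qed
  then show ?thesis using bij by (auto simp: cyc_iso_def)
qed

lemma cyc_iso_imp_sim3:
  assumes G: "finite_grp G" and H: "finite_grp H" and \<phi>: "cyc_iso G H \<phi>"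
  shows "sim3 G H"
proof -
  interpret G: finite_grp G by fact
  interpret H: finite_grp H by fact
  have inj: "inj_on \<phi> (carrier G)" and im: "\<phi> ` carrier G = carrier H"
    and cy: "\<And>x y. x \<in> carrier G \<Longrightarrow> y \<in> carrier G \<Longrightarrow> x \<in> cyc G y \<longleftrightarrow> \<phi> x \<in> cyc H (\<phi> y)"
    using \<phi> by (auto simp: cyc_iso_def bij_betw_def)
  have image: "\<phi> ` cyc G x = cyc H (\<phi> x)" if x: "x \<in> carrier G" for x
  proof
    show "\<phi> ` cyc G x \<subseteq> cyc H (\<phi> x)" using cy x G.cyc_carrier by blast
    show "cyc H (\<phi> x) \<subseteq> \<phi> ` cyc G x"
    proof
      fix v assume v: "v \<in> cyc H (\<phi> x)"
      then have "v \<in> carrier H" using H.cyc_carrier x im by blast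
      then obtain u where "u \<in> carrier G" "v = \<phi> u" using im by blast
      then show "v \<in> \<phi> ` cyc G x" using v cy x by blast
    qed
  qed
  have sub: "C \<subseteq> carrier G" if "C \<in> cyclic_subgroups G" for C
    using that G.cyclic_subgroups_eq G.cyc_subset by auto
  have "inj_on (image \<phi>) (cyclic_subgroups G)"
    using inj sub by (meson inj_onI inj_on_image_eq_iff)
  moreover have "image \<phi> ` cyclic_subgroups G = cyclic_subgroups H"
  proof -
    have "image \<phi> ` cyclic_subgroups G = cyc H ` (\<phi> ` carrier G)"
      using image by (simp add: G.cyclic_subgroups_eq image_image)
    then show ?thesis using im H.cyclic_subgroups_eq by simp
  qed
  ultimately have "bij_betw (image \<phi>) (cyclic_subgroups G) (cyclic_subgroups H)"
    by (simp add: bij_betw_def)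
  moreover have "D \<subset> C \<longleftrightarrow> \<phi> ` D \<subset> \<phi> ` C"
    if "C \<in> cyclic_subgroups G" "D \<in> cyclic_subgroups G" for C D
  proof -
    have "\<phi> ` D \<subseteq> \<phi> ` C \<longleftrightarrow> D \<subseteq> C"
    proof
      assume im_sub: "\<phi> ` D \<subseteq> \<phi> ` C"
      show "D \<subseteq> C"
      proof
        fix d assume d: "d \<in> D"
        then have "\<phi> d \<in> \<phi> ` C" using im_sub by blast
        then show "d \<in> C" using inj_on_image_mem_iff[OF inj _ sub[OF that(1)]] sub[OF that(2)] d by blast
      qed
    qed blast
    moreover have "\<phi> ` D = \<phi> ` C \<longleftrightarrow> D = C"
      using inj_on_image_eq_iff[OF inj] sub that by blast
    ultimately show ?thesis by blast
  qed
  moreover have "card (\<phi> ` C) = card C" if "C \<in> cyclic_subgroups G" for C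
    using inj sub[OF that] by (meson card_image inj_on_subset)
  ultimately show ?thesis unfolding sim3_iff[OF G H] by blast
qed

lemma cyc_iso_imp_sim4:
  assumes "finite_grp G" "finite_grp H" "cyc_iso G H \<phi>"
  shows "sim4 G H"
  unfolding sim4_iff[OF assms(1,2)] using assms(3) by (auto simp: cyc_iso_def)

lemma power_map_digraph_iso_iff:
  assumes "finite_grp G" "finite_grp H"
  shows "digraph_iso (with_proj (power_map_digraph t G)) (with_proj (power_map_digraph t H)) \<longleftrightarrow>
    (\<exists>f. bij_betw f (carrier G) (carrier H) \<and>
         (\<forall>x\<in>carrier G. f (x [^]\<^bsub>G\<^esub> t) = f x [^]\<^bsub>H\<^esub> t))" (is "_ \<longleftrightarrow> (\<exists>f. ?P f)")
proof -
  interpret G: finite_grp G by fact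
  interpret H: finite_grp H by fact
  have arcG: "(x, y) \<in> parcs (power_map_digraph t G) \<longleftrightarrow> y = x [^]\<^bsub>G\<^esub> t"
    if "x \<in> carrier G" for x y using that by (auto simp: power_map_digraph_def)
  have arcH: "(x, y) \<in> parcs (power_map_digraph t H) \<longleftrightarrow> y = x [^]\<^bsub>H\<^esub> t"
    if "x \<in> carrier H" for x y using that by (auto simp: power_map_digraph_def)
  have pv: "pverts (power_map_digraph t G) = carrier G" "pverts (power_map_digraph t H) = carrier H"
    by (simp_all add: power_map_digraph_def)
  have "parcs (power_map_digraph t G) \<subseteq> carrier G \<times> carrier G"
    "parcs (power_map_digraph t H) \<subseteq> carrier H \<times> carrier H"
    by (auto simp: power_map_digraph_def)
  then have "digraph_iso (with_proj (power_map_digraph t G)) (with_proj (power_map_digraph t H)) \<longleftrightarrow>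
    (\<exists>f. bij_betw f (carrier G) (carrier H) \<and> (\<forall>x\<in>carrier G. \<forall>y\<in>carrier G.
       (x, y) \<in> parcs (power_map_digraph t G) \<longleftrightarrow> (f x, f y) \<in> parcs (power_map_digraph t H)))"
    using digraph_iso_with_proj_iff[of "power_map_digraph t G" "power_map_digraph t H"]
    unfolding pv by blast
  also have "\<dots> \<longleftrightarrow> (\<exists>f. ?P f)"
  proof (intro ex_cong1 conj_cong refl ball_cong)
    fix f x assume f: "bij_betw f (carrier G) (carrier H)" and x: "x \<in> carrier G"
    have "f x \<in> carrier H" using bij_betw_apply[OF f x] .
    then have "(\<forall>y\<in>carrier G. (x, y) \<in> parcs (power_map_digraph t G) \<longleftrightarrow>
            (f x, f y) \<in> parcs (power_map_digraph t H)) \<longleftrightarrow>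
          (\<forall>y\<in>carrier G. y = x [^]\<^bsub>G\<^esub> t \<longleftrightarrow> f y = f x [^]\<^bsub>H\<^esub> t)"
      using arcG[OF x] arcH by simp
    also have "\<dots> \<longleftrightarrow> f (x [^]\<^bsub>G\<^esub> t) = f x [^]\<^bsub>H\<^esub> t"
      using f x G.int_pow_closed by (metis bij_betw_def inj_on_def)
    finally show "(\<forall>y\<in>carrier G. (x, y) \<in> parcs (power_map_digraph t G) \<longleftrightarrow>
            (f x, f y) \<in> parcs (power_map_digraph t H)) \<longleftrightarrow>
          f (x [^]\<^bsub>G\<^esub> t) = f x [^]\<^bsub>H\<^esub> t" .
  qed
  finally show ?thesis .
qed

lemma sim2_imp_sim5:
  assumes "finite_grp G" "finite_grp H" "sim2 G H"
  shows "sim5 G H"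
  using assms(3) power_map_digraph_iso_iff[OF assms(1,2)] by (auto simp: sim5_def sim2_def)

lemma (in finite_grp) count_order_multiset:
  "count (order_multiset G) d = card {x \<in> carrier G. ord x = d}"
proof -
  have "{x. x \<in> carrier G \<and> d = ord x} = {x \<in> carrier G. ord x = d}" by auto
  then show ?thesis
    by (simp add: order_multiset_def count_image_mset' fin)
qed

lemma (in finite_grp) card_ord_dvd_eq_sum:
  assumes "n > 0"
  shows "card {x \<in> carrier G. ord x dvd n} = (\<Sum>d | d dvd n. card {x \<in> carrier G. ord x = d})"
proof -
  have "{x \<in> carrier G. ord x dvd n} = (\<Union>d\<in>{d. d dvd n}. {x \<in> carrier G. ord x = d})" by auto
  moreover have "card (\<Union>d\<in>{d. d dvd n}. {x \<in> carrier G. ord x = d}) =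
      (\<Sum>d | d dvd n. card {x \<in> carrier G. ord x = d})"
    by (rule card_UN_disjoint) (use assms fin in auto)
  ultimately show ?thesis by simp
qed

lemma (in finite_grp) pow_Suc_eq_iff:
  assumes x: "x \<in> carrier G"
  shows "x [^] int (n + 1) = x \<longleftrightarrow> ord x dvd n"
proof -
  have "x [^] int (n + 1) = x [^] (n + 1)" by (rule int_pow_int)
  also have "\<dots> = x [^] n \<otimes> x" by simp
  finally have "x [^] int (n + 1) = x \<longleftrightarrow> x [^] n = \<one>" using x r_cancel_one by simp
  then show ?thesis using x pow_eq_id by simp
qed

text \<open>The loops of the digraph of the map \<open>g \<mapsto> g\<^bsup>n + 1\<^esup>\<close> are the elements whose order divides
  \<open>n\<close>; counting them for every \<open>n\<close> determines the number of elements of each order, by induction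
  over the divisors.\<close>
lemma sim5_imp_sim6:
  assumes "finite_grp G" "finite_grp H" "sim5 G H"
  shows "sim6 G H"
proof -
  interpret G: finite_grp G by fact
  interpret H: finite_grp H by fact
  have dvd: "card {x \<in> carrier G. G.ord x dvd n} = card {x \<in> carrier H. H.ord x dvd n}" for n
  proof -
    have "digraph_iso (with_proj (power_map_digraph (int (n + 1)) G))
                      (with_proj (power_map_digraph (int (n + 1)) H))"
      using assms(3) unfolding sim5_def by (rule spec)
    then obtain f where bij: "bij_betw f (carrier G) (carrier H)"
      and f: "\<And>x. x \<in> carrier G \<Longrightarrow> f (x [^]\<^bsub>G\<^esub> int (n + 1)) = f x [^]\<^bsub>H\<^esub> int (n + 1)"
      unfolding power_map_digraph_iso_iff[OF assms(1,2)] by (elim exE conjE) (rule that, auto)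
    have *: "G.ord x dvd n \<longleftrightarrow> H.ord (f x) dvd n" if x: "x \<in> carrier G" for x
    proof -
      have fx: "f x \<in> carrier H" using bij_betw_apply[OF bij x] .
      have "x [^]\<^bsub>G\<^esub> int (n + 1) = x \<longleftrightarrow> f (x [^]\<^bsub>G\<^esub> int (n + 1)) = f x"
        using inj_on_eq_iff[OF bij_betw_imp_inj_on[OF bij] G.int_pow_closed[OF x] x] by simp
      then show ?thesis unfolding f[OF x] G.pow_Suc_eq_iff[OF x] H.pow_Suc_eq_iff[OF fx] .
    qed
    have "f ` {x \<in> carrier G. G.ord x dvd n} = {x \<in> carrier H. H.ord x dvd n}"
    proof
      show "f ` {x \<in> carrier G. G.ord x dvd n} \<subseteq> {x \<in> carrier H. H.ord x dvd n}"
        using * bij_betw_apply[OF bij] by blast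
      show "{x \<in> carrier H. H.ord x dvd n} \<subseteq> f ` {x \<in> carrier G. G.ord x dvd n}"
      proof clarify
        fix v assume v: "v \<in> carrier H" "H.ord v dvd n"
        then obtain u where "u \<in> carrier G" "v = f u"
          using bij_betw_imp_surj_on[OF bij] by blast
        then show "v \<in> f ` {x \<in> carrier G. G.ord x dvd n}" using * v by blast
      qed
    qed
    moreover have "inj_on f {x \<in> carrier G. G.ord x dvd n}"
      by (rule inj_on_subset[OF bij_betw_imp_inj_on[OF bij]]) auto
    ultimately show ?thesis using card_image by fastforce
  qed
  have eq: "card {x \<in> carrier G. G.ord x = d} = card {x \<in> carrier H. H.ord x = d}" for d
  proof (induction d rule: less_induct)
    case (less d)
    show ?case
    proof (cases "d = 0")
      case True
      have "{x \<in> carrier G. G.ord x = d} = {}" "{x \<in> carrier H. H.ord x = d} = {}"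
        using True G.ord_pos H.ord_pos by fastforce+
      then show ?thesis by (simp only: card.empty)
    next
      case False
      have split: "{k. k dvd d} = insert d {k. k dvd d \<and> k < d}"
        using False by (auto dest: dvd_imp_le)
      have "(\<Sum>k | k dvd d \<and> k < d. card {x \<in> carrier G. G.ord x = k}) =
            (\<Sum>k | k dvd d \<and> k < d. card {x \<in> carrier H. H.ord x = k})"
        by (rule sum.cong) (auto simp: less.IH)
      then show ?thesis
        using dvd[of d] G.card_ord_dvd_eq_sum[of d] H.card_ord_dvd_eq_sum[of d] False split by simp
    qed
  qed
  show ?thesis unfolding sim6_def
    by (rule multiset_eqI) (simp add: eq G.count_order_multiset H.count_order_multiset)
qed

text \<open>Used to match elements by their orders, or by their orders within corresponding twin classes.\<close>
lemma ex_label_preserving_bij: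
  assumes fin: "finite A" "finite B"
    and card: "\<And>k. card {x \<in> A. l x = k} = card {y \<in> B. l' y = k}"
  obtains g where "bij_betw g A B" "\<And>x. x \<in> A \<Longrightarrow> l' (g x) = l x"
proof -
  have "\<exists>h. bij_betw h {x \<in> A. l x = k} {y \<in> B. l' y = k}" for k
    using fin card by (intro finite_same_card_bij) auto
  then obtain h where h: "\<And>k. bij_betw (h k) {x \<in> A. l x = k} {y \<in> B. l' y = k}" by metis
  define g where "g x = h (l x) x" for x
  have g: "g x \<in> B \<and> l' (g x) = l x" if "x \<in> A" for x
    using bij_betw_apply[OF h[of "l x"], of x] that by (simp add: g_def)
  have "inj_on g A"
  proof (rule inj_onI)
    fix x y assume xy: "x \<in> A" "y \<in> A" "g x = g y"
    then have "l x = l y" using g by metis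
    then show "x = y" using xy h[of "l x"] by (auto simp: g_def bij_betw_def inj_on_def)
  qed
  moreover have "B \<subseteq> g ` A"
  proof
    fix y assume "y \<in> B"
    then have "y \<in> h (l' y) ` {x \<in> A. l x = l' y}" using h[of "l' y"] by (auto simp: bij_betw_def)
    then show "y \<in> g ` A" unfolding g_def by (auto intro!: rev_image_eqI)
  qed
  ultimately have "bij_betw g A B" using g by (auto simp: bij_betw_def)
  then show thesis using that g by blast
qed

section \<open>Compatible generators of the cyclic subgroups\<close>

hide_const (open) Divisibility.prime

context finite_grp
begin

text \<open>\<open>g\<close> may be taken as the value of \<open>\<gamma>\<close> at \<open>C\<close>, given the values at the proper subgroups of \<open>C\<close>.
  Compatibility with the subgroups of prime index implies it for all subgroups.\<close>
definition compatible_generator :: "('a set \<Rightarrow> 'a) \<Rightarrow> 'a set \<Rightarrow> 'a \<Rightarrow> bool" where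
  "compatible_generator \<gamma> C g \<longleftrightarrow> g \<in> carrier G \<and> cyc G g = C \<and>
     (\<forall>p. prime p \<longrightarrow> p dvd card C \<longrightarrow> \<gamma> (cyc G (g [^] p)) = g [^] p)"

lemma ord_pow_of_dvd:
  assumes "x \<in> carrier G" "p dvd ord x"
  shows "ord (x [^] p) = ord x div p"
  using assms ord_pow[OF assms] ord_pos by fastforce

text \<open>The compatible generators \<open>\<gamma>\<^sub>p\<close> of the subgroups of prime index \<open>p\<close> of a cyclic group \<open>C\<close>
  satisfy \<open>\<gamma>\<^sub>p\<^sup>q = \<gamma>\<^sub>q\<^sup>p\<close>, and a generator \<open>g\<close> with \<open>g\<^sup>p = \<gamma>\<^sub>p\<close> for all \<open>p\<close> is wanted. If two primes
  \<open>p \<noteq> q\<close> divide the order and \<open>a p + b q = 1\<close>, then \<open>g = \<gamma>\<^sub>p\<^sup>a \<gamma>\<^sub>q\<^sup>b\<close> works; if there is only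
  one prime \<open>p\<close>, any \<open>p\<close>-th root of \<open>\<gamma>\<^sub>p\<close> works as soon as \<open>\<gamma>\<^sub>p \<noteq> \<one>\<close>.\<close>
lemma ex_compatible_generator:
  assumes c: "c \<in> carrier G"
    and \<gamma>: "\<And>x. x \<in> carrier G \<Longrightarrow> ord x < ord c \<Longrightarrow> compatible_generator \<gamma> (cyc G x) (\<gamma> (cyc G x))"
  shows "\<exists>g. compatible_generator \<gamma> (cyc G c) g"
proof -
  define N where "N = ord c"
  have N0: "N > 0" using c ord_pos N_def by simp
  define \<delta> where "\<delta> p = \<gamma> (cyc G (c [^] (p::nat)))" for p
  have ordp: "ord (c [^] p) = N div p" if "p dvd N" for p
    using ord_pow_of_dvd c that N_def by simp
  have ok: "compatible_generator \<gamma> (cyc G (c [^] p)) (\<delta> p)" if "prime p" "p dvd N" for p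
    unfolding \<delta>_def
  proof (rule \<gamma>)
    have "N div p < N" using N0 prime_gt_1_nat[OF that(1)] by (simp add: div_less_dividend)
    then show "ord (c [^] p) < ord c" using ordp[OF that(2)] N_def by simp
  qed (use c in simp)
  have \<delta>c: "\<delta> p \<in> carrier G" and \<delta>cyc: "cyc G (\<delta> p) = cyc G (c [^] p)"
    if "prime p" "p dvd N" for p
    using ok[OF that] by (auto simp: compatible_generator_def)
  have \<delta>ord: "ord (\<delta> p) = N div p" if "prime p" "p dvd N" for p
    using cyc_cardD[OF \<delta>cyc[OF that]] \<delta>c[OF that] c ordp[OF that(2)] by simp
  have \<delta>in: "\<delta> p \<in> cyc G (c [^] p)" if "prime p" "p dvd N" for p
    using \<delta>cyc[OF that] cyc_refl by blast
  have \<delta>inc: "\<delta> p \<in> cyc G c" if "prime p" "p dvd N" for p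
    using \<delta>in[OF that] cyc_nat_pow[OF c] cyc_trans c by blast
  have \<delta>pow: "\<gamma> (cyc G (\<delta> p [^] q)) = \<delta> p [^] q"
    if p: "prime p" "p dvd N" and q: "prime q" "q dvd ord (\<delta> p)" for p q
  proof -
    have "card (cyc G (c [^] p)) = ord (\<delta> p)"
      using card_cyc[of "c [^] p"] ordp[OF p(2)] \<delta>ord[OF p] c by simp
    then show ?thesis using ok[OF p] q unfolding compatible_generator_def by metis
  qed
  have comm: "\<delta> p [^] q = \<delta> q [^] p" if p: "prime p" "p dvd N" and q: "prime q" "q dvd N" for p q
  proof (cases "p = q")
    case False
    have pq: "coprime p q" using False p q primes_coprime by blast
    then have "p * q dvd N" using p q by (simp add: divides_mult)
    then have qd: "q dvd ord (\<delta> p)" and pd: "p dvd ord (\<delta> q)"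
      unfolding \<delta>ord[OF p] \<delta>ord[OF q] using p q
      by (simp_all add: dvd_div_iff_mult prime_gt_0_nat mult.commute)
    have "\<gamma> (cyc G (\<delta> p [^] q)) = \<delta> p [^] q" "\<gamma> (cyc G (\<delta> q [^] p)) = \<delta> q [^] p"
      using \<delta>pow[OF p q(1) qd] \<delta>pow[OF q p(1) pd] .
    moreover have "cyc G (\<delta> p [^] q) = cyc G (\<delta> q [^] p)"
    proof (rule cyc_eq_of_ord[OF c])
      show "\<delta> p [^] q \<in> cyc G c" "\<delta> q [^] p \<in> cyc G c"
        using cyc_trans[OF cyc_nat_pow[OF \<delta>c[OF p]] \<delta>inc[OF p] c]
          cyc_trans[OF cyc_nat_pow[OF \<delta>c[OF q]] \<delta>inc[OF q] c] by blast+
      have "ord (\<delta> p [^] q) = N div p div q" "ord (\<delta> q [^] p) = N div q div p"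
        using ord_pow_of_dvd[OF \<delta>c[OF p] qd] ord_pow_of_dvd[OF \<delta>c[OF q] pd]
        unfolding \<delta>ord[OF p] \<delta>ord[OF q] by blast+
      then show "ord (\<delta> p [^] q) = ord (\<delta> q [^] p)"
        by (metis div_mult2_eq mult.commute)
    qed
    ultimately show ?thesis by metis
  qed simp
  \<comment> \<open>The compatibility condition at \<open>C\<close> only concerns \<open>p\<close>-th powers for primes \<open>p\<close>.\<close>
  have suff: "compatible_generator \<gamma> (cyc G c) g"
    if g: "g \<in> cyc G c" and ord: "ord g = N"
      and root: "\<And>r. prime r \<Longrightarrow> r dvd N \<Longrightarrow> g [^] r = \<delta> r" for g
  proof -
    have "cyc G g = cyc G c" using cyc_eq_of_ord[OF c g cyc_refl] ord N_def by simp
    moreover have "\<gamma> (cyc G (g [^] r)) = g [^] r" if "prime r" "r dvd N" for r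
      using \<delta>cyc[OF that] root[OF that] by (simp add: \<delta>_def)
    ultimately show ?thesis using g c cyc_carrier
      by (auto simp: compatible_generator_def card_cyc N_def)
  qed
  show ?thesis
  proof (cases "N = 1")
    case True
    then show ?thesis using suff[of c] by (auto simp: N_def)
  next
    case False
    then obtain p where p: "prime p" "p dvd N" using prime_factor_nat by blast
    show ?thesis
    proof (cases "\<exists>q. prime q \<and> q dvd N \<and> q \<noteq> p")
      case True
      then obtain q where q: "prime q" "q dvd N" and "q \<noteq> p" by blast
      then have cop: "coprime p q" using p primes_coprime by blast
      have "\<exists>i::int. prime r \<longrightarrow> r dvd N \<longrightarrow> \<delta> r = c [^] i" for r
        using \<delta>inc cyc_iff[OF c] by blast
      then obtain e :: "nat \<Rightarrow> int" where
        e: "\<And>r. prime r \<Longrightarrow> r dvd N \<Longrightarrow> \<delta> r = c [^] e r"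
        by metis
      obtain a b where ab: "a * int p + b * int q = 1"
        using bezout_int[of "int p" "int q"] cop by (auto simp: mult.commute)
      \<comment> \<open>This is \<open>\<gamma>\<^sub>p\<^sup>a \<gamma>\<^sub>q\<^sup>b\<close>, since \<open>\<gamma>\<^sub>r = c\<^bsup>e r\<^esup>\<close> for all primes \<open>r\<close>.\<close>
      define g where "g = c [^] (a * e p + b * e q)"
      have gc: "g \<in> carrier G" using c g_def by simp
      have root: "g [^] r = \<delta> r" if r: "prime r" "r dvd N" for r
      proof -
        have "c [^] (e p * int r) = c [^] (e r * int p)" "c [^] (e q * int r) = c [^] (e r * int q)"
          using comm[OF p r] comm[OF q r] e[OF p] e[OF q] e[OF r] c
          by (metis int_pow_int int_pow_pow)+
        then have "int N dvd e r * int p - e p * int r" "int N dvd e r * int q - e q * int r"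
          using c by (auto simp: int_pow_eq N_def)
        then have "int N dvd a * (e r * int p - e p * int r) + b * (e r * int q - e q * int r)"
          by auto
        also have "\<dots> = e r * (a * int p + b * int q) - (a * e p + b * e q) * int r"
          by (simp add: algebra_simps)
        finally have "int N dvd e r - (a * e p + b * e q) * int r" using ab by simp
        then have "c [^] ((a * e p + b * e q) * int r) = c [^] e r"
          using c by (simp add: int_pow_eq N_def)
        then have "(c [^] (a * e p + b * e q)) [^] int r = c [^] e r"
          using c by (simp add: int_pow_pow)
        then show ?thesis using e[OF r] by (simp add: g_def int_pow_int)
      qed
      have ginc: "g \<in> cyc G c" using cyc_int_pow c g_def by simp
      have "N dvd ord g * r" if r: "prime r" "r dvd N" for r
      proof -
        have "N div r dvd ord g"
          using cyc_ord_dvd[OF cyc_nat_pow[OF gc] gc, of r] root[OF r] \<delta>ord[OF r] by simp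
        then show ?thesis using r by (metis dvd_div_mult_self mult_dvd_mono dvd_refl)
      qed
      then have "N dvd gcd (ord g * p) (ord g * q)" using p q by simp
      then have "N dvd ord g" using cop by (simp add: gcd_mult_distrib_nat[symmetric])
      then have "ord g = N" using cyc_ord_dvd[OF ginc c] N_def dvd_antisym by auto
      then show ?thesis using suff[OF ginc] root by blast
    next
      case only: False
      show ?thesis
      proof (cases "N = p")
        case True
        have "\<delta> p \<in> cyc G \<one>" using \<delta>in[OF p] pow_ord_eq_1[OF c] True N_def by metis
        then have "\<delta> p = \<one>" by (simp add: generate_one)
        then have "c [^] p = \<delta> p" using True N_def c by auto
        moreover have "r = p" if "prime r" "r dvd N" for r
          using that True p(1) primes_dvd_imp_eq by blast
        ultimately show ?thesis using suff[OF cyc_refl] N_def by blast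
      next
        case False
        then have "N div p \<noteq> 1" using p by (metis dvd_div_mult_self mult_1)
        then obtain q where "prime q" "q dvd N div p" using prime_factor_nat by blast
        moreover have "N div p dvd N" using p by (metis dvd_div_mult_self dvd_triv_left)
        ultimately have pp: "p dvd N div p" using only dvd_trans by blast
        obtain j :: int where j: "\<delta> p = (c [^] p) [^] j"
          using \<delta>in[OF p] cyc_iff c by auto
        define g where "g = c [^] j"
        have gc: "g \<in> carrier G" using c g_def by simp
        have gp: "g [^] p = \<delta> p"
          unfolding g_def j using c by (metis int_pow_int int_pow_pow mult.commute)
        have ginc: "g \<in> cyc G c" using cyc_int_pow c g_def by simp
        have "N div p dvd ord g"
          using cyc_ord_dvd[OF cyc_nat_pow[OF gc] gc, of p] gp \<delta>ord[OF p] by simp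
        then have pg: "p dvd ord g" using pp dvd_trans by blast
        then have "ord g div p = N div p" using ord_pow_of_dvd[OF gc pg] gp \<delta>ord[OF p] by simp
        then have "ord g = N" using pg p(2) by (metis dvd_div_mult_self)
        moreover have "g [^] r = \<delta> r" if "prime r" "r dvd N" for r using only that gp by auto
        ultimately show ?thesis using suff[OF ginc] by blast
      qed
    qed
  qed
qed

lemma ex_compatible_generators_upto:
  "\<exists>\<gamma>. \<forall>x\<in>carrier G. ord x \<le> n \<longrightarrow> compatible_generator \<gamma> (cyc G x) (\<gamma> (cyc G x))"
proof (induction n)
  case 0
  have "\<not> ord x \<le> 0" if "x \<in> carrier G" for x using ord_pos[OF that] by simp
  then show ?case by blast
next
  case (Suc n)
  then obtain \<gamma> where
    \<gamma>: "\<And>x. x \<in> carrier G \<Longrightarrow> ord x \<le> n \<Longrightarrow> compatible_generator \<gamma> (cyc G x) (\<gamma> (cyc G x))"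
    by blast
  define \<gamma>' where "\<gamma>' C = (if card C = Suc n then SOME g. compatible_generator \<gamma> C g else \<gamma> C)" for C
  have "compatible_generator \<gamma>' (cyc G x) (\<gamma>' (cyc G x))"
    if x: "x \<in> carrier G" and le: "ord x \<le> Suc n" for x
  proof -
    have old: "compatible_generator \<gamma> (cyc G x) (\<gamma>' (cyc G x))"
    proof (cases "ord x = Suc n")
      case True
      then have "\<exists>g. compatible_generator \<gamma> (cyc G x) g"
        by (intro ex_compatible_generator x \<gamma>) simp_all
      then have "compatible_generator \<gamma> (cyc G x) (SOME g. compatible_generator \<gamma> (cyc G x) g)"
        by (rule someI_ex)
      then show ?thesis using True card_cyc[OF x] by (simp add: \<gamma>'_def)
    next
      case False
      then show ?thesis using \<gamma>[OF x] le card_cyc[OF x] by (simp add: \<gamma>'_def)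
    qed
    define g where "g = \<gamma>' (cyc G x)"
    have g: "g \<in> carrier G" "cyc G g = cyc G x"
      using old unfolding compatible_generator_def g_def by blast+
    then have og: "ord g = ord x" using cyc_cardD x by blast
    have "\<gamma>' (cyc G (g [^] p)) = g [^] p" if p: "prime p" "p dvd card (cyc G x)" for p
    proof -
      have pd: "p dvd ord g" using p(2) og card_cyc[OF x] by simp
      have "ord (g [^] p) < ord g"
        unfolding ord_pow_of_dvd[OF g(1) pd]
        using ord_pos[OF g(1)] prime_gt_1_nat[OF p(1)] by (simp add: div_less_dividend)
      then have "card (cyc G (g [^] p)) \<noteq> Suc n"
        using og le g(1) card_cyc[of "g [^] p"] by simp
      then have "\<gamma>' (cyc G (g [^] p)) = \<gamma> (cyc G (g [^] p))" by (simp add: \<gamma>'_def)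
      then show ?thesis using old p unfolding compatible_generator_def g_def by metis
    qed
    then show ?thesis using g unfolding compatible_generator_def g_def by blast
  qed
  then show ?case by blast
qed

text \<open>Compatibility passes from prime indices to an arbitrary index \<open>m\<close> by splitting off one prime
  factor of \<open>m\<close> at a time.\<close>
lemma ex_compatible_generators:
  "\<exists>\<gamma>. \<forall>y\<in>carrier G. \<gamma> (cyc G y) \<in> carrier G \<and> cyc G (\<gamma> (cyc G y)) = cyc G y \<and>
     (\<forall>x\<in>cyc G y. \<gamma> (cyc G x) = \<gamma> (cyc G y) [^] (ord y div ord x))"
proof -
  obtain \<gamma> where "\<forall>x\<in>carrier G. ord x \<le> order G \<longrightarrow> compatible_generator \<gamma> (cyc G x) (\<gamma> (cyc G x))"
    using ex_compatible_generators_upto by blast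
  then have \<gamma>: "compatible_generator \<gamma> (cyc G x) (\<gamma> (cyc G x))" if "x \<in> carrier G" for x
    using that ord_le_group_order[OF fin] by blast
  have gen: "\<gamma> (cyc G x) \<in> carrier G" "cyc G (\<gamma> (cyc G x)) = cyc G x" if "x \<in> carrier G" for x
    using \<gamma>[OF that] by (auto simp: compatible_generator_def)
  have og: "ord (\<gamma> (cyc G x)) = ord x" if "x \<in> carrier G" for x
    using cyc_cardD gen that by blast
  have pow: "\<gamma> (cyc G (\<gamma> (cyc G x) [^] m)) = \<gamma> (cyc G x) [^] m"
    if "x \<in> carrier G" "m dvd ord x" for x m
    using that
  proof (induction m arbitrary: x rule: less_induct)
    case (less m)
    define g where "g = \<gamma> (cyc G x)"
    have g: "g \<in> carrier G" "cyc G g = cyc G x" "ord g = ord x"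
      using gen og less.prems g_def by auto
    show ?case
    proof (cases "m = 1")
      case True
      then show ?thesis using g by (simp add: g_def)
    next
      case False
      then obtain p where p: "prime p" "p dvd m" using prime_factor_nat by blast
      then obtain m' where m': "m = p * m'" by (auto elim: dvdE)
      have m0: "m \<noteq> 0" using less.prems ord_pos[of x] by (metis dvd_0_left less_irrefl)
      then have m'lt: "m' < m" using m' prime_gt_1_nat[OF p(1)] by auto
      define y where "y = g [^] p"
      have y: "y \<in> carrier G" using g y_def by simp
      have pd: "p dvd ord g" using p less.prems g dvd_trans by auto
      have \<gamma>y: "\<gamma> (cyc G y) = y"
        using \<gamma>[OF less.prems(1)] p(1) pd g less.prems(1)
        by (auto simp: compatible_generator_def g_def y_def card_cyc)
      have "m' dvd ord y"
        unfolding y_def ord_pow_of_dvd[OF g(1) pd]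
        using less.prems(2) m' g(3) pd p(1) by (simp add: dvd_div_iff_mult prime_gt_0_nat mult.commute)
      then have "\<gamma> (cyc G (y [^] m')) = y [^] m'" using less.IH[OF m'lt y] \<gamma>y by simp
      moreover have "y [^] m' = g [^] m" using g m' y_def by (simp add: nat_pow_pow)
      ultimately show ?thesis by (simp add: g_def)
    qed
  qed
  have "\<gamma> (cyc G x) = \<gamma> (cyc G y) [^] (ord y div ord x)" if y: "y \<in> carrier G" and xy: "x \<in> cyc G y" for x y
  proof -
    define m where "m = ord y div ord x"
    define g where "g = \<gamma> (cyc G y)"
    have x: "x \<in> carrier G" using xy y cyc_carrier by blast
    have d: "ord x dvd ord y" using cyc_ord_dvd xy y by blast
    have g: "g \<in> carrier G" "cyc G g = cyc G y" "ord g = ord y"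
      using gen og y g_def by auto
    have md: "m dvd ord y" using d m_def by (metis dvd_div_mult_self dvd_triv_left)
    have "ord (g [^] m) = ord x"
      using ord_pow_of_dvd[OF g(1), of m] md g d ord_pos[OF y] m_def
      by (auto elim!: dvdE)
    moreover have "g [^] m \<in> cyc G y" using cyc_nat_pow[OF g(1)] g(2) by blast
    ultimately have "cyc G (g [^] m) = cyc G x" using cyc_eq_of_ord[OF y _ xy] by blast
    then show ?thesis using pow[OF y md] by (simp add: g_def m_def)
  qed
  then show ?thesis using gen by blast
qed

end

text \<open>The map sends \<open>\<gamma>(C)\<^sup>k\<close> to \<open>\<gamma>'(F C)\<^sup>k\<close>, where \<open>\<gamma>\<close> and \<open>\<gamma>'\<close> are compatible generators in the two groups.
  Taking \<open>C = \<langle>x\<rangle>\<close> defines it at \<open>x\<close>, and compatibility shows that any other cyclic subgroup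
  containing \<open>x\<close> gives the same value; hence it commutes with powers.\<close>
lemma sim3_imp_sim2:
  assumes fG: "finite_grp G" and fH: "finite_grp H" and sim: "sim3 G H"
  shows "sim2 G H"
proof -
  interpret G: finite_grp G by fact
  interpret H: finite_grp H by fact
  obtain F where F: "bij_betw F (cyclic_subgroups G) (cyclic_subgroups H) \<and>
     (\<forall>C\<in>cyclic_subgroups G. \<forall>D\<in>cyclic_subgroups G. D \<subset> C \<longleftrightarrow> F D \<subset> F C) \<and>
     (\<forall>C\<in>cyclic_subgroups G. card (F C) = card C)"
    using sim[unfolded sim3_iff[OF fG fH]] by (rule exE)
  note bijF = F[THEN conjunct1]
    and psub = F[THEN conjunct2, THEN conjunct1, rule_format]
    and cardF = F[THEN conjunct2, THEN conjunct2, rule_format]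
  obtain \<gamma> where \<gamma>: "\<forall>y\<in>carrier G. \<gamma> (cyc G y) \<in> carrier G \<and>
      cyc G (\<gamma> (cyc G y)) = cyc G y \<and>
      (\<forall>x\<in>cyc G y. \<gamma> (cyc G x) = \<gamma> (cyc G y) [^]\<^bsub>G\<^esub> (G.ord y div G.ord x))"
    using G.ex_compatible_generators by (rule exE)
  note \<gamma>c = bspec[OF \<gamma>, THEN conjunct1]
    and \<gamma>cyc = bspec[OF \<gamma>, THEN conjunct2, THEN conjunct1]
    and \<gamma>pow = bspec[OF \<gamma>, THEN conjunct2, THEN conjunct2, THEN bspec]
  obtain \<gamma>' where \<gamma>': "\<forall>y\<in>carrier H. \<gamma>' (cyc H y) \<in> carrier H \<and>
      cyc H (\<gamma>' (cyc H y)) = cyc H y \<and>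
      (\<forall>x\<in>cyc H y. \<gamma>' (cyc H x) = \<gamma>' (cyc H y) [^]\<^bsub>H\<^esub> (H.ord y div H.ord x))"
    using H.ex_compatible_generators by (rule exE)
  note \<gamma>'c = bspec[OF \<gamma>', THEN conjunct1]
    and \<gamma>'cyc = bspec[OF \<gamma>', THEN conjunct2, THEN conjunct1]
    and \<gamma>'pow = bspec[OF \<gamma>', THEN conjunct2, THEN conjunct2, THEN bspec]
  have csG: "cyc G x \<in> cyclic_subgroups G" if "x \<in> carrier G" for x
    unfolding G.cyclic_subgroups_eq using that by (rule imageI)
  define a where "a x = \<gamma> (cyc G x)" for x
  define b where "b x = \<gamma>' (F (cyc G x))" for x
  have ac: "a x \<in> carrier G" and acyc: "cyc G (a x) = cyc G x" if "x \<in> carrier G" for x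
    unfolding a_def using \<gamma>c[OF that] \<gamma>cyc[OF that] .
  have aord: "G.ord (a x) = G.ord x" if "x \<in> carrier G" for x
    using G.cyc_cardD[OF acyc[OF that] ac[OF that] that] .
  have ex_rep: "\<exists>h\<in>carrier H. F (cyc G x) = cyc H h \<and> H.ord h = G.ord x" if x: "x \<in> carrier G" for x
  proof -
    have "F (cyc G x) \<in> cyclic_subgroups H" using bij_betw_apply[OF bijF csG[OF x]] .
    then obtain h where h: "h \<in> carrier H" "F (cyc G x) = cyc H h"
      unfolding H.cyclic_subgroups_eq by (elim imageE) (rule that)
    have "H.ord h = G.ord x"
      using cardF[OF csG[OF x]] unfolding h(2) H.card_cyc[OF h(1)] G.card_cyc[OF x] .
    then show ?thesis using h by (intro bexI[of _ h] conjI)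
  qed
  have bc: "b x \<in> carrier H" and bcyc: "cyc H (b x) = F (cyc G x)" and bord: "H.ord (b x) = G.ord x"
    if x: "x \<in> carrier G" for x
  proof -
    obtain h where h: "h \<in> carrier H" "F (cyc G x) = cyc H h" "H.ord h = G.ord x"
      using ex_rep[OF x] by blast
    show 1: "b x \<in> carrier H" unfolding b_def h(2) by (rule \<gamma>'c[OF h(1)])
    show 2: "cyc H (b x) = F (cyc G x)" unfolding b_def h(2) by (rule \<gamma>'cyc[OF h(1)])
    show "H.ord (b x) = G.ord x"
      using H.cyc_cardD[OF 2[unfolded h(2)] 1 h(1)] h(3) by (rule trans)
  qed
  have apow: "a x = a y [^]\<^bsub>G\<^esub> (G.ord y div G.ord x)" if "y \<in> carrier G" "x \<in> cyc G y" for x y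
    unfolding a_def using that by (rule \<gamma>pow)
  have bpow: "b x = b y [^]\<^bsub>H\<^esub> (G.ord y div G.ord x)" if y: "y \<in> carrier G" and xy: "x \<in> cyc G y" for x y
  proof -
    have x: "x \<in> carrier G" using G.cyc_carrier xy y by blast
    obtain h where h: "h \<in> carrier H" "F (cyc G x) = cyc H h" "H.ord h = G.ord x"
      using ex_rep[OF x] by blast
    obtain k where k: "k \<in> carrier H" "F (cyc G y) = cyc H k" "H.ord k = G.ord y"
      using ex_rep[OF y] by blast
    have "cyc G x \<subseteq> cyc G y" using G.cyc_mono xy y by blast
    then have "F (cyc G x) \<subseteq> F (cyc G y)"
      using psub[OF csG[OF y] csG[OF x]] by (cases "cyc G x = cyc G y") auto
    then have "h \<in> cyc H k" using h k H.cyc_refl by blast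
    then show ?thesis unfolding b_def h(2) k(2) h(3)[symmetric] k(3)[symmetric]
      by (rule \<gamma>'pow[OF k(1)])
  qed
  have ex_k: "\<exists>i::int. x = a x [^]\<^bsub>G\<^esub> i" if x: "x \<in> carrier G" for x
    using G.cyc_refl[of x] unfolding acyc[OF x, symmetric] G.cyc_iff[OF ac[OF x]] .
  define k where "k x = (SOME i::int. x = a x [^]\<^bsub>G\<^esub> i)" for x
  have k: "x = a x [^]\<^bsub>G\<^esub> k x" if "x \<in> carrier G" for x
    unfolding k_def using ex_k[OF that] by (rule someI_ex)
  define \<phi> where "\<phi> x = b x [^]\<^bsub>H\<^esub> k x" for x
  have same: "a y [^]\<^bsub>G\<^esub> i = a y [^]\<^bsub>G\<^esub> j \<longleftrightarrow> b y [^]\<^bsub>H\<^esub> i = b y [^]\<^bsub>H\<^esub> j"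
    if y: "y \<in> carrier G" for y and i j :: int
    by (simp add: G.int_pow_eq[OF ac[OF y]] H.int_pow_eq[OF bc[OF y]] aord[OF y] bord[OF y])
  \<comment> \<open>Independence of the cyclic subgroup used to write the argument as a power.\<close>
  have key: "\<phi> (a y [^]\<^bsub>G\<^esub> i) = b y [^]\<^bsub>H\<^esub> i" if y: "y \<in> carrier G" for y and i :: int
  proof -
    define x where "x = a y [^]\<^bsub>G\<^esub> i"
    have xy: "x \<in> cyc G y" using G.cyc_int_pow[OF ac[OF y]] unfolding acyc[OF y] x_def .
    have x: "x \<in> carrier G" using G.cyc_carrier xy y by blast
    define m where "m = int (G.ord y div G.ord x)"
    have am: "a x = a y [^]\<^bsub>G\<^esub> m" unfolding m_def int_pow_int by (rule apow[OF y xy])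
    have bm: "b x = b y [^]\<^bsub>H\<^esub> m" unfolding m_def int_pow_int by (rule bpow[OF y xy])
    have "a y [^]\<^bsub>G\<^esub> i = (a y [^]\<^bsub>G\<^esub> m) [^]\<^bsub>G\<^esub> k x"
      using k[OF x] unfolding am[symmetric] x_def[symmetric] .
    also have "\<dots> = a y [^]\<^bsub>G\<^esub> (m * k x)" by (rule G.int_pow_pow[OF ac[OF y]])
    finally have "a y [^]\<^bsub>G\<^esub> i = a y [^]\<^bsub>G\<^esub> (m * k x)" .
    then have "b y [^]\<^bsub>H\<^esub> i = b y [^]\<^bsub>H\<^esub> (m * k x)" using same[OF y] by blast
    also have "\<dots> = \<phi> x" unfolding \<phi>_def bm by (rule H.int_pow_pow[OF bc[OF y], symmetric])
    finally show ?thesis unfolding x_def by (rule sym)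
  qed
  have hom: "\<phi> (x [^]\<^bsub>G\<^esub> t) = \<phi> x [^]\<^bsub>H\<^esub> t" if x: "x \<in> carrier G" for x and t :: int
  proof -
    have "x [^]\<^bsub>G\<^esub> t = (a x [^]\<^bsub>G\<^esub> k x) [^]\<^bsub>G\<^esub> t" using k[OF x] by (rule arg_cong)
    also have "\<dots> = a x [^]\<^bsub>G\<^esub> (k x * t)" by (rule G.int_pow_pow[OF ac[OF x]])
    finally have "\<phi> (x [^]\<^bsub>G\<^esub> t) = b x [^]\<^bsub>H\<^esub> (k x * t)" unfolding key[OF x, symmetric] by (rule arg_cong)
    also have "\<dots> = \<phi> x [^]\<^bsub>H\<^esub> t" unfolding \<phi>_def by (rule H.int_pow_pow[OF bc[OF x], symmetric])
    finally show ?thesis .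
  qed
  have \<phi>c: "\<phi> x \<in> carrier H" if "x \<in> carrier G" for x
    unfolding \<phi>_def by (rule H.int_pow_closed[OF bc[OF that]])
  have \<phi>cyc: "cyc H (\<phi> x) = F (cyc G x)" if x: "x \<in> carrier G" for x
  proof -
    have in1: "\<phi> x \<in> cyc H (b x)" unfolding \<phi>_def by (rule H.cyc_int_pow[OF bc[OF x]])
    obtain i :: int where i: "a x = x [^]\<^bsub>G\<^esub> i"
      using G.cyc_iff[OF x] acyc[OF x] G.cyc_refl by blast
    have "\<phi> (a x) = b x"
      using key[OF x, of 1] unfolding G.int_pow_1[OF ac[OF x]] H.int_pow_1[OF bc[OF x]] .
    moreover have "\<phi> (a x) = \<phi> x [^]\<^bsub>H\<^esub> i" unfolding i by (rule hom[OF x])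
    ultimately have "b x \<in> cyc H (\<phi> x)" using H.cyc_int_pow[OF \<phi>c[OF x]] by metis
    then have "cyc H (\<phi> x) = cyc H (b x)"
      using in1 H.cyc_mono[OF _ bc[OF x]] H.cyc_mono[OF _ \<phi>c[OF x]] by blast
    then show ?thesis using bcyc[OF x] by (rule trans)
  qed
  have "inj_on \<phi> (carrier G)"
  proof (rule inj_onI)
    fix x y assume x: "x \<in> carrier G" and y: "y \<in> carrier G" and eq: "\<phi> x = \<phi> y"
    have "F (cyc G x) = F (cyc G y)"
      using eq unfolding \<phi>cyc[OF x, symmetric] \<phi>cyc[OF y, symmetric] by (rule arg_cong)
    then have C: "cyc G x = cyc G y"
      by (rule inj_onD[OF bij_betw_imp_inj_on[OF bijF] _ csG[OF x] csG[OF y]])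
    have ab: "a x = a y" "b x = b y" unfolding a_def b_def C by (rule refl)+
    have "b y [^]\<^bsub>H\<^esub> k x = b y [^]\<^bsub>H\<^esub> k y" using eq unfolding \<phi>_def ab .
    then have "a y [^]\<^bsub>G\<^esub> k x = a y [^]\<^bsub>G\<^esub> k y" unfolding same[OF y] .
    then have "a x [^]\<^bsub>G\<^esub> k x = a y [^]\<^bsub>G\<^esub> k y" unfolding ab .
    then show "x = y" unfolding k[OF x, symmetric] k[OF y, symmetric] .
  qed
  moreover have "carrier H \<subseteq> \<phi> ` carrier G"
  proof
    fix h assume h: "h \<in> carrier H"
    then have "cyc H h \<in> F ` cyclic_subgroups G"
      unfolding bij_betw_imp_surj_on[OF bijF] H.cyclic_subgroups_eq by (rule imageI)
    then obtain y where y: "y \<in> carrier G" "F (cyc G y) = cyc H h"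
      unfolding G.cyclic_subgroups_eq by (elim imageE) (rule that, simp_all)
    have "h \<in> cyc H (b y)" unfolding bcyc[OF y(1)] y(2) by (rule H.cyc_refl)
    then obtain i :: int where "h = b y [^]\<^bsub>H\<^esub> i" unfolding H.cyc_iff[OF bc[OF y(1)]] by (rule exE)
    then have "h = \<phi> (a y [^]\<^bsub>G\<^esub> i)" unfolding key[OF y(1)] .
    then show "h \<in> \<phi> ` carrier G" using G.int_pow_closed[OF ac[OF y(1)]] by (rule image_eqI)
  qed
  ultimately have "bij_betw \<phi> (carrier G) (carrier H)"
    using \<phi>c by (auto simp: bij_betw_def)
  then show ?thesis unfolding sim2_def using hom by blast
qed

section \<open>Prime powers and totients\<close>

text \<open>The value 1 counts as a prime power, so that the property passes to divisors.\<close>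
definition prime_pow :: "nat \<Rightarrow> bool" where
  "prime_pow n \<longleftrightarrow> (\<exists>p k. prime p \<and> n = p ^ k)"

lemma prime_pow_dvd: "prime_pow n \<Longrightarrow> d dvd n \<Longrightarrow> prime_pow d"
  unfolding prime_pow_def using divides_primepow_nat by blast

lemma prime_pow_dvd_linear:
  assumes "prime_pow n" "a dvd n" "b dvd n"
  shows "a dvd b \<or> b dvd a"
proof -
  obtain p k where p: "prime p" "n = p ^ k" using assms(1) prime_pow_def by auto
  then obtain i j where "a = p ^ i" "b = p ^ j" using assms(2,3) divides_primepow_nat by metis
  then show ?thesis using linear[of i j] le_imp_power_dvd by blast
qed

lemma not_prime_powE:
  assumes "n > 0" "\<not> prime_pow n"
  obtains p q where "prime p" "prime q" "p < q" "p dvd n" "q dvd n"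
proof -
  have "n \<noteq> 1"
  proof
    assume "n = 1"
    then have "n = 2 ^ 0" by simp
    then show False using assms(2) two_is_prime_nat unfolding prime_pow_def by blast
  qed
  then obtain p where p: "prime p" "p dvd n" using prime_factor_nat by blast
  have "n \<noteq> 0" "\<not> is_unit p" using assms(1) p by auto
  then obtain m where m: "n = p ^ multiplicity p n * m" "\<not> p dvd m"
    by (rule multiplicity_decompose')
  have "m \<noteq> 1" using m(1) assms(2) p(1) unfolding prime_pow_def by (metis mult.right_neutral)
  then obtain q where q: "prime q" "q dvd m" using prime_factor_nat by blast
  have "q dvd n" using q(2) m(1) by (metis dvd_mult)
  moreover have "p \<noteq> q" using q m by auto
  ultimately show thesis using that p q by (metis linorder_neqE_nat)
qed

text \<open>If \<open>m\<close> is a power of a prime, any other prime divisor of \<open>n\<close> will do; otherwise the full power in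
  \<open>n\<close> of a prime dividing \<open>n / m\<close>.\<close>
lemma ex_incomparable_divisor:
  fixes m n :: nat
  assumes n: "n > 0" "\<not> prime_pow n" and m: "m dvd n" "m \<noteq> 1" "m \<noteq> n"
  obtains d where "d dvd n" "\<not> d dvd m" "\<not> m dvd d"
proof (cases "prime_pow m")
  case True
  then obtain p j where p: "prime p" "m = p ^ j" unfolding prime_pow_def by blast
  obtain q where q: "prime q" "q dvd n" "q \<noteq> p" using not_prime_powE[OF n] by (metis less_irrefl)
  have "\<not> q dvd m" using p q prime_dvd_power primes_dvd_imp_eq by blast
  moreover have "\<not> m dvd q" using q(1) m(2) \<open>\<not> q dvd m\<close> by (metis dvd_refl prime_nat_iff)
  ultimately show thesis using that q(2) by blast
next
  case False
  obtain k where k: "n = m * k" using m(1) by (auto elim: dvdE)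
  have "k \<noteq> 1" using k m(3) by auto
  then obtain r where r: "prime r" "r dvd k" using prime_factor_nat by blast
  define d where "d = r ^ multiplicity r n"
  have "d dvd n" unfolding d_def by (rule multiplicity_dvd)
  moreover have "\<not> d dvd m"
  proof
    assume "d dvd m"
    then have "d * r dvd m * k" using r(2) by (rule mult_dvd_mono)
    then have "r ^ Suc (multiplicity r n) dvd n" using k by (simp add: d_def mult.commute)
    then show False using n(1) r(1) not_dvd_imp_multiplicity_0 multiplicity_geI
      by (metis Suc_n_not_le_n neq0_conv not_prime_unit)
  qed
  moreover have "\<not> m dvd d"
    using False prime_pow_dvd[of d m] r(1) unfolding prime_pow_def d_def by blast
  ultimately show thesis using that by blast
qed

lemma totient_le_of_dvd: "m dvd n \<Longrightarrow> n > 0 \<Longrightarrow> totient m \<le> totient n"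
  by (simp add: dvd_imp_le totient_dvd)

text \<open>Multiplying \<open>m\<close> by a prime \<open>p\<close> leaves the totient unchanged only if \<open>p = 2\<close> and \<open>m\<close> is odd.\<close>
lemma totient_eq_of_dvd:
  assumes dvd: "m dvd n" and n: "n > 0" and eq: "totient m = totient n" and neq: "m \<noteq> n"
  shows "odd m" "n = 2 * m"
proof -
  obtain k where k: "n = m * k" using dvd by (auto elim: dvdE)
  have m0: "totient m > 0" using n k by simp
  have two: "p = 2 \<and> odd m" if p: "prime p" "p dvd k" for p
  proof -
    have le: "totient (m * p) \<le> totient m"
      using totient_le_of_dvd[of "m * p" n] k p n eq by simp
    have p2: "p \<ge> 2" using p(1) prime_ge_2_nat by blast
    have "\<not> p dvd m"
    proof
      assume "p dvd m"
      then have "gcd m p = p" by (simp add: gcd_nat.absorb2)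
      then have "totient (m * p) * totient p = totient m * totient p * p"
        using totient_gcd[of m p] by simp
      moreover have "totient p > 0" using p2 by simp
      ultimately have "totient (m * p) = totient m * p" by (simp add: mult.assoc mult.left_commute)
      then show False using le m0 p2 by simp
    qed
    then have cop: "coprime m p"
      using prime_imp_coprime[OF p(1)] coprime_commute by blast
    then have "totient m * (p - 1) \<le> totient m * 1"
      using le by (simp add: totient_mult_coprime totient_prime[OF p(1)])
    then have "p - 1 \<le> 1" using m0 by (metis mult_le_cancel1)
    then have "p = 2" using p2 by simp
    then show ?thesis using cop by auto
  qed
  have "k \<noteq> 1" using neq k by auto
  then obtain p where p: "prime p" "p dvd k" using prime_factor_nat by blast
  show odd: "odd m" using two[OF p] by simp
  have "2 dvd k" using two[OF p] p by simp
  then obtain k' where k': "k = 2 * k'" by (auto elim: dvdE)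
  have "k' = 1"
  proof (rule ccontr)
    assume "k' \<noteq> 1"
    then obtain q where q: "prime q" "q dvd k'" using prime_factor_nat by blast
    then have "q dvd k" using k' by simp
    then have "q = 2" using two q by blast
    then have "2 * (2 * m) dvd n" using k k' q(2) by (auto elim!: dvdE)
    then have "totient (2 * (2 * m)) \<le> totient m" using totient_le_of_dvd n eq by metis
    moreover have "totient (2 * (2 * m)) = 2 * totient m"
      using odd totient_double[of "2 * m"] totient_double[of m] by simp
    ultimately show False using m0 by simp
  qed
  then show "n = 2 * m" using k k' by simp
qed

section \<open>Twin classes of the power graph\<close>

text \<open>All graph-theoretic notions below are expressed through closed neighbourhoods, so that they
  are visibly preserved by isomorphisms of power graphs.\<close>

definition nbh :: "('a, 'm) monoid_scheme \<Rightarrow> 'a \<Rightarrow> 'a set" where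
  "nbh G x = {y \<in> carrier G. x \<in> cyc G y \<or> y \<in> cyc G x}"

definition twins :: "('a, 'm) monoid_scheme \<Rightarrow> 'a \<Rightarrow> 'a set" where
  "twins G x = {y \<in> carrier G. nbh G y = nbh G x}"

definition dominators :: "('a, 'm) monoid_scheme \<Rightarrow> 'a \<Rightarrow> 'a set" where
  "dominators G x = {y \<in> carrier G. nbh G x \<subseteq> nbh G y}"

text \<open>The twin class of the identity.\<close>
definition hub :: "('a, 'm) monoid_scheme \<Rightarrow> 'a set" where
  "hub G = {x \<in> carrier G. nbh G x = carrier G}"

text \<open>A class outside the hub is plain if and only if it is the set of generators of one cyclic group.\<close>
definition plain :: "('a, 'm) monoid_scheme \<Rightarrow> 'a \<Rightarrow> bool" where
  "plain G x \<longleftrightarrow> (\<forall>y\<in>twins G x. group.ord G y = group.ord G x)"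

text \<open>The cardinalities found at a class consisting of the elements of orders \<open>q\<^bsup>b + 1\<^esup>, \<dots>, q\<^sup>a\<close> of a cyclic
  group of order \<open>q\<^sup>a\<close>. The condition for \<open>b = 0\<close> excludes plain classes of the same
  cardinality, such as that of an element of order 15 (where \<open>\<phi>(15) = 9 - 1\<close>).\<close>
definition compound_shape :: "('a, 'm) monoid_scheme \<Rightarrow> 'a \<Rightarrow> bool" where
  "compound_shape G x \<longleftrightarrow> (\<exists>q a b. prime q \<and> b + 2 \<le> a \<and> card (dominators G x) = q ^ a \<and>
     card (twins G x) + q ^ b = q ^ a \<and>
     (b = 0 \<longrightarrow> (\<forall>y\<in>nbh G x - hub G. card (twins G x) < 2 * card (twins G y))))"

context finite_grp
begin

lemma nbh_sym: "x \<in> carrier G \<Longrightarrow> y \<in> nbh G x \<Longrightarrow> x \<in> nbh G y"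
  by (auto simp: nbh_def)

lemma nbh_refl: "x \<in> carrier G \<Longrightarrow> x \<in> nbh G x"
  by (auto simp: nbh_def)

lemma nbh_subset: "nbh G x \<subseteq> carrier G"
  by (auto simp: nbh_def)

lemma nbh_of_cyc: "x \<in> cyc G y \<Longrightarrow> y \<in> carrier G \<Longrightarrow> x \<in> nbh G y"
  using cyc_carrier by (auto simp: nbh_def)

lemma nbh_cong:
  assumes "x \<in> carrier G" "y \<in> carrier G" "cyc G x = cyc G y"
  shows "nbh G x = nbh G y"
proof -
  have "x \<in> cyc G z \<longleftrightarrow> y \<in> cyc G z" if "z \<in> carrier G" for z
    using assms cyc_refl cyc_trans[OF _ _ that] by metis
  then show ?thesis using assms(3) by (auto simp: nbh_def)
qed

lemma nbh_ord_dvd: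
  assumes "y \<in> nbh G x" "x \<in> carrier G"
  shows "ord x dvd ord y \<or> ord y dvd ord x"
  using assms cyc_ord_dvd by (auto simp: nbh_def)

lemma nbh_of_ord_dvd:
  assumes "z \<in> carrier G" "x \<in> cyc G z" "y \<in> cyc G z" "ord x dvd ord y"
  shows "y \<in> nbh G x"
  using cyc_of_ord_dvd[OF assms] cyc_carrier assms by (auto simp: nbh_def)

lemma twin_iff: "y \<in> twins G x \<longleftrightarrow> y \<in> carrier G \<and> nbh G y = nbh G x"
  by (simp add: twins_def)

lemma finite_twins: "finite (twins G x)"
  using fin by (simp add: twins_def)

lemma twin_nbh: "y \<in> twins G x \<Longrightarrow> y \<in> nbh G x"
  using nbh_refl by (auto simp: twins_def)

lemma one_in_hub: "\<one> \<in> hub G"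
  by (auto simp: hub_def nbh_def)

lemma ord_neq_1: "x \<in> carrier G \<Longrightarrow> x \<notin> hub G \<Longrightarrow> ord x \<noteq> 1"
  using ord_eq_1 one_in_hub by blast

lemma twin_hub_iff: "y \<in> twins G x \<Longrightarrow> x \<in> carrier G \<Longrightarrow> y \<in> hub G \<longleftrightarrow> x \<in> hub G"
  by (auto simp: hub_def twins_def)

text \<open>The subgroups of a cyclic group of prime power order form a chain.\<close>
lemma nbh_mono_of_prime_pow:
  assumes y: "y \<in> carrier G" and x: "x \<in> cyc G y" and pp: "prime_pow (ord y)"
  shows "nbh G y \<subseteq> nbh G x"
proof
  fix w assume w: "w \<in> nbh G y"
  then have wc: "w \<in> carrier G" using nbh_subset by blast
  consider "y \<in> cyc G w" | "w \<in> cyc G y" using w by (auto simp: nbh_def)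
  then show "w \<in> nbh G x"
  proof cases
    case 1
    then show ?thesis using cyc_trans[OF x 1 wc] wc by (auto simp: nbh_def)
  next
    case 2
    have "ord x dvd ord w \<or> ord w dvd ord x"
      using prime_pow_dvd_linear[OF pp] cyc_ord_dvd x 2 y by blast
    then show ?thesis
      using nbh_of_ord_dvd[OF y x 2] nbh_of_ord_dvd[OF y 2 x] nbh_sym[OF wc] by blast
  qed
qed

text \<open>Conversely, a nontrivial proper subgroup of a cyclic group whose order is not a prime power is
  incomparable to some other subgroup.\<close>
lemma prime_pow_of_nbh_mono:
  assumes y: "y \<in> carrier G" and x: "x \<in> cyc G y" and "ord x \<noteq> 1" "ord x \<noteq> ord y"
    and sub: "nbh G y \<subseteq> nbh G x"
  shows "prime_pow (ord y)"
proof (rule ccontr)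
  assume "\<not> prime_pow (ord y)"
  then obtain d where d: "d dvd ord y" "\<not> d dvd ord x" "\<not> ord x dvd d"
    using ex_incomparable_divisor[OF ord_pos[OF y] _ cyc_ord_dvd[OF x y] assms(3,4)] by metis
  obtain w where w: "w \<in> cyc G y" "ord w = d" using ex_in_cyc_of_ord[OF y d(1)] .
  then have "w \<in> nbh G x" using sub nbh_of_cyc y by blast
  then show False using nbh_ord_dvd cyc_carrier[OF x y] w d by blast
qed

lemma cyc_eq_of_nbh_ord_eq:
  assumes "x \<in> carrier G" "y \<in> nbh G x" "ord y = ord x"
  shows "cyc G y = cyc G x"
proof -
  have y: "y \<in> carrier G" using assms(2) nbh_subset by blast
  consider "y \<in> cyc G x" | "x \<in> cyc G y" using assms(2) by (auto simp: nbh_def)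
  then show ?thesis
  proof cases
    case 1
    then show ?thesis using cyc_eq_of_ord[OF assms(1) 1 cyc_refl] assms(3) by blast
  next
    case 2
    then show ?thesis using cyc_eq_of_ord[OF y cyc_refl 2] assms(3) by blast
  qed
qed

lemma generators_subset_twins:
  assumes x: "x \<in> carrier G"
  shows "{y \<in> cyc G x. ord y = ord x} \<subseteq> twins G x"
proof clarify
  fix y assume y: "y \<in> cyc G x" "ord y = ord x"
  then have "cyc G y = cyc G x" using cyc_eq_of_ord[OF x y(1) cyc_refl] by blast
  then show "y \<in> twins G x" using nbh_cong[of y x] x cyc_carrier[OF y(1) x] by (simp add: twins_def)
qed

lemma totient_le_card_twins:
  assumes x: "x \<in> carrier G"
  shows "totient (ord x) \<le> card (twins G x)"
  using card_mono[OF finite_twins generators_subset_twins[OF x]] card_ord_eq_in_cyc[OF x, of "ord x"]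
  by simp

lemma plain_twins:
  assumes x: "x \<in> carrier G" and "plain G x"
  shows "twins G x = {y \<in> cyc G x. ord y = ord x}"
proof
  show "twins G x \<subseteq> {y \<in> cyc G x. ord y = ord x}"
  proof clarify
    fix y assume y: "y \<in> twins G x"
    then have o: "ord y = ord x" using assms(2) by (auto simp: plain_def)
    then have "cyc G y = cyc G x" using cyc_eq_of_nbh_ord_eq[OF x twin_nbh[OF y]] by blast
    then show "y \<in> cyc G x \<and> ord y = ord x" using o cyc_refl by blast
  qed
qed (rule generators_subset_twins[OF x])

lemma card_plain_twins:
  assumes "x \<in> carrier G" "plain G x"
  shows "card (twins G x) = totient (ord x)"
  unfolding plain_twins[OF assms] using card_ord_eq_in_cyc[OF assms(1)] by simp

text \<open>Let \<open>t\<close> and \<open>b\<close> be twins of \<open>x\<close> of largest and smallest order. As \<open>b \<in> \<langle>t\<rangle>\<close> has the same neighbours as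
  \<open>t\<close>, the order of \<open>t\<close> is a prime power, and everything between \<open>b\<close> and \<open>t\<close> is a twin too. If \<open>y\<close>
  strictly above \<open>t\<close> dominated \<open>x\<close> without being a twin, its order would have a prime divisor \<open>q \<noteq> p\<close>,
  and then an element of \<open>\<langle>y\<rangle>\<close> of order \<open>q * ord b\<close> would be a neighbour of \<open>b\<close> but not of \<open>t\<close>.\<close>
lemma compound_twinsE:
  assumes x: "x \<in> carrier G" "x \<notin> hub G" and "\<not> plain G x"
  obtains t p r s where "t \<in> twins G x" "prime p" "ord t = p ^ r" "Suc s < r"
    "twins G x = {y \<in> cyc G t. p ^ Suc s dvd ord y}"
    "dominators G x = cyc G t"
proof -
  have ne: "twins G x \<noteq> {}" using x by (auto simp: twins_def)
  have "Max (ord ` twins G x) \<in> ord ` twins G x" using finite_twins ne by simp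
  then obtain t where t: "Max (ord ` twins G x) = ord t" "t \<in> twins G x" by (rule imageE)
  have "Min (ord ` twins G x) \<in> ord ` twins G x" using finite_twins ne by simp
  then obtain b where b: "Min (ord ` twins G x) = ord b" "b \<in> twins G x" by (rule imageE)
  have tmax: "ord y \<le> ord t" and bmin: "ord b \<le> ord y" if "y \<in> twins G x" for y
    unfolding t(1)[symmetric] b(1)[symmetric] using that finite_twins by simp_all
  note t = t(2) and b = b(2)
  have tc: "t \<in> carrier G" "nbh G t = nbh G x" and bc: "b \<in> carrier G" "nbh G b = nbh G x"
    using t b unfolding twin_iff by blast+
  obtain y where y: "y \<in> twins G x" "ord y \<noteq> ord x"
    using assms(3) unfolding plain_def by blast
  have "x \<in> twins G x" using x by (simp add: twins_def)
  then have lt: "ord b < ord t" using y tmax[of x] tmax[of y] bmin[of x] bmin[of y] by linarith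
  have bnbh: "b \<in> nbh G t" unfolding tc(2) by (rule twin_nbh[OF b])
  have bt: "b \<in> cyc G t"
  proof (rule ccontr)
    assume "b \<notin> cyc G t"
    then have "t \<in> cyc G b" using bnbh unfolding nbh_def by blast
    then have "ord t dvd ord b" by (rule cyc_ord_dvd[OF _ bc(1)])
    then show False using lt ord_pos[OF bc(1)] by (auto dest: dvd_imp_le)
  qed
  have b1: "ord b \<noteq> 1" using ord_neq_1[OF bc(1)] twin_hub_iff[OF b x(1)] x(2) by blast
  have pp: "prime_pow (ord t)"
  proof (rule prime_pow_of_nbh_mono[OF tc(1) bt b1])
    show "ord b \<noteq> ord t" using lt by simp
    show "nbh G t \<subseteq> nbh G b" unfolding tc(2) bc(2) by (rule subset_refl)
  qed
  then obtain p r where p: "prime p" "ord t = p ^ r" unfolding prime_pow_def by blast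
  have "ord b dvd p ^ r" using cyc_ord_dvd[OF bt tc(1)] unfolding p(2) .
  then obtain s' where s': "ord b = p ^ s'" "s' \<le> r"
    unfolding divides_primepow_nat[OF p(1)] by blast
  obtain s where s: "s' = Suc s" using b1 unfolding s'(1) by (cases s') simp_all
  have sr: "Suc s < r" 
    using lt unfolding s'(1) s p(2) by (rule power_less_imp_less_exp[OF prime_gt_1_nat[OF p(1)]])
  have below_t: "y \<in> cyc G t" if "y \<in> twins G x" for y
  proof (rule ccontr)
    assume no: "y \<notin> cyc G t"
    have yc: "y \<in> carrier G" and ynbh: "y \<in> nbh G t"
      unfolding tc(2) using that twin_nbh[OF that] unfolding twin_iff by blast+
    then have "t \<in> cyc G y" using no unfolding nbh_def by blast
    then have "ord t dvd ord y" by (rule cyc_ord_dvd[OF _ yc])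
    then have "ord y = ord t" using tmax[OF that] ord_pos[OF yc] by (auto dest: dvd_imp_le)
    then show False using cyc_eq_of_nbh_ord_eq[OF tc(1) ynbh] no cyc_refl by blast
  qed
  have tw: "twins G x = {y \<in> cyc G t. p ^ Suc s dvd ord y}"
  proof
    show "twins G x \<subseteq> {y \<in> cyc G t. p ^ Suc s dvd ord y}"
    proof clarify
      fix y assume y: "y \<in> twins G x"
      have "ord y dvd p ^ r" using cyc_ord_dvd[OF below_t[OF y] tc(1)] unfolding p(2) .
      then obtain i where i: "ord y = p ^ i" unfolding divides_primepow_nat[OF p(1)] by blast
      have "p ^ Suc s \<le> p ^ i" using bmin[OF y] unfolding s'(1) s i .
      then have "Suc s \<le> i" by (rule power_le_imp_le_exp[OF prime_gt_1_nat[OF p(1)]])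
      then have "p ^ Suc s dvd ord y" unfolding i by (rule le_imp_power_dvd)
      then show "y \<in> cyc G t \<and> p ^ Suc s dvd ord y" using below_t[OF y] by (rule conjI[rotated])
    qed
    show "{y \<in> cyc G t. p ^ Suc s dvd ord y} \<subseteq> twins G x"
    proof clarify
      fix y assume y: "y \<in> cyc G t" "p ^ Suc s dvd ord y"
      have yc: "y \<in> carrier G" using y(1) tc cyc_carrier by blast
      have by': "b \<in> cyc G y" using cyc_of_ord_dvd[OF tc(1) bt y(1)] y(2) unfolding s'(1) s .
      have "prime_pow (ord y)" by (rule prime_pow_dvd[OF pp cyc_ord_dvd[OF y(1) tc(1)]])
      then have "nbh G y \<subseteq> nbh G b" using nbh_mono_of_prime_pow[OF yc by'] by blast
      moreover have "nbh G t \<subseteq> nbh G y" using nbh_mono_of_prime_pow[OF tc(1) y(1) pp] .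
      ultimately show "y \<in> twins G x" using yc unfolding twin_iff tc(2) bc(2) by blast
    qed
  qed
  have "dominators G x = cyc G t"
  proof
    show "cyc G t \<subseteq> dominators G x"
      using nbh_mono_of_prime_pow[OF tc(1) _ pp] tc cyc_carrier unfolding dominators_def by blast
    show "dominators G x \<subseteq> cyc G t"
    proof
      fix y assume "y \<in> dominators G x"
      then have yc: "y \<in> carrier G" and sub: "nbh G t \<subseteq> nbh G y"
        unfolding tc(2) by (auto simp: dominators_def)
      show "y \<in> cyc G t"
      proof (rule ccontr)
        assume no: "y \<notin> cyc G t"
        have "t \<in> nbh G y" using sub nbh_refl[OF tc(1)] by blast
        then have ty: "t \<in> cyc G y" using no unfolding nbh_def by blast
        have "\<not> prime_pow (ord y)"
        proof
          assume "prime_pow (ord y)"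
          then have "nbh G y = nbh G t" using nbh_mono_of_prime_pow[OF yc ty] sub by blast
          then have "y \<in> twins G x" unfolding twin_iff tc(2) using yc by blast
          then show False using below_t no by blast
        qed
        then obtain p1 p2 where "prime p1" "prime p2" "p1 < p2" "p1 dvd ord y" "p2 dvd ord y"
          using not_prime_powE[OF ord_pos[OF yc]] by blast
        then obtain q where q: "prime q" "q dvd ord y" "q \<noteq> p" by blast
        have cop: "coprime q (p ^ i)" for i using primes_coprime[OF q(1) p(1) q(3)] by simp
        have byc: "b \<in> cyc G y" using cyc_trans[OF bt ty yc] .
        have "coprime (ord b) q" unfolding s'(1) using cop coprime_commute by blast
        then have "ord b * q dvd ord y" by (rule divides_mult[OF cyc_ord_dvd[OF byc yc] q(2)])
        then obtain u where u: "u \<in> cyc G y" "ord u = ord b * q" using ex_in_cyc_of_ord[OF yc] by blast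
        then have "u \<in> nbh G b" by (intro nbh_of_ord_dvd[OF yc byc u(1)]) simp
        then have "ord t dvd ord u \<or> ord u dvd ord t"
          unfolding bc(2) tc(2)[symmetric] by (rule nbh_ord_dvd[OF _ tc(1)])
        moreover have "\<not> q dvd ord t"
          using cop[of r] q(1) unfolding p(2) by (metis coprime_absorb_left not_prime_unit)
        then have "\<not> ord u dvd ord t" unfolding u(2) using dvd_mult_right by blast
        moreover have "\<not> ord t dvd ord u"
        proof
          assume "ord t dvd ord u"
          then have "p ^ r dvd p ^ Suc s * q" unfolding u(2) p(2) s'(1) s .
          moreover have "coprime (p ^ r) q" using cop coprime_commute by blast
          ultimately have "p ^ r dvd p ^ Suc s" by (simp only: coprime_dvd_mult_left_iff)
          then have "r \<le> Suc s" using prime_gt_1_nat[OF p(1)] by (rule power_dvd_imp_le)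
          then show False using sr by simp
        qed
        ultimately show False by blast
      qed
    qed
  qed
  then show thesis by (rule that[OF t p sr tw])
qed

end

context finite_grp
begin

lemma card_compound_twins:
  assumes t: "t \<in> carrier G" and p: "prime p" "ord t = p ^ r" and "s < r"
  shows "card {y \<in> cyc G t. p ^ Suc s dvd ord y} + p ^ s = p ^ r"
proof -
  have dvd_iff: "p ^ Suc s dvd ord y \<longleftrightarrow> \<not> ord y dvd p ^ s" if "y \<in> cyc G t" for y
  proof -
    have "ord y dvd p ^ r" using cyc_ord_dvd[OF that t] unfolding p(2) .
    then obtain i where i: "ord y = p ^ i" unfolding divides_primepow_nat[OF p(1)] by blast
    have "p ^ a dvd p ^ b \<longleftrightarrow> a \<le> b" for a b
      using power_dvd_imp_le[OF _ prime_gt_1_nat[OF p(1)]] le_imp_power_dvd by metis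
    then show ?thesis unfolding i by (simp only: not_le Suc_le_eq)
  qed
  have split: "cyc G t = {y \<in> cyc G t. p ^ Suc s dvd ord y} \<union> {y \<in> cyc G t. ord y dvd p ^ s}"
    using dvd_iff by blast
  have "card (cyc G t) =
      card {y \<in> cyc G t. p ^ Suc s dvd ord y} + card {y \<in> cyc G t. ord y dvd p ^ s}"
    by (subst split, rule card_Un_disjoint) (use dvd_iff finite_cyc[OF t] in auto)
  moreover have "card {y \<in> cyc G t. ord y dvd p ^ s} = p ^ s"
    by (rule card_ord_dvd_in_cyc[OF t]) (use p(2) assms(4) in \<open>simp add: le_imp_power_dvd\<close>)
  ultimately show ?thesis using card_cyc[OF t] p(2) by simp
qed

text \<open>For \<open>b = 0\<close> the class is \<open>\<langle>t\<rangle> - {\<one>}\<close>, with \<open>p\<^sup>r - 1\<close> elements; a neighbour outside it lies above \<open>t\<close>, so that its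
  class has at least \<open>\<phi>(p\<^sup>r) \<ge> p\<^sup>r / 2\<close> elements.\<close>
lemma compound_shape_of_not_plain:
  assumes x: "x \<in> carrier G" "x \<notin> hub G" and np: "\<not> plain G x"
  shows "compound_shape G x"
proof -
  obtain t p r s where t: "t \<in> twins G x" and p: "prime p" "ord t = p ^ r" and sr: "Suc s < r"
    and tw: "twins G x = {y \<in> cyc G t. p ^ Suc s dvd ord y}" and dom: "dominators G x = cyc G t"
    by (rule compound_twinsE[OF x np])
  have tc: "t \<in> carrier G" "nbh G t = nbh G x" using t unfolding twin_iff by blast+
  have "card (dominators G x) = p ^ r" unfolding dom using card_cyc[OF tc(1)] p(2) by simp
  moreover have card_tw: "card (twins G x) + p ^ s = p ^ r"
    unfolding tw by (rule card_compound_twins[OF tc(1) p]) (use sr in simp)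
  moreover have "card (twins G x) < 2 * card (twins G y)" if s: "s = 0" and y: "y \<in> nbh G x - hub G" for y
  proof -
    have yc: "y \<in> carrier G" using y nbh_subset by blast
    have y1: "ord y \<noteq> 1" using y yc ord_neq_1 by blast
    have "y \<in> nbh G t" using y unfolding tc(2) by blast
    then consider "y \<in> cyc G t" | "t \<in> cyc G y" unfolding nbh_def by blast
    then show ?thesis
    proof cases
      case 1
      have "ord y dvd p ^ r" using cyc_ord_dvd[OF 1 tc(1)] unfolding p(2) .
      then obtain i where i: "ord y = p ^ i" unfolding divides_primepow_nat[OF p(1)] by blast
      then have "i \<noteq> 0" using y1 by (cases i) auto
      then have "p ^ Suc s dvd ord y" unfolding i s by (simp add: le_imp_power_dvd)
      then have "y \<in> twins G x" unfolding tw using 1 by blast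
      then have "nbh G y = nbh G x" unfolding twin_iff by blast
      then have "twins G y = twins G x" unfolding twins_def by simp
      moreover have "card (twins G x) > 0"
        using finite_twins t by (auto simp: card_gt_0_iff)
      ultimately show ?thesis by simp
    next
      case 2
      have "p ^ r dvd ord y" using cyc_ord_dvd[OF 2 yc] unfolding p(2) .
      then have "totient (p ^ r) \<le> totient (ord y)" using ord_pos[OF yc] by (rule totient_le_of_dvd)
      also have "\<dots> \<le> card (twins G y)" by (rule totient_le_card_twins[OF yc])
      finally have le: "totient (p ^ r) \<le> card (twins G y)" .
      obtain r' where r': "r = Suc r'" using sr by (cases r) simp_all
      have tot: "totient (p ^ r) = p ^ r' * (p - 1)"
        unfolding r' by (rule totient_prime_power_Suc[OF p(1)])
      have "p ^ r' * p \<le> p ^ r' * (2 * (p - 1))"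
        using prime_ge_2_nat[OF p(1)] by (intro mult_le_mono2) simp
      moreover have "p ^ r = p ^ r' * p" unfolding r' by (rule power_Suc2)
      moreover have "p ^ r' * (2 * (p - 1)) = 2 * totient (p ^ r)" unfolding tot by simp
      ultimately have "p ^ r \<le> 2 * totient (p ^ r)" by linarith
      moreover have "card (twins G x) < p ^ r" using card_tw unfolding s by simp
      ultimately show ?thesis using le by linarith
    qed
  qed
  ultimately show ?thesis unfolding compound_shape_def using p(1) sr
    by (intro exI[of _ p] exI[of _ r] exI[of _ s]) simp
qed

text \<open>Every cyclic group whose order is not a prime power thus contains small plain classes, namely those of
  its elements of prime order.\<close>
lemma plain_of_prime_ord:
  assumes x: "x \<in> carrier G" and z: "z \<in> cyc G x" and p: "prime (ord z)"
    and q: "prime q" "q dvd ord x" "q \<noteq> ord z"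
  shows "z \<notin> hub G" "plain G z"
proof -
  have zc: "z \<in> carrier G" using z x cyc_carrier by blast
  have ndvd: "\<not> q dvd ord z" "\<not> ord z dvd q"
    using p q primes_dvd_imp_eq by metis+
  have ord_x: "ord z * q dvd ord x"
    using primes_coprime[OF p q(1)] q(3) cyc_ord_dvd[OF z x] q(2) divides_mult by metis
  obtain w where w: "w \<in> cyc G x" "ord w = q" using ex_in_cyc_of_ord[OF x q(2)] .
  have "w \<notin> nbh G z" using nbh_ord_dvd[OF _ zc, of w] ndvd unfolding w(2) by blast
  then show nh: "z \<notin> hub G" using w(1) cyc_carrier[OF _ x] unfolding hub_def by blast
  show "plain G z" unfolding plain_def
  proof (rule ballI, rule ccontr)
    fix v assume v: "v \<in> twins G z" and neq: "ord v \<noteq> ord z"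
    have vc: "v \<in> carrier G" "nbh G v = nbh G z" using v unfolding twin_iff by blast+
    have v1: "ord v \<noteq> 1" using ord_neq_1[OF vc(1)] twin_hub_iff[OF v zc] nh by blast
    have "\<not> ord v dvd ord z" using p v1 neq prime_nat_iff by blast
    then have "v \<notin> cyc G z" using cyc_ord_dvd[OF _ zc] by blast
    then have zv: "z \<in> cyc G v" using twin_nbh[OF v] unfolding nbh_def by blast
    have z1: "ord z \<noteq> 1" using p by auto
    have pp: "prime_pow (ord v)"
      by (rule prime_pow_of_nbh_mono[OF vc(1) zv z1 neq[symmetric]]) (simp add: vc(2))
    have zdv: "ord z dvd ord v" by (rule cyc_ord_dvd[OF zv vc(1)])
    have nq: "\<not> q dvd ord v"
    proof
      assume "q dvd ord v"
      then have "ord z dvd q \<or> q dvd ord z" using prime_pow_dvd_linear[OF pp zdv] by blast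
      then show False using ndvd by blast
    qed
    \<comment> \<open>An element of order \<open>ord z * q\<close> is adjacent to \<open>z\<close> but not to \<open>v\<close>.\<close>
    obtain u where u: "u \<in> cyc G x" "ord u = ord z * q" using ex_in_cyc_of_ord[OF x ord_x] .
    have "u \<in> nbh G z" by (rule nbh_of_ord_dvd[OF x z u(1)]) (simp add: u(2))
    then have "ord v dvd ord u \<or> ord u dvd ord v"
      unfolding vc(2)[symmetric] by (rule nbh_ord_dvd[OF _ vc(1)])
    moreover have "\<not> ord u dvd ord v" unfolding u(2) using nq dvd_mult_right by blast
    ultimately have "ord v dvd ord z * q" unfolding u(2) by blast
    moreover have "coprime (ord v) q" using prime_imp_coprime[OF q(1) nq] coprime_commute by blast
    ultimately have "ord v dvd ord z" by (simp only: coprime_dvd_mult_left_iff)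
    then show False using \<open>\<not> ord v dvd ord z\<close> by blast
  qed
qed

text \<open>If a plain class had the sizes of a compound one, then nothing strictly above \<open>x\<close> could
  dominate \<open>x\<close>, since the generators of its cyclic group would make \<open>dominators G x\<close> too large. So
  \<open>dominators G x\<close> is \<open>\<langle>x\<rangle>\<close> if \<open>ord x\<close> is a prime power, and consists of the generators of \<open>\<langle>x\<rangle>\<close>
  and the identity otherwise. Sizes exclude the first case, and the
  class of an element of prime order in \<open>\<langle>x\<rangle>\<close>, which is small, excludes the second. (The sizes alone
  do not: \<open>\<phi>(15) = 9 - 1\<close>.)\<close>
lemma plain_imp_not_compound_shape:
  assumes x: "x \<in> carrier G" "x \<notin> hub G" and plain: "plain G x"
  shows "\<not> compound_shape G x"
proof
  assume "compound_shape G x"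
  then obtain q a b where q: "prime q" and ab: "b + 2 \<le> a" and dom: "card (dominators G x) = q ^ a"
    and tw: "card (twins G x) + q ^ b = q ^ a"
    and nb: "b = 0 \<Longrightarrow> \<forall>y\<in>nbh G x - hub G. card (twins G x) < 2 * card (twins G y)"
    unfolding compound_shape_def by blast
  define n where "n = ord x"
  have n0: "n > 0" and n1: "n \<noteq> 1" using ord_pos[OF x(1)] ord_neq_1[OF x] n_def by auto
  have card_tw: "card (twins G x) = totient n" unfolding n_def by (rule card_plain_twins[OF x(1) plain])
  have findom: "finite (dominators G x)" using fin unfolding dominators_def by simp
  have tw_dom: "twins G x \<subseteq> dominators G x" unfolding twins_def dominators_def by blast
  have q2: "q \<ge> 2" using prime_ge_2_nat[OF q] .
  have "q ^ b * 4 \<le> q ^ b * q ^ 2" using power_mono[OF q2, of 2] by (intro mult_le_mono2) simp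
  also have "\<dots> = q ^ (b + 2)" by (rule power_add[symmetric])
  also have "\<dots> \<le> q ^ a" using ab q2 by (intro power_increasing) auto
  finally have qab: "4 * q ^ b \<le> q ^ a" by simp
  have qb0: "q ^ b > 0" using q2 by simp
  have above: "ord y = n" if y: "y \<in> dominators G x" and xy: "x \<in> cyc G y" for y
  proof (rule ccontr)
    assume neq: "ord y \<noteq> n"
    have yc: "y \<in> carrier G" and sub: "nbh G x \<subseteq> nbh G y" using y unfolding dominators_def by blast+
    define Y where "Y = {z \<in> cyc G y. ord z = ord y}"
    have "Y \<subseteq> dominators G x"
    proof
      fix z assume "z \<in> Y"
      then have "z \<in> twins G y" using generators_subset_twins[OF yc] Y_def by blast
      then show "z \<in> dominators G x" using sub unfolding twins_def dominators_def by blast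
    qed
    then have "card (twins G x \<union> Y) \<le> card (dominators G x)"
      using tw_dom by (intro card_mono findom) blast
    moreover have "twins G x \<inter> Y = {}" using plain neq unfolding Y_def plain_def n_def by auto
    then have "card (twins G x \<union> Y) = card (twins G x) + card Y"
      using findom \<open>Y \<subseteq> dominators G x\<close> by (intro card_Un_disjoint finite_twins) (auto intro: finite_subset)
    moreover have "card Y = totient (ord y)"
      unfolding Y_def by (rule card_ord_eq_in_cyc[OF yc dvd_refl])
    moreover have "totient n \<le> totient (ord y)"
      unfolding n_def by (rule totient_le_of_dvd[OF cyc_ord_dvd[OF xy yc] ord_pos[OF yc]])
    ultimately have "2 * card (twins G x) \<le> q ^ a" using card_tw dom by linarith
    then show False using tw qab qb0 by linarith
  qed
  have dom_cyc: "y \<in> cyc G x" if y: "y \<in> dominators G x" for y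
  proof (rule ccontr)
    assume no: "y \<notin> cyc G x"
    have yc: "y \<in> carrier G" and xn: "x \<in> nbh G y"
      using y nbh_refl[OF x(1)] unfolding dominators_def by blast+
    have ynx: "y \<in> nbh G x" by (rule nbh_sym[OF yc xn])
    then have "x \<in> cyc G y" using no unfolding nbh_def by blast
    then have "ord y = ord x" using above[OF y] unfolding n_def by blast
    then have "cyc G y = cyc G x" by (rule cyc_eq_of_nbh_ord_eq[OF x(1) ynx])
    then show False using no cyc_refl[of y] by blast
  qed
  show False
  proof (cases "prime_pow n")
    case True
    then obtain p r where p: "prime p" "n = p ^ r" unfolding prime_pow_def by blast
    have "cyc G x \<subseteq> dominators G x"
      using nbh_mono_of_prime_pow[OF x(1) _ True[unfolded n_def]] cyc_subset[OF x(1)]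
      unfolding dominators_def by blast
    then have "dominators G x = cyc G x" using dom_cyc by blast
    then have eq: "p ^ r = q ^ a" using dom card_cyc[OF x(1)] p(2) n_def by simp
    have r0: "r \<noteq> 0" using n1 p(2) by (cases r) simp_all
    then have "p dvd q ^ a" unfolding eq[symmetric] by simp
    then have "p = q" using p(1) q prime_dvd_power primes_dvd_imp_eq by blast
    then have "r = a" using eq q2 by (simp add: power_inject_exp)
    obtain a' where a': "a = Suc a'" using ab by (cases a) simp_all
    have "card (twins G x) = q ^ a' * (q - 1)"
      unfolding card_tw p(2) \<open>p = q\<close> \<open>r = a\<close> a' by (rule totient_prime_power_Suc[OF q])
    then have "card (twins G x) + q ^ a' = q ^ a" using q2 unfolding a'
      by (simp add: algebra_simps)
    then have "q ^ a' = q ^ b" using tw by simp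
    then have "a' = b" using q2 by (simp add: power_inject_exp)
    then show False using ab a' by simp
  next
    case False
    have "dominators G x = insert \<one> (twins G x)"
    proof
      show "insert \<one> (twins G x) \<subseteq> dominators G x"
        using tw_dom one_in_hub nbh_subset unfolding hub_def dominators_def by blast
      show "dominators G x \<subseteq> insert \<one> (twins G x)"
      proof
        fix y assume y: "y \<in> dominators G x"
        have yx: "y \<in> cyc G x" by (rule dom_cyc[OF y])
        have yc: "y \<in> carrier G" and sub: "nbh G x \<subseteq> nbh G y" using y unfolding dominators_def by blast+
        have "ord y = 1 \<or> ord y = ord x"
          using prime_pow_of_nbh_mono[OF x(1) yx _ _ sub] False unfolding n_def by blast
        then show "y \<in> insert \<one> (twins G x)"
          using ord_eq_1[OF yc] generators_subset_twins[OF x(1)] yx by blast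
      qed
    qed
    moreover have "\<one> \<notin> twins G x" using twin_hub_iff[of \<one> x] x one_in_hub by blast
    ultimately have "card (dominators G x) = Suc (card (twins G x))"
      using finite_twins by simp
    then have "q ^ b = 1" using dom tw by simp
    then have b: "b = 0" using q2 by simp
    obtain p p' where pp: "prime p" "prime p'" "p < p'" "p dvd n" "p' dvd n"
      using not_prime_powE[OF n0 False] .
    obtain z where z: "z \<in> cyc G x" "ord z = p" using ex_in_cyc_of_ord[OF x(1) pp(4)[unfolded n_def]] .
    have zc: "z \<in> carrier G" by (rule cyc_carrier[OF z(1) x(1)])
    have zp: "prime (ord z)" "p' \<noteq> ord z" using pp z(2) by simp_all
    note zz = plain_of_prime_ord[OF x(1) z(1) zp(1) pp(2) pp(5)[unfolded n_def] zp(2)]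
    have "card (twins G z) = p - 1"
      unfolding card_plain_twins[OF zc zz(2)] z(2) by (rule totient_prime[OF pp(1)])
    moreover have "z \<in> nbh G x - hub G" using nbh_of_cyc[OF z(1) x(1)] zz(1) by blast
    ultimately have lt: "totient n < 2 * (p - 1)" using nb[OF b] card_tw by metis
    have cop: "coprime p p'" using primes_coprime[OF pp(1,2)] pp(3) by simp
    have "totient (p * p') \<le> totient n"
      using divides_mult[OF pp(4,5) cop] n0 by (rule totient_le_of_dvd)
    moreover have "totient (p * p') = (p - 1) * (p' - 1)"
      using totient_mult_coprime[OF cop] totient_prime pp(1,2) by simp
    moreover have "(p - 1) * 2 \<le> (p - 1) * (p' - 1)"
      using prime_ge_2_nat[OF pp(1)] pp(3) by (intro mult_le_mono2) simp
    ultimately show False using lt by linarith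
  qed
qed

section \<open>The hub of the power graph\<close>

text \<open>An element strictly above \<open>s\<close> would have an order that is not a prime power, and hence neighbours that
  are incomparable to \<open>s\<close>.\<close>
lemma carrier_cyclic_of_hub:
  assumes s: "s \<in> hub G" "s \<noteq> \<one>" and np: "\<not> prime_pow (ord s)"
  shows "carrier G = cyc G s"
proof
  have sc: "s \<in> carrier G" and nb: "nbh G s = carrier G" using s unfolding hub_def by blast+
  show "cyc G s \<subseteq> carrier G" by (rule cyc_subset[OF sc])
  show "carrier G \<subseteq> cyc G s"
  proof (rule subsetI, rule ccontr)
    fix w assume w: "w \<in> carrier G" and no: "w \<notin> cyc G s"
    have wn: "w \<in> nbh G s" using w nb by blast
    then have sw: "s \<in> cyc G w" using no unfolding nbh_def by blast
    have "ord s \<noteq> ord w"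
    proof
      assume "ord s = ord w"
      then have "cyc G w = cyc G s" by (intro cyc_eq_of_nbh_ord_eq[OF sc wn]) simp
      then show False using no cyc_refl[of w] by blast
    qed
    moreover have "ord s \<noteq> 1" using s(2) ord_eq_1[OF sc] by blast
    ultimately have "prime_pow (ord w)"
      using prime_pow_of_nbh_mono[OF w sw] nb nbh_subset by blast
    then show False using np prime_pow_dvd cyc_ord_dvd[OF sw w] by blast
  qed
qed

text \<open>Every element is comparable to \<open>s\<close>, hence a \<open>p\<close>-element; Sylow subgroups for other primes are
  therefore trivial.\<close>
lemma prime_pow_order_of_hub:
  assumes s: "s \<in> hub G" "s \<noteq> \<one>" and pp: "prime_pow (ord s)"
  shows "prime_pow (order G)"
proof (rule ccontr)
  assume "\<not> prime_pow (order G)"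
  moreover have "order G > 0" using fin order_gt_0_iff_finite by blast
  ultimately obtain p1 p2 where p12: "prime p1" "prime p2" "p1 < p2" "p1 dvd order G" "p2 dvd order G"
    using not_prime_powE by metis
  have sc: "s \<in> carrier G" and nb: "nbh G s = carrier G" using s unfolding hub_def by blast+
  obtain p k where p: "prime p" "ord s = p ^ k" using pp unfolding prime_pow_def by blast
  have s1: "ord s \<noteq> 1" using s(2) ord_eq_1[OF sc] by blast
  then have k: "k \<noteq> 0" using p(2) by (cases k) simp_all
  obtain q where q: "prime q" "q dvd order G" "q \<noteq> p" using p12 by blast
  have q_ord: "\<not> q dvd ord w" if w: "w \<in> carrier G" for w
  proof
    assume qw: "q dvd ord w"
    have nqs: "\<not> q dvd ord s"
      unfolding p(2) using q p(1) prime_dvd_power primes_dvd_imp_eq by blast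
    have "w \<in> nbh G s" using w nb by blast
    moreover have "w \<notin> cyc G s" using nqs qw cyc_ord_dvd[OF _ sc] dvd_trans by blast
    ultimately have sw: "s \<in> cyc G w" unfolding nbh_def by blast
    have "ord s \<noteq> ord w" using nqs qw by metis
    then have ppw: "prime_pow (ord w)"
      using prime_pow_of_nbh_mono[OF w sw s1] nb nbh_subset by blast
    have "ord s dvd q" using prime_pow_dvd_linear[OF ppw cyc_ord_dvd[OF sw w] qw] nqs by blast
    then have "ord s = q" using q(1) s1 prime_nat_iff by blast
    then show False using nqs by simp
  qed
  obtain m where m: "order G = q ^ 1 * m" using q(2) by (auto elim: dvdE)
  obtain K where K: "subgroup K G" "card K = q ^ 1"
    using sylow_thm[OF q(1) is_group m fin] by blast
  have "K \<noteq> {\<one>}" using K(2) prime_gt_1_nat[OF q(1)] by auto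
  then obtain w where w: "w \<in> K" "w \<noteq> \<one>" using subgroup.one_closed[OF K(1)] by blast
  have wc: "w \<in> carrier G" using w(1) subgroup.subset[OF K(1)] by blast
  have "cyc G w \<subseteq> K" using generate_subgroup_incl[OF _ K(1)] w(1) by blast
  moreover have "subgroup (cyc G w) G" by (rule generate_is_subgroup) (use wc in blast)
  ultimately have "subgroup (cyc G w) (G\<lparr>carrier := K\<rparr>)" using K(1) subgroup_incl by blast
  then have "card (cyc G w) dvd order (G\<lparr>carrier := K\<rparr>)"
    using group.lagrange[OF subgroup_imp_group[OF K(1)]] dvd_triv_right by metis
  then have "ord w dvd q" using K(2) card_cyc[OF wc] by (simp add: order_def)
  moreover have "ord w \<noteq> 1" using w(2) ord_eq_1[OF wc] by blast
  ultimately have "ord w = q" using q(1) prime_nat_iff by blast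
  then show False using q_ord[OF wc] by simp
qed

text \<open>The hub is generated by any of its elements of maximal order, because its elements are pairwise
  comparable.\<close>
lemma hub_eq_cyc:
  assumes pp: "prime_pow (order G)"
  obtains t where "t \<in> hub G" "hub G = cyc G t"
proof -
  have finh: "finite (hub G)" using fin unfolding hub_def by simp
  have "Max (ord ` hub G) \<in> ord ` hub G" using finh one_in_hub by (intro Max_in) auto
  then obtain t where t: "Max (ord ` hub G) = ord t" "t \<in> hub G" by (rule imageE)
  have tc: "t \<in> carrier G" and nb: "nbh G t = carrier G" using t(2) unfolding hub_def by blast+
  have ppt: "prime_pow (ord t)" by (rule prime_pow_dvd[OF pp ord_dvd_group_order[OF tc]])
  have "hub G = cyc G t"
  proof
    show "cyc G t \<subseteq> hub G"
      using nbh_mono_of_prime_pow[OF tc _ ppt] cyc_subset[OF tc] nbh_subset nb unfolding hub_def by blast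
    show "hub G \<subseteq> cyc G t"
    proof (rule subsetI, rule ccontr)
      fix y assume y: "y \<in> hub G" and no: "y \<notin> cyc G t"
      have yc: "y \<in> carrier G" using y unfolding hub_def by blast
      then have yn: "y \<in> nbh G t" using nb by blast
      then have "t \<in> cyc G y" using no unfolding nbh_def by blast
      then have "ord t dvd ord y" by (rule cyc_ord_dvd[OF _ yc])
      then have "ord t \<le> ord y" using ord_pos[OF yc] by (rule dvd_imp_le)
      moreover have "ord y \<le> ord t" unfolding t(1)[symmetric] using y finh by simp
      ultimately have "cyc G y = cyc G t" by (intro cyc_eq_of_nbh_ord_eq[OF tc yn]) simp
      then show False using no cyc_refl[of y] by blast
    qed
  qed
  then show thesis using that t(2) by blast
qed

text \<open>The hypothesis on the hub fails only for cyclic groups whose order is not a prime power; there the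
  hub also contains elements above all others.\<close>
lemma hub_below:
  assumes h: "hub G = {\<one>} \<or> prime_pow (order G)"
    and s: "s \<in> hub G" and x: "x \<in> carrier G" "x \<notin> hub G"
  shows "s \<in> cyc G x"
proof (cases "prime_pow (order G)")
  case True
  obtain t where t: "t \<in> hub G" "hub G = cyc G t" using hub_eq_cyc[OF True] .
  have "x \<in> nbh G t" using t(1) x(1) unfolding hub_def by blast
  then have "t \<in> cyc G x" using x(2) unfolding t(2) nbh_def by blast
  then show ?thesis using cyc_trans[OF _ _ x(1)] s unfolding t(2) by blast
next
  case False
  then show ?thesis using h s by auto
qed

lemma card_hub_ord_eq:
  assumes h: "hub G = {\<one>} \<or> prime_pow (order G)"
  shows "card {y \<in> hub G. ord y = d} = (if d dvd card (hub G) then totient d else 0)"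
proof -
  have "\<exists>t\<in>carrier G. hub G = cyc G t"
  proof (cases "prime_pow (order G)")
    case True
    obtain t where t: "t \<in> hub G" "hub G = cyc G t" using hub_eq_cyc[OF True] .
    have "t \<in> carrier G" using t(1) unfolding hub_def by blast
    then show ?thesis using t(2) by (intro bexI)
  next
    case False
    then have "hub G = cyc G \<one>" using h unfolding generate_one by blast
    then show ?thesis using one_closed by (intro bexI)
  qed
  then obtain t where t: "t \<in> carrier G" "hub G = cyc G t" by (elim bexE)
  show ?thesis
  proof (cases "d dvd ord t")
    case True
    then show ?thesis unfolding t(2) card_cyc[OF t(1)]
      by (simp only: if_True card_ord_eq_in_cyc[OF t(1)])
  next
    case False
    have "{y \<in> cyc G t. ord y = d} = {}"
    proof (rule ccontr)
      assume "{y \<in> cyc G t. ord y = d} \<noteq> {}"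
      then obtain y where y: "y \<in> cyc G t" "ord y = d" by auto
      have "d dvd ord t" using cyc_ord_dvd[OF y(1) t(1)] unfolding y(2) .
      then show False using False by simp
    qed
    then show ?thesis unfolding t(2) card_cyc[OF t(1)] using False by (simp only: card.empty if_False)
  qed
qed

text \<open>The numbers of elements of each order in a compound class depend on the graph only.\<close>
lemma card_compound_twins_ord_eq:
  assumes x: "x \<in> carrier G" "x \<notin> hub G" and np: "\<not> plain G x"
  shows "card {y \<in> twins G x. ord y = d} =
    (if d dvd card (dominators G x) \<and> \<not> d dvd card (dominators G x) - card (twins G x)
     then totient d else 0)"
proof -
  obtain t p r s where t: "t \<in> twins G x" and p: "prime p" "ord t = p ^ r" and sr: "Suc s < r"
    and tw: "twins G x = {y \<in> cyc G t. p ^ Suc s dvd ord y}" and dom: "dominators G x = cyc G t"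
    by (rule compound_twinsE[OF x np])
  have tc: "t \<in> carrier G" using t unfolding twin_iff by blast
  have cd: "card (dominators G x) = p ^ r" unfolding dom using card_cyc[OF tc] p(2) by simp
  have "card (twins G x) + p ^ s = p ^ r"
    unfolding tw by (rule card_compound_twins[OF tc p]) (use sr in simp)
  then have diff: "p ^ r - card (twins G x) = p ^ s" by simp
  have set: "{y \<in> twins G x. ord y = d} = (if p ^ Suc s dvd d then {y \<in> cyc G t. ord y = d} else {})"
    unfolding tw by auto
  show ?thesis
  proof (cases "d dvd p ^ r")
    case True
    then obtain i where i: "d = p ^ i" unfolding divides_primepow_nat[OF p(1)] by blast
    have "p ^ a dvd p ^ b \<longleftrightarrow> a \<le> b" for a b
      using power_dvd_imp_le[OF _ prime_gt_1_nat[OF p(1)]] le_imp_power_dvd by metis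
    then have iff: "p ^ Suc s dvd d \<longleftrightarrow> \<not> d dvd p ^ s" unfolding i by (simp only: not_le Suc_le_eq)
    have "card {y \<in> cyc G t. ord y = d} = totient d"
      by (rule card_ord_eq_in_cyc[OF tc]) (simp add: p(2) True)
    then show ?thesis
      unfolding set cd diff iff by (cases "d dvd p ^ s") (simp_all only: True if_True if_False simp_thms card.empty)
  next
    case False
    have "{y \<in> twins G x. ord y = d} = {}"
    proof (rule ccontr)
      assume "{y \<in> twins G x. ord y = d} \<noteq> {}"
      then obtain y where y: "y \<in> cyc G t" "ord y = d" unfolding tw by auto
      have "d dvd p ^ r" using cyc_ord_dvd[OF y(1) tc] unfolding y(2) p(2) .
      then show False using False by simp
    qed
    then show ?thesis unfolding cd using False by (simp only: card.empty if_False simp_thms)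
  qed
qed

end

lemma (in finite_grp) cyc_of_nbh_ord_dvd:
  assumes x: "x \<in> carrier G" and y: "y \<in> nbh G x" and dvd: "ord y dvd ord x"
  shows "y \<in> cyc G x"
proof (rule ccontr)
  assume no: "y \<notin> cyc G x"
  have yc: "y \<in> carrier G" using y nbh_subset by blast
  have "x \<in> cyc G y" using y no unfolding nbh_def by blast
  then have "ord x dvd ord y" by (rule cyc_ord_dvd[OF _ yc])
  then have "ord y = ord x" using dvd by (intro dvd_antisym)
  then have "cyc G y = cyc G x" by (rule cyc_eq_of_nbh_ord_eq[OF x y])
  then show False using no cyc_refl[of y] by blast
qed

section \<open>Isomorphisms of power graphs\<close>

locale power_graph_iso = G: finite_grp G + H: finite_grp H
  for G :: "('a, 'm) monoid_scheme" and H :: "('b, 'n) monoid_scheme" +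
  fixes f :: "'a \<Rightarrow> 'b"
  assumes bij: "bij_betw f (carrier G) (carrier H)"
    and adj: "\<And>x y. x \<in> carrier G \<Longrightarrow> y \<in> carrier G \<Longrightarrow> f y \<in> nbh H (f x) \<longleftrightarrow> y \<in> nbh G x"
begin

lemma inj: "inj_on f (carrier G)"
  by (rule bij_betw_imp_inj_on[OF bij])

lemma f_closed: "x \<in> carrier G \<Longrightarrow> f x \<in> carrier H"
  by (rule bij_betw_apply[OF bij])

lemma inverse: "power_graph_iso H G (inv_into (carrier G) f)"
proof (intro power_graph_iso.intro power_graph_iso_axioms.intro)
  let ?g = "inv_into (carrier G) f"
  show "finite_grp H" "finite_grp G" by unfold_locales
  show bij': "bij_betw ?g (carrier H) (carrier G)" by (rule bij_betw_inv_into[OF bij])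
  fix u v assume uv: "u \<in> carrier H" "v \<in> carrier H"
  have c: "?g u \<in> carrier G" "?g v \<in> carrier G" using uv bij_betw_apply[OF bij'] by blast+
  have "f (?g u) = u" "f (?g v) = v" using uv bij_betw_inv_into_right[OF bij] by blast+
  then show "?g v \<in> nbh G (?g u) \<longleftrightarrow> v \<in> nbh H u" using adj[OF c] by simp
qed

lemma image_Collect_carrier:
  assumes "\<And>y. y \<in> carrier G \<Longrightarrow> Q (f y) \<longleftrightarrow> P y"
  shows "{v \<in> carrier H. Q v} = f ` {y \<in> carrier G. P y}"
proof -
  have "{v \<in> f ` carrier G. Q v} = f ` {y \<in> carrier G. P y}" using assms by blast
  then show ?thesis unfolding bij_betw_imp_surj_on[OF bij] .
qed

lemma card_f_image: "S \<subseteq> carrier G \<Longrightarrow> card (f ` S) = card S"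
  by (rule card_image[OF inj_on_subset[OF inj]])

lemma nbh_image:
  assumes x: "x \<in> carrier G"
  shows "nbh H (f x) = f ` nbh G x"
proof -
  have "{v \<in> carrier H. v \<in> nbh H (f x)} = f ` {y \<in> carrier G. y \<in> nbh G x}"
    by (rule image_Collect_carrier) (rule adj[OF x])
  moreover have "{v \<in> carrier H. v \<in> nbh H (f x)} = nbh H (f x)" using H.nbh_subset by blast
  moreover have "{y \<in> carrier G. y \<in> nbh G x} = nbh G x" using G.nbh_subset by blast
  ultimately show ?thesis by (simp only:)
qed

lemma nbh_subset_iff:
  assumes x: "x \<in> carrier G" and y: "y \<in> carrier G"
  shows "nbh H (f x) \<subseteq> nbh H (f y) \<longleftrightarrow> nbh G x \<subseteq> nbh G y"
proof
  assume sub: "nbh H (f x) \<subseteq> nbh H (f y)"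
  show "nbh G x \<subseteq> nbh G y"
  proof
    fix z assume z: "z \<in> nbh G x"
    have zc: "z \<in> carrier G" using z G.nbh_subset by blast
    have "f z \<in> nbh H (f y)" using z sub adj[OF x zc] by blast
    then show "z \<in> nbh G y" using adj[OF y zc] by blast
  qed
next
  assume "nbh G x \<subseteq> nbh G y"
  then show "nbh H (f x) \<subseteq> nbh H (f y)" unfolding nbh_image[OF x] nbh_image[OF y] by (rule image_mono)
qed

lemma nbh_eq_iff:
  assumes "x \<in> carrier G" "y \<in> carrier G"
  shows "nbh H (f x) = nbh H (f y) \<longleftrightarrow> nbh G x = nbh G y"
  using nbh_subset_iff[OF assms] nbh_subset_iff[OF assms(2,1)] by (simp only: set_eq_subset)

lemma twins_image: "x \<in> carrier G \<Longrightarrow> twins H (f x) = f ` twins G x"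
  unfolding twins_def by (rule image_Collect_carrier) (rule nbh_eq_iff)

lemma dominators_image: "x \<in> carrier G \<Longrightarrow> dominators H (f x) = f ` dominators G x"
  unfolding dominators_def by (rule image_Collect_carrier) (rule nbh_subset_iff)

lemma hub_image: "hub H = f ` hub G"
  unfolding hub_def
proof (rule image_Collect_carrier)
  fix y assume y: "y \<in> carrier G"
  have "carrier H = f ` carrier G" by (rule bij_betw_imp_surj_on[OF bij, symmetric])
  then show "nbh H (f y) = carrier H \<longleftrightarrow> nbh G y = carrier G"
    unfolding nbh_image[OF y] using inj_on_image_eq_iff[OF inj G.nbh_subset subset_refl] by (simp only:)
qed

lemma hub_subset: "hub G \<subseteq> carrier G"
  unfolding hub_def by blast

lemma hub_iff: "x \<in> carrier G \<Longrightarrow> f x \<in> hub H \<longleftrightarrow> x \<in> hub G"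
  unfolding hub_image by (rule inj_on_image_mem_iff[OF inj _ hub_subset])

lemma card_twins: "x \<in> carrier G \<Longrightarrow> card (twins H (f x)) = card (twins G x)"
  unfolding twins_image by (rule card_f_image) (auto simp: twins_def)

lemma card_dominators: "x \<in> carrier G \<Longrightarrow> card (dominators H (f x)) = card (dominators G x)"
  unfolding dominators_image by (rule card_f_image) (auto simp: dominators_def)

lemma compound_shape_iff:
  assumes x: "x \<in> carrier G"
  shows "compound_shape H (f x) \<longleftrightarrow> compound_shape G x"
proof -
  have "nbh H (f x) - hub H = f ` (nbh G x - hub G)"
    unfolding nbh_image[OF x] hub_image
    using inj_on_image_set_diff[OF inj _ hub_subset, of "nbh G x"] G.nbh_subset by blast
  moreover have "(\<forall>v\<in>f ` (nbh G x - hub G). card (twins G x) < 2 * card (twins H v)) \<longleftrightarrow>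
      (\<forall>y\<in>nbh G x - hub G. card (twins G x) < 2 * card (twins G y))"
  proof -
    have "card (twins H (f y)) = card (twins G y)" if "y \<in> nbh G x - hub G" for y
      using that G.nbh_subset by (intro card_twins) blast
    then show ?thesis by (simp only: ball_simps cong: ball_cong)
  qed
  ultimately show ?thesis
    unfolding compound_shape_def card_twins[OF x] card_dominators[OF x] by (simp only:)
qed

lemma plain_iff:
  assumes x: "x \<in> carrier G" "x \<notin> hub G"
  shows "plain H (f x) \<longleftrightarrow> plain G x"
proof -
  have fx: "f x \<in> carrier H" "f x \<notin> hub H" using f_closed[OF x(1)] hub_iff[OF x(1)] x(2) by blast+
  show ?thesis
    using G.compound_shape_of_not_plain[OF x] G.plain_imp_not_compound_shape[OF x]
      H.compound_shape_of_not_plain[OF fx] H.plain_imp_not_compound_shape[OF fx]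
      compound_shape_iff[OF x(1)] by blast
qed

lemma order_eq: "order H = order G"
  unfolding order_def using bij_betw_same_card[OF bij] by simp

lemma card_hub: "card (hub H) = card (hub G)"
  unfolding hub_image by (rule card_f_image[OF hub_subset])

lemma small_hub_transfer:
  assumes "hub G = {\<one>\<^bsub>G\<^esub>} \<or> prime_pow (order G)"
  shows "hub H = {\<one>\<^bsub>H\<^esub>} \<or> prime_pow (order H)"
  using assms
proof
  assume "hub G = {\<one>\<^bsub>G\<^esub>}"
  then have "card (hub H) = 1" unfolding card_hub by simp
  then obtain h where "hub H = {h}" by (rule card_1_singletonE)
  then show ?thesis using H.one_in_hub by auto
next
  assume "prime_pow (order G)"
  then show ?thesis unfolding order_eq by blast
qed

text \<open>For plain \<open>x\<close> the graph shows which neighbours \<open>y\<close> lie below \<open>x\<close>. If the class of \<open>y\<close> is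
  compound, then \<open>x\<close> is above it unless it belongs to \<open>dominators G y\<close>. If both classes are plain, their
  sizes are totients, and a reversal would force \<open>\<phi>(ord y) = \<phi>(ord x)\<close>, so that \<open>ord x = 2 * ord y\<close>
  with \<open>ord y\<close> odd; then the involution in \<open>\<langle>x\<rangle>\<close>, a singleton class, is adjacent to \<open>x\<close> but not to \<open>y\<close>.\<close>
lemma image_below_plain:
  assumes small: "hub G = {\<one>\<^bsub>G\<^esub>} \<or> prime_pow (order G)"
    and x: "x \<in> carrier G" "x \<notin> hub G" and plain: "plain G x" and yx: "y \<in> cyc G x"
  shows "f y \<in> cyc H (f x)"
proof (rule ccontr)
  assume no: "f y \<notin> cyc H (f x)"
  have yc: "y \<in> carrier G" by (rule G.cyc_carrier[OF yx x(1)])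
  have fxc: "f x \<in> carrier H" and fyc: "f y \<in> carrier H" using f_closed x(1) yc by blast+
  have fxh: "f x \<notin> hub H" using hub_iff[OF x(1)] x(2) by blast
  have "f y \<in> nbh H (f x)" using adj[OF x(1) yc] G.nbh_of_cyc[OF yx x(1)] by blast
  then have xy': "f x \<in> cyc H (f y)" using no unfolding nbh_def by blast
  have "f y \<notin> hub H" using no H.hub_below[OF small_hub_transfer[OF small] _ fxc fxh] by blast
  then have yh: "y \<notin> hub G" using hub_iff[OF yc] by blast
  have plainH: "plain H (f x)" using plain_iff[OF x] plain by blast
  have not_twin: "nbh G y \<noteq> nbh G x"
  proof
    assume "nbh G y = nbh G x"
    then have "nbh H (f y) = nbh H (f x)" using nbh_eq_iff[OF yc x(1)] by blast
    then have "f y \<in> twins H (f x)" using fyc unfolding H.twin_iff by blast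
    then show False using no unfolding H.plain_twins[OF fxc plainH] by blast
  qed
  show False
  proof (cases "plain G y")
    case False
    obtain t p r s where t: "t \<in> twins G y" and p: "prime p" "G.ord t = p ^ r"
      and dom: "dominators G y = cyc G t"
      by (rule G.compound_twinsE[OF yc yh False])
    have tc: "t \<in> carrier G" "nbh G t = nbh G y" using t unfolding G.twin_iff by blast+
    have pp: "prime_pow (G.ord t)" unfolding p(2) prime_pow_def using p(1) by blast
    have npH: "\<not> plain H (f y)" using plain_iff[OF yc yh] False by blast
    obtain t' p' r' s' where t': "t' \<in> twins H (f y)" and dom': "dominators H (f y) = cyc H t'"
      by (rule H.compound_twinsE[OF fyc \<open>f y \<notin> hub H\<close> npH])
    have t'c: "t' \<in> carrier H" using t' unfolding H.twin_iff by blast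
    have "f y \<in> dominators H (f y)" unfolding dominators_def using fyc by blast
    then have "f x \<in> dominators H (f y)" unfolding dom' by (rule H.cyc_trans[OF xy' _ t'c])
    then have "f x \<in> f ` dominators G y" unfolding dominators_image[OF yc] .
    then have xt: "x \<in> cyc G t"
      unfolding dom using inj_on_image_mem_iff[OF inj x(1) G.cyc_subset[OF tc(1)]] by blast
    have "prime_pow (G.ord x)" by (rule prime_pow_dvd[OF pp G.cyc_ord_dvd[OF xt tc(1)]])
    then have "nbh G x \<subseteq> nbh G y" by (rule G.nbh_mono_of_prime_pow[OF x(1) yx])
    moreover have "nbh G y \<subseteq> nbh G x"
      using G.nbh_mono_of_prime_pow[OF tc(1) xt pp] unfolding tc(2) .
    ultimately show False using not_twin by blast
  next
    case True
    have plainHy: "plain H (f y)" using plain_iff[OF yc yh] True by blast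
    define m n m' n' where "m = G.ord y" and "n = G.ord x" and "m' = H.ord (f y)" and "n' = H.ord (f x)"
    have mn: "m dvd n" unfolding m_def n_def by (rule G.cyc_ord_dvd[OF yx x(1)])
    have n'm': "n' dvd m'" unfolding m'_def n'_def by (rule H.cyc_ord_dvd[OF xy' fyc])
    have n0: "n > 0" "m' > 0" unfolding n_def m'_def using G.ord_pos[OF x(1)] H.ord_pos[OF fyc] by simp_all
    have "totient m' = totient m"
      unfolding m_def m'_def G.card_plain_twins[OF yc True, symmetric]
        H.card_plain_twins[OF fyc plainHy, symmetric] by (rule card_twins[OF yc])
    moreover have "totient n' = totient n"
      unfolding n_def n'_def G.card_plain_twins[OF x(1) plain, symmetric]
        H.card_plain_twins[OF fxc plainH, symmetric] by (rule card_twins[OF x(1)])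
    moreover have "totient m \<le> totient n" by (rule totient_le_of_dvd[OF mn n0(1)])
    moreover have "totient n' \<le> totient m'" by (rule totient_le_of_dvd[OF n'm' n0(2)])
    ultimately have tot: "totient m = totient n" "totient n' = totient m'" by simp_all
    have "m \<noteq> n"
    proof
      assume "m = n"
      then have "G.ord y = G.ord x" unfolding m_def n_def .
      then have "cyc G y = cyc G x" by (rule G.cyc_eq_of_nbh_ord_eq[OF x(1) G.nbh_of_cyc[OF yx x(1)]])
      then show False using not_twin G.nbh_cong[OF yc x(1)] by blast
    qed
    note n = totient_eq_of_dvd[OF mn n0(1) tot(1) this]
    have "n' \<noteq> m'"
    proof
      assume "n' = m'"
      then have "H.ord (f x) = H.ord (f y)" unfolding m'_def n'_def .
      then have "cyc H (f x) = cyc H (f y)"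
        by (rule H.cyc_eq_of_nbh_ord_eq[OF fyc H.nbh_of_cyc[OF xy' fyc]])
      then show False using no H.cyc_refl[of "f y"] by blast
    qed
    note m' = totient_eq_of_dvd[OF n'm' n0(2) tot(2) this]
    have m1: "m \<noteq> 1" unfolding m_def by (rule G.ord_neq_1[OF yc yh])
    have "2 dvd G.ord x" using n(2) unfolding n_def by simp
    then obtain t where t: "t \<in> cyc G x" "G.ord t = 2" by (rule G.ex_in_cyc_of_ord[OF x(1)])
    have tc: "t \<in> carrier G" by (rule G.cyc_carrier[OF t(1) x(1)])
    have ftc: "f t \<in> carrier H" by (rule f_closed[OF tc])
    have tny: "t \<notin> nbh G y"
    proof
      assume "t \<in> nbh G y"
      then have "m dvd 2 \<or> 2 dvd m" using G.nbh_ord_dvd[OF _ yc] t(2) unfolding m_def by metis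
      then have "m dvd 2" using n(1) by blast
      then have "m = 1 \<or> m = 2" using two_is_prime_nat prime_nat_iff by blast
      then show False using m1 n(1) by auto
    qed
    then have th: "t \<notin> hub G" using G.nbh_sym[OF tc, of y] yc unfolding hub_def by blast
    obtain q where q: "prime q" "q dvd m" using m1 prime_factor_nat by blast
    have q2: "q \<noteq> 2" using q n(1) by auto
    have plain_t: "plain G t"
    proof (rule G.plain_of_prime_ord(2)[OF x(1) t(1) _ q(1)])
      show "prime (G.ord t)" unfolding t(2) by (rule two_is_prime_nat)
      show "q dvd G.ord x" using q(2) mn dvd_trans unfolding n_def by blast
      show "q \<noteq> G.ord t" unfolding t(2) by (rule q2)
    qed
    have "card (twins H (f t)) = 1"
      unfolding card_twins[OF tc] G.card_plain_twins[OF tc plain_t] t(2) by simp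
    then have tot_t: "totient (H.ord (f t)) \<le> 1" using H.totient_le_card_twins[OF ftc] by simp
    have "f t \<in> nbh H (f x)" using adj[OF x(1) tc] G.nbh_of_cyc[OF t(1) x(1)] by blast
    moreover have "f t \<notin> cyc H (f x)"
    proof
      assume "f t \<in> cyc H (f x)"
      then have "f t \<in> cyc H (f y)" by (rule H.cyc_trans[OF _ xy' fyc])
      then have "f t \<in> nbh H (f y)" by (rule H.nbh_of_cyc[OF _ fyc])
      then show False using adj[OF yc tc] tny by blast
    qed
    ultimately have "f x \<in> cyc H (f t)" unfolding nbh_def by blast
    then have "n' dvd H.ord (f t)" unfolding n'_def by (rule H.cyc_ord_dvd[OF _ ftc])
    then have n't: "totient n' \<le> 1" using totient_le_of_dvd[OF _ H.ord_pos[OF ftc]] tot_t le_trans by blast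
    have "n' \<noteq> 1" unfolding n'_def by (rule H.ord_neq_1[OF fxc fxh])
    moreover have "n' > 0" unfolding n'_def by (rule H.ord_pos[OF fxc])
    ultimately have "n' > 2" using m'(1) by (cases "n' = 2") auto
    then have "totient n' > 1" by (rule totient_gt_1)
    then show False using n't by simp
  qed
qed

lemma ord_le_of_plain:
  assumes small: "hub G = {\<one>\<^bsub>G\<^esub>} \<or> prime_pow (order G)"
    and x: "x \<in> carrier G" "x \<notin> hub G" and plain: "plain G x"
  shows "G.ord x \<le> H.ord (f x)"
proof -
  have fxc: "f x \<in> carrier H" by (rule f_closed[OF x(1)])
  have "f ` cyc G x \<subseteq> cyc H (f x)" using image_below_plain[OF small x plain] by blast
  then have "card (f ` cyc G x) \<le> card (cyc H (f x))" by (rule card_mono[OF H.finite_cyc[OF fxc]])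
  then show ?thesis
    unfolding card_f_image[OF G.cyc_subset[OF x(1)]] G.card_cyc[OF x(1)] H.card_cyc[OF fxc] .
qed

text \<open>The inclusion of the image of \<open>\<langle>x\<rangle>\<close> in \<open>\<langle>f x\<rangle>\<close> applies to \<open>f\<close> and to its inverse.\<close>
lemma ord_eq_of_plain:
  assumes small: "hub G = {\<one>\<^bsub>G\<^esub>} \<or> prime_pow (order G)"
    and x: "x \<in> carrier G" "x \<notin> hub G" and plain: "plain G x"
  shows "H.ord (f x) = G.ord x"
proof (rule antisym)
  interpret inv: power_graph_iso H G "inv_into (carrier G) f" by (rule inverse)
  have fx: "f x \<in> carrier H" "f x \<notin> hub H" "plain H (f x)"
    using f_closed[OF x(1)] hub_iff[OF x(1)] x(2) plain_iff[OF x] plain by blast+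
  show "H.ord (f x) \<le> G.ord x"
    using inv.ord_le_of_plain[OF small_hub_transfer[OF small] fx]
    unfolding inv_into_f_f[OF inj x(1)] .
  show "G.ord x \<le> H.ord (f x)" by (rule ord_le_of_plain[OF small x plain])
qed

lemma card_twins_ord_eq:
  assumes small: "hub G = {\<one>\<^bsub>G\<^esub>} \<or> prime_pow (order G)" and x: "x \<in> carrier G"
  shows "card {v \<in> twins H (f x). H.ord v = d} = card {y \<in> twins G x. G.ord y = d}"
proof -
  have fxc: "f x \<in> carrier H" by (rule f_closed[OF x])
  consider (hub) "x \<in> hub G" | (plain) "x \<notin> hub G" "plain G x" | (compound) "x \<notin> hub G" "\<not> plain G x"
    by blast
  then show ?thesis
  proof cases
    case hub
    have "f x \<in> hub H" using hub_iff[OF x] hub by blast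
    then have "twins H (f x) = hub H" "twins G x = hub G"
      using hub unfolding hub_def twins_def by simp_all
    then show ?thesis
      by (simp only: G.card_hub_ord_eq[OF small] H.card_hub_ord_eq[OF small_hub_transfer[OF small]] card_hub)
  next
    case plain
    have plainH: "plain H (f x)" using plain_iff[OF x plain(1)] plain(2) by blast
    have G: "{y \<in> twins G x. G.ord y = d} = (if d = G.ord x then twins G x else {})"
      using plain(2) unfolding plain_def by auto
    have H: "{v \<in> twins H (f x). H.ord v = d} = (if d = H.ord (f x) then twins H (f x) else {})"
      using plainH unfolding plain_def by auto
    show ?thesis unfolding G H ord_eq_of_plain[OF small x plain]
      by (cases "d = G.ord x") (simp_all only: simp_thms if_True if_False card_twins[OF x] card.empty)
  next
    case compound
    have npH: "f x \<notin> hub H" "\<not> plain H (f x)"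
      using hub_iff[OF x] plain_iff[OF x compound(1)] compound by blast+
    show ?thesis
      by (simp only: G.card_compound_twins_ord_eq[OF x compound]
          H.card_compound_twins_ord_eq[OF fxc npH] card_twins[OF x] card_dominators[OF x])
  qed
qed

text \<open>Permuting \<open>f\<close> within the twin classes does not affect adjacency, and makes it order-preserving;
  orders then tell the direction of each edge.\<close>
lemma ex_cyc_iso_of_small_hub:
  assumes small: "hub G = {\<one>\<^bsub>G\<^esub>} \<or> prime_pow (order G)"
  shows "\<exists>\<phi>. cyc_iso G H \<phi>"
proof -
  \<comment> \<open>Label the elements by twin class (transported to \<open>H\<close> along \<open>f\<close>) and order.\<close>
  define l where "l x = (f ` twins G x, G.ord x)" for x
  define l' where "l' v = (twins H v, H.ord v)" for v
  have card: "card {x \<in> carrier G. l x = k} = card {v \<in> carrier H. l' v = k}" for k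
  proof -
    obtain K d where k: "k = (K, d)" by (rule prod.exhaust)
    show ?thesis
    proof (cases "\<exists>z\<in>carrier G. K = f ` twins G z")
      case True
      then obtain z where z: "z \<in> carrier G" "K = f ` twins G z" by (elim bexE)
      have fz: "f z \<in> carrier H" by (rule f_closed[OF z(1)])
      have G: "f ` twins G x = f ` twins G z \<longleftrightarrow> x \<in> twins G z" if x: "x \<in> carrier G" for x
      proof
        assume "f ` twins G x = f ` twins G z"
        moreover have "f x \<in> f ` twins G x" using x unfolding twins_def by blast
        ultimately have "f x \<in> f ` twins G z" by blast
        moreover have "twins G z \<subseteq> carrier G" unfolding twins_def by blast
        ultimately show "x \<in> twins G z" using inj_on_image_mem_iff[OF inj x] by blast
      next
        assume "x \<in> twins G z"
        then have "nbh G x = nbh G z" unfolding twins_def by blast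
        then show "f ` twins G x = f ` twins G z" unfolding twins_def by (simp only:)
      qed
      have H: "twins H v = twins H (f z) \<longleftrightarrow> v \<in> twins H (f z)" if v: "v \<in> carrier H" for v
      proof
        assume "twins H v = twins H (f z)"
        moreover have "v \<in> twins H v" using v unfolding twins_def by blast
        ultimately show "v \<in> twins H (f z)" by blast
      next
        assume "v \<in> twins H (f z)"
        then have "nbh H v = nbh H (f z)" unfolding twins_def by blast
        then show "twins H v = twins H (f z)" unfolding twins_def by (simp only:)
      qed
      have "{x \<in> carrier G. l x = k} = {x \<in> twins G z. G.ord x = d}"
        unfolding l_def k z(2) prod.inject using G unfolding twins_def by blast
      moreover have "{v \<in> carrier H. l' v = k} = {v \<in> twins H (f z). H.ord v = d}"
        unfolding l'_def k z(2) twins_image[OF z(1), symmetric] prod.inject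
        using H unfolding twins_def by blast
      ultimately show ?thesis using card_twins_ord_eq[OF small z(1)] by (simp only:)
    next
      case False
      then have "{x \<in> carrier G. l x = k} = {}" unfolding l_def k prod.inject by blast
      moreover have "{v \<in> carrier H. l' v = k} = {}"
      proof (rule ccontr)
        assume "{v \<in> carrier H. l' v = k} \<noteq> {}"
        then obtain v where v: "v \<in> carrier H" "twins H v = K" unfolding l'_def k prod.inject by blast
        then obtain z where z: "z \<in> carrier G" "v = f z"
          using bij_betw_imp_surj_on[OF bij] by (metis imageE)
        have "K = f ` twins G z" using v(2) unfolding z(2) twins_image[OF z(1)] by (rule sym)
        then show False using False z(1) by blast
      qed
      ultimately show ?thesis by (simp only: card.empty)
    qed
  qed
  obtain g where g: "bij_betw g (carrier G) (carrier H)" and gl: "\<And>x. x \<in> carrier G \<Longrightarrow> l' (g x) = l x"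
    using ex_label_preserving_bij[of "carrier G" "carrier H" l l', OF G.fin H.fin card] by blast
  have gc: "g x \<in> carrier H" if "x \<in> carrier G" for x by (rule bij_betw_apply[OF g that])
  have gtw: "nbh H (g x) = nbh H (f x)" and gord: "H.ord (g x) = G.ord x" if x: "x \<in> carrier G" for x
  proof -
    have eq: "twins H (g x) = twins H (f x)" and o: "H.ord (g x) = G.ord x"
      using gl[OF x] unfolding l_def l'_def prod.inject twins_image[OF x] by blast+
    have "g x \<in> twins H (g x)" using gc[OF x] unfolding twins_def by blast
    then have "g x \<in> twins H (f x)" unfolding eq .
    then show "nbh H (g x) = nbh H (f x)" unfolding twins_def by blast
    show "H.ord (g x) = G.ord x" by (rule o)
  qed
  have gadj: "g y \<in> nbh H (g x) \<longleftrightarrow> y \<in> nbh G x" if x: "x \<in> carrier G" and y: "y \<in> carrier G" for x y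
  proof -
    have "g y \<in> nbh H (g x) \<longleftrightarrow> g x \<in> nbh H (f y)"
      using H.nbh_sym[OF gc[OF x], of "g y"] H.nbh_sym[OF gc[OF y], of "g x"] unfolding gtw[OF y] by blast
    also have "\<dots> \<longleftrightarrow> f y \<in> nbh H (f x)"
      using H.nbh_sym[OF f_closed[OF y], of "g x"] H.nbh_sym[OF gc[OF x], of "f y"]
      unfolding gtw[OF x] by blast
    also have "\<dots> \<longleftrightarrow> y \<in> nbh G x" by (rule adj[OF x y])
    finally show ?thesis .
  qed
  have Gcyc: "y \<in> cyc G x \<longleftrightarrow> y \<in> nbh G x \<and> G.ord y dvd G.ord x"
    if x: "x \<in> carrier G" and y: "y \<in> carrier G" for x y
    using G.cyc_of_nbh_ord_dvd[OF x] G.nbh_of_cyc[OF _ x] G.cyc_ord_dvd[OF _ x] by blast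
  have Hcyc: "v \<in> cyc H u \<longleftrightarrow> v \<in> nbh H u \<and> H.ord v dvd H.ord u"
    if u: "u \<in> carrier H" and v: "v \<in> carrier H" for u v
    using H.cyc_of_nbh_ord_dvd[OF u] H.nbh_of_cyc[OF _ u] H.cyc_ord_dvd[OF _ u] by blast
  have "x \<in> cyc G y \<longleftrightarrow> g x \<in> cyc H (g y)" if x: "x \<in> carrier G" and y: "y \<in> carrier G" for x y
    unfolding Gcyc[OF y x] Hcyc[OF gc[OF y] gc[OF x]] gadj[OF y x] gord[OF x] gord[OF y] by (rule refl)
  then show ?thesis unfolding cyc_iso_def using g by blast
qed

end

lemma (in finite_grp) card_ord_eq_of_cyclic:
  assumes s: "s \<in> carrier G" "carrier G = cyc G s"
  shows "card {x \<in> carrier G. ord x = d} = (if d dvd order G then totient d else 0)"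
proof -
  have os: "order G = ord s" using card_cyc[OF s(1)] s(2) unfolding order_def by simp
  show ?thesis
  proof (cases "d dvd order G")
    case True
    have "card {x \<in> cyc G s. ord x = d} = totient d"
      by (rule card_ord_eq_in_cyc[OF s(1)]) (use True os in simp)
    then show ?thesis unfolding s(2)[symmetric] using True by (simp only: if_True)
  next
    case False
    have "{x \<in> carrier G. ord x = d} = {}"
    proof (rule ccontr)
      assume "{x \<in> carrier G. ord x = d} \<noteq> {}"
      then obtain x where "x \<in> carrier G" "ord x = d" by auto
      then show False using False ord_dvd_group_order by blast
    qed
    then show ?thesis using False by (simp only: card.empty if_False)
  qed
qed

lemma cyc_iso_of_cyclic:
  assumes fG: "finite_grp G" and fH: "finite_grp H" and eq: "order G = order H"
    and s: "s \<in> carrier G" "carrier G = cyc G s" and t: "t \<in> carrier H" "carrier H = cyc H t"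
  shows "\<exists>\<phi>. cyc_iso G H \<phi>"
proof -
  interpret G: finite_grp G by (rule fG)
  interpret H: finite_grp H by (rule fH)
  have card: "card {x \<in> carrier G. G.ord x = d} = card {x \<in> carrier H. H.ord x = d}" for d
    unfolding G.card_ord_eq_of_cyclic[OF s] H.card_ord_eq_of_cyclic[OF t] eq by (rule refl)
  obtain g where g: "bij_betw g (carrier G) (carrier H)"
    and go: "\<And>x. x \<in> carrier G \<Longrightarrow> H.ord (g x) = G.ord x"
    using ex_label_preserving_bij[of "carrier G" "carrier H" G.ord H.ord, OF G.fin H.fin card] by blast
  have Gcyc: "x \<in> cyc G y \<longleftrightarrow> G.ord x dvd G.ord y" if x: "x \<in> carrier G" and y: "y \<in> carrier G" for x y
    using G.cyc_of_ord_dvd[OF s(1)] G.cyc_ord_dvd[OF _ y] x y unfolding s(2)[symmetric] by blast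
  have Hcyc: "x \<in> cyc H y \<longleftrightarrow> H.ord x dvd H.ord y" if x: "x \<in> carrier H" and y: "y \<in> carrier H" for x y
    using H.cyc_of_ord_dvd[OF t(1)] H.cyc_ord_dvd[OF _ y] x y unfolding t(2)[symmetric] by blast
  have "x \<in> cyc G y \<longleftrightarrow> g x \<in> cyc H (g y)" if x: "x \<in> carrier G" and y: "y \<in> carrier G" for x y
    unfolding Gcyc[OF x y] Hcyc[OF bij_betw_apply[OF g x] bij_betw_apply[OF g y]] go[OF x] go[OF y]
    by (rule refl)
  then show ?thesis unfolding cyc_iso_def using g by blast
qed

lemma (in finite_grp) large_hub_imp_cyclic:
  assumes "hub G \<noteq> {\<one>}" "\<not> prime_pow (order G)"
  shows "\<exists>s\<in>carrier G. carrier G = cyc G s"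
proof -
  obtain s where s: "s \<in> hub G" "s \<noteq> \<one>" using assms(1) one_in_hub by blast
  have "\<not> prime_pow (ord s)" using prime_pow_order_of_hub[OF s] assms(2) by blast
  then have "carrier G = cyc G s" by (rule carrier_cyclic_of_hub[OF s])
  moreover have "s \<in> carrier G" using s(1) unfolding hub_def by blast
  ultimately show ?thesis by blast
qed

text \<open>If the hub is large and the order of the group is not a prime power, then both groups are
  cyclic of the same order; here the given isomorphism is replaced by any bijection preserving orders.\<close>
lemma sim4_imp_cyc_iso:
  assumes fG: "finite_grp G" and fH: "finite_grp H" and sim: "sim4 G H"
  shows "\<exists>\<phi>. cyc_iso G H \<phi>"
proof -
  obtain f where f: "bij_betw f (carrier G) (carrier H) \<and>
     (\<forall>x\<in>carrier G. \<forall>y\<in>carrier G.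
        x \<in> cyc G y \<or> y \<in> cyc G x \<longleftrightarrow> f x \<in> cyc H (f y) \<or> f y \<in> cyc H (f x))"
    using sim[unfolded sim4_iff[OF fG fH]] by (rule exE)
  interpret power_graph_iso G H f
  proof (intro power_graph_iso.intro power_graph_iso_axioms.intro fG fH)
    show bij: "bij_betw f (carrier G) (carrier H)" using f by (rule conjunct1)
    fix x y assume xy: "x \<in> carrier G" "y \<in> carrier G"
    have "f y \<in> carrier H" by (rule bij_betw_apply[OF bij xy(2)])
    then have "f y \<in> nbh H (f x) \<longleftrightarrow> f x \<in> cyc H (f y) \<or> f y \<in> cyc H (f x)"
      unfolding nbh_def by blast
    also have "\<dots> \<longleftrightarrow> x \<in> cyc G y \<or> y \<in> cyc G x"
      using f[THEN conjunct2, THEN bspec, THEN bspec, OF xy] by (rule sym)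
    also have "\<dots> \<longleftrightarrow> y \<in> nbh G x" using xy unfolding nbh_def by blast
    finally show "f y \<in> nbh H (f x) \<longleftrightarrow> y \<in> nbh G x" .
  qed
  interpret inv: power_graph_iso H G "inv_into (carrier G) f" by (rule inverse)
  show ?thesis
  proof (cases "hub G = {\<one>\<^bsub>G\<^esub>} \<or> prime_pow (order G)")
    case True
    then show ?thesis by (rule ex_cyc_iso_of_small_hub)
  next
    case False
    then have "\<not> (hub H = {\<one>\<^bsub>H\<^esub>} \<or> prime_pow (order H))" using inv.small_hub_transfer by blast
    then obtain s t where "s \<in> carrier G" "carrier G = cyc G s" "t \<in> carrier H" "carrier H = cyc H t"
      using False G.large_hub_imp_cyclic H.large_hub_imp_cyclic by blast
    then show ?thesis by (rule cyc_iso_of_cyclic[OF fG fH order_eq[symmetric]])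
  qed
qed

section \<open>Separating examples\<close>

text \<open>The central extension of \<open>(\<int>/3)\<^sup>2\<close> by \<open>\<int>/3\<close> whose cocycle is \<open>c\<close> times the determinant. As the
  determinant is alternating, powers do not depend on \<open>c\<close>; but the group is abelian for \<open>c = 0\<close> and
  not for \<open>c = 1\<close> (the Heisenberg group).\<close>
definition det_extension :: "int \<Rightarrow> (int \<times> int \<times> int) monoid" where
  "det_extension c = \<lparr>carrier = {0..<3} \<times> {0..<3} \<times> {0..<3},
     monoid.mult = (\<lambda>(a, b, z) (a', b', z').
       ((a + a') mod 3, (b + b') mod 3, (z + z' + c * (a * b' - b * a')) mod 3)),
     monoid.one = (0, 0, 0)\<rparr>"

lemma det_extension_mult:
  "(a, b, z) \<otimes>\<^bsub>det_extension c\<^esub> (a', b', z') =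
     ((a + a') mod 3, (b + b') mod 3, (z + z' + c * (a * b' - b * a')) mod 3)"
  by (simp add: det_extension_def)

lemma finite_grp_det_extension: "finite_grp (det_extension c)"
proof -
  have "group (det_extension c)"
  proof (rule groupI)
    fix x y assume "x \<in> carrier (det_extension c)" "y \<in> carrier (det_extension c)"
    then show "x \<otimes>\<^bsub>det_extension c\<^esub> y \<in> carrier (det_extension c)"
      by (auto simp: det_extension_def split: prod.splits)
  next
    show "\<one>\<^bsub>det_extension c\<^esub> \<in> carrier (det_extension c)" by (simp add: det_extension_def)
  next
    fix x y z assume "x \<in> carrier (det_extension c)" "y \<in> carrier (det_extension c)"
      "z \<in> carrier (det_extension c)"
    obtain a b s a' b' s' a'' b'' s'' where
      eqs: "x = (a, b, s)" "y = (a', b', s')" "z = (a'', b'', s'')"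
      by (cases x; cases y; cases z)
    have "((s + s' + c * (a * b' - b * a')) mod 3 + s'' +
        c * ((a + a') mod 3 * b'' - (b + b') mod 3 * a'')) mod 3 =
      (s + s' + c * (a * b' - b * a') + s'' + c * ((a + a') * b'' - (b + b') * a'')) mod 3"
      by (intro mod_add_cong mod_mult_cong mod_diff_cong refl mod_mod_trivial)
    also have "s + s' + c * (a * b' - b * a') + s'' + c * ((a + a') * b'' - (b + b') * a'') =
      s + (s' + s'' + c * (a' * b'' - b' * a'')) + c * (a * (b' + b'') - b * (a' + a''))"
      by (simp add: algebra_simps)
    also have "\<dots> mod 3 = (s + (s' + s'' + c * (a' * b'' - b' * a'')) mod 3 +
        c * (a * ((b' + b'') mod 3) - b * ((a' + a'') mod 3))) mod 3"
      by (intro mod_add_cong mod_mult_cong mod_diff_cong refl mod_mod_trivial[symmetric])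
    finally have third: "((s + s' + c * (a * b' - b * a')) mod 3 + s'' +
        c * ((a + a') mod 3 * b'' - (b + b') mod 3 * a'')) mod 3 = \<dots>" .
    show "x \<otimes>\<^bsub>det_extension c\<^esub> y \<otimes>\<^bsub>det_extension c\<^esub> z = x \<otimes>\<^bsub>det_extension c\<^esub> (y \<otimes>\<^bsub>det_extension c\<^esub> z)"
      unfolding eqs det_extension_mult prod.inject
      by (intro conjI third) (simp_all only: mod_add_left_eq mod_add_right_eq add.assoc)
  next
    fix x assume "x \<in> carrier (det_extension c)"
    then show "\<one>\<^bsub>det_extension c\<^esub> \<otimes>\<^bsub>det_extension c\<^esub> x = x"
      by (auto simp: det_extension_def)
  next
    fix x assume x: "x \<in> carrier (det_extension c)"
    obtain a b z where abz: "x = (a, b, z)" by (cases x)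
    have "((- z) mod 3 + z + c * ((- a) mod 3 * b - (- b) mod 3 * a)) mod 3 =
        (- z + z + c * (- a * b - - b * a)) mod 3"
      by (intro mod_add_cong mod_mult_cong mod_diff_cong refl mod_mod_trivial)
    also have "\<dots> = 0" by simp
    finally have "((- a) mod 3, (- b) mod 3, (- z) mod 3) \<otimes>\<^bsub>det_extension c\<^esub> x = (0, 0, 0)"
      unfolding abz det_extension_mult prod.inject by (simp add: mod_add_left_eq)
    then show "\<exists>y\<in>carrier (det_extension c). y \<otimes>\<^bsub>det_extension c\<^esub> x = \<one>\<^bsub>det_extension c\<^esub>"
      by (intro bexI[of _ "((- a) mod 3, (- b) mod 3, (- z) mod 3)"])
        (simp_all add: det_extension_def)
  qed
  then show ?thesis by (simp add: finite_grp_def finite_grp_axioms_def det_extension_def)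
qed

lemma nat_pow_det_extension:
  assumes "(a, b, z) \<in> carrier (det_extension c)"
  shows "(a, b, z) [^]\<^bsub>det_extension c\<^esub> (n::nat) = (int n * a mod 3, int n * b mod 3, int n * z mod 3)"
proof (induction n)
  case 0
  then show ?case by (simp add: nat_pow_def det_extension_def)
next
  case (Suc n)
  have "(a, b, z) [^]\<^bsub>det_extension c\<^esub> Suc n =
      (a, b, z) [^]\<^bsub>det_extension c\<^esub> n \<otimes>\<^bsub>det_extension c\<^esub> (a, b, z)"
    by (simp add: nat_pow_def)
  also have "\<dots> = (int (Suc n) * a mod 3, int (Suc n) * b mod 3, int (Suc n) * z mod 3)"
  proof -
    have comp: "(int n * u mod 3 + u) mod 3 = int (Suc n) * u mod 3" for u :: int
      unfolding mod_add_left_eq by (simp add: distrib_right add.commute)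
    have "(int n * z mod 3 + z + c * (int n * a mod 3 * b - int n * b mod 3 * a)) mod 3 =
        (int n * z mod 3 + z + c * (int n * a * b - int n * b * a)) mod 3"
      by (intro mod_add_cong mod_mult_cong mod_diff_cong refl mod_mod_trivial)
    also have "\<dots> = int (Suc n) * z mod 3" unfolding comp[symmetric] by simp
    finally show ?thesis unfolding Suc.IH det_extension_mult prod.inject by (intro conjI comp)
  qed
  finally show ?case .
qed

lemma int_pow_det_extension:
  assumes x: "x \<in> carrier (det_extension c)"
  shows "x [^]\<^bsub>det_extension c\<^esub> (t::int) = x [^]\<^bsub>det_extension c\<^esub> nat (t mod 3)"
proof -
  interpret finite_grp "det_extension c" by (rule finite_grp_det_extension)
  obtain a b z where abz: "x = (a, b, z)" by (cases x)
  have "x [^]\<^bsub>det_extension c\<^esub> (3::nat) = \<one>\<^bsub>det_extension c\<^esub>"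
    unfolding abz by (subst nat_pow_det_extension) (use x abz in \<open>simp_all add: det_extension_def\<close>)
  then have "ord x dvd 3" using pow_eq_id[OF x] by blast
  then have "int (ord x) dvd 3" using int_dvd_int_iff[of "ord x" 3] by simp
  moreover have "3 dvd t mod 3 - t" by (simp add: mod_eq_dvd_iff[symmetric])
  ultimately have "int (ord x) dvd t mod 3 - t" by (rule dvd_trans)
  then have "x [^]\<^bsub>det_extension c\<^esub> t = x [^]\<^bsub>det_extension c\<^esub> (t mod 3)"
    using int_pow_eq[OF x] by blast
  also have "t mod 3 = int (nat (t mod 3))" by simp
  finally show ?thesis by (simp only: int_pow_int)
qed

lemma sim2_det_extension: "sim2 (det_extension 0) (det_extension 1)"
  unfolding sim2_def
proof (intro exI[of _ "\<lambda>x. x"] conjI ballI allI)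
  have carr: "carrier (det_extension 0) = carrier (det_extension 1)" by (simp add: det_extension_def)
  show "bij_betw (\<lambda>x. x) (carrier (det_extension 0)) (carrier (det_extension 1))"
    unfolding carr by (rule bij_betw_id[unfolded id_def])
  fix x and t :: int assume x: "x \<in> carrier (det_extension 0)"
  obtain a b z where abz: "x = (a, b, z)" by (cases x)
  have x1: "x \<in> carrier (det_extension 1)" using x unfolding carr .
  show "x [^]\<^bsub>det_extension 0\<^esub> t = x [^]\<^bsub>det_extension 1\<^esub> t"
    unfolding int_pow_det_extension[OF x] int_pow_det_extension[OF x1]
    unfolding abz nat_pow_det_extension[OF x[unfolded abz]] nat_pow_det_extension[OF x1[unfolded abz]]
    by (rule refl)
qed

lemma not_iso_det_extension: "\<not> det_extension 1 \<cong> det_extension 0"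
proof
  assume "det_extension 1 \<cong> det_extension 0"
  then obtain h where "h \<in> iso (det_extension 1) (det_extension 0)" unfolding is_iso_def by blast
  then have h: "h \<in> hom (det_extension 1) (det_extension 0)"
    and inj: "inj_on h (carrier (det_extension 1))"
    unfolding iso_def bij_betw_def by blast+
  define x y :: "int \<times> int \<times> int" where "x = (1, 0, 0)" and "y = (0, 1, 0)"
  have xy: "x \<in> carrier (det_extension 1)" "y \<in> carrier (det_extension 1)"
    by (simp_all add: x_def y_def det_extension_def)
  have comm: "u \<otimes>\<^bsub>det_extension 0\<^esub> v = v \<otimes>\<^bsub>det_extension 0\<^esub> u" for u v
    by (cases u; cases v) (simp add: det_extension_def add.commute)
  have "h (x \<otimes>\<^bsub>det_extension 1\<^esub> y) = h (y \<otimes>\<^bsub>det_extension 1\<^esub> x)"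
    unfolding hom_mult[OF h xy] hom_mult[OF h xy(2,1)] by (rule comm)
  moreover have "x \<otimes>\<^bsub>det_extension 1\<^esub> y \<in> carrier (det_extension 1)"
    "y \<otimes>\<^bsub>det_extension 1\<^esub> x \<in> carrier (det_extension 1)"
    by (simp_all add: x_def y_def det_extension_def)
  ultimately have "x \<otimes>\<^bsub>det_extension 1\<^esub> y = y \<otimes>\<^bsub>det_extension 1\<^esub> x" using inj by (simp add: inj_on_def)
  then show False by (simp add: x_def y_def det_extension_def)
qed

text \<open>The semidirect product of two cyclic groups of order 4 in which the generator of the second acts
  on the first by \<open>i \<mapsto> (1 + 2 e) i\<close>: the direct product for \<open>e = 0\<close>, and the nontrivial semidirect
  product for \<open>e = 1\<close>.\<close>
definition C4_by_C4 :: "int \<Rightarrow> (int \<times> int) monoid" where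
  "C4_by_C4 e = \<lparr>carrier = {0..<4} \<times> {0..<4},
     monoid.mult = (\<lambda>(i, j) (i', j'). ((i + i' + 2 * e * j * i') mod 4, (j + j') mod 4)),
     monoid.one = (0, 0)\<rparr>"

lemma C4_by_C4_mult:
  "(i, j) \<otimes>\<^bsub>C4_by_C4 e\<^esub> (i', j') = ((i + i' + 2 * e * j * i') mod 4, (j + j') mod 4)"
  by (simp add: C4_by_C4_def)

lemma finite_grp_C4_by_C4: "finite_grp (C4_by_C4 e)"
proof -
  have "group (C4_by_C4 e)"
  proof (rule groupI)
    fix x y assume "x \<in> carrier (C4_by_C4 e)" "y \<in> carrier (C4_by_C4 e)"
    then show "x \<otimes>\<^bsub>C4_by_C4 e\<^esub> y \<in> carrier (C4_by_C4 e)"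
      by (auto simp: C4_by_C4_def split: prod.splits)
  next
    show "\<one>\<^bsub>C4_by_C4 e\<^esub> \<in> carrier (C4_by_C4 e)" by (simp add: C4_by_C4_def)
  next
    fix x y z assume "x \<in> carrier (C4_by_C4 e)" "y \<in> carrier (C4_by_C4 e)" "z \<in> carrier (C4_by_C4 e)"
    obtain i j i' j' i'' j'' where eqs: "x = (i, j)" "y = (i', j')" "z = (i'', j'')"
      by (cases x; cases y; cases z)
    have "((i + i' + 2 * e * j * i') mod 4 + i'' + 2 * e * ((j + j') mod 4) * i'') mod 4 =
        (i + i' + 2 * e * j * i' + i'' + 2 * e * (j + j') * i'') mod 4"
      by (intro mod_add_cong mod_mult_cong refl mod_mod_trivial)
    also have "\<dots> = (i + (i' + i'' + 2 * e * j' * i'') + 2 * e * j * (i' + i'' + 2 * e * j' * i'')) mod 4"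
      by (simp add: mod_eq_dvd_iff algebra_simps)
    also have "\<dots> = (i + (i' + i'' + 2 * e * j' * i'') mod 4 +
        2 * e * j * ((i' + i'' + 2 * e * j' * i'') mod 4)) mod 4"
      by (intro mod_add_cong mod_mult_cong refl mod_mod_trivial[symmetric])
    finally have first: "((i + i' + 2 * e * j * i') mod 4 + i'' + 2 * e * ((j + j') mod 4) * i'') mod 4 = \<dots>" .
    show "x \<otimes>\<^bsub>C4_by_C4 e\<^esub> y \<otimes>\<^bsub>C4_by_C4 e\<^esub> z = x \<otimes>\<^bsub>C4_by_C4 e\<^esub> (y \<otimes>\<^bsub>C4_by_C4 e\<^esub> z)"
      unfolding eqs C4_by_C4_mult prod.inject
      by (intro conjI first) (simp only: mod_add_left_eq mod_add_right_eq add.assoc)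
  next
    fix x assume "x \<in> carrier (C4_by_C4 e)"
    then show "\<one>\<^bsub>C4_by_C4 e\<^esub> \<otimes>\<^bsub>C4_by_C4 e\<^esub> x = x" by (auto simp: C4_by_C4_def)
  next
    fix x assume x: "x \<in> carrier (C4_by_C4 e)"
    obtain i j where ij: "x = (i, j)" by (cases x)
    have "((2 * e * j * i - i) mod 4 + i + 2 * e * ((- j) mod 4) * i) mod 4 =
        (2 * e * j * i - i + i + 2 * e * (- j) * i) mod 4"
      by (intro mod_add_cong mod_mult_cong refl mod_mod_trivial)
    also have "\<dots> = 0" by simp
    finally have "((2 * e * j * i - i) mod 4, (- j) mod 4) \<otimes>\<^bsub>C4_by_C4 e\<^esub> x = (0, 0)"
      unfolding ij C4_by_C4_mult prod.inject by (simp add: mod_add_left_eq)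
    then show "\<exists>y\<in>carrier (C4_by_C4 e). y \<otimes>\<^bsub>C4_by_C4 e\<^esub> x = \<one>\<^bsub>C4_by_C4 e\<^esub>"
      by (intro bexI[of _ "((2 * e * j * i - i) mod 4, (- j) mod 4)"])
        (simp_all add: C4_by_C4_def)
  qed
  then show ?thesis by (simp add: finite_grp_def finite_grp_axioms_def C4_by_C4_def)
qed

lemma square_C4_by_C4:
  assumes "(i, j) \<in> carrier (C4_by_C4 e)"
  shows "(i, j) [^]\<^bsub>C4_by_C4 e\<^esub> (2::nat) = (2 * i * (1 + e * j) mod 4, 2 * j mod 4)"
proof -
  interpret finite_grp "C4_by_C4 e" by (rule finite_grp_C4_by_C4)
  have "(i, j) [^]\<^bsub>C4_by_C4 e\<^esub> (2::nat) = (i, j) \<otimes>\<^bsub>C4_by_C4 e\<^esub> (i, j)"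
    using assms by (simp add: numeral_2_eq_2)
  also have "\<dots> = (2 * i * (1 + e * j) mod 4, 2 * j mod 4)"
    unfolding C4_by_C4_mult by (simp add: algebra_simps)
  finally show ?thesis .
qed

lemma (in finite_grp) ord_of_pow_4_eq_one:
  assumes x: "x \<in> carrier G" and "x [^] (4::nat) = \<one>"
  shows "ord x = (if x = \<one> then 1 else if x [^] (2::nat) = \<one> then 2 else 4)"
proof -
  have "ord x dvd 4" using assms pow_eq_id[OF x] by blast
  then have "ord x \<in> {1, 2, 4}"
  proof -
    have "ord x \<le> 4" using \<open>ord x dvd 4\<close> by (auto dest: dvd_imp_le)
    moreover have "ord x \<noteq> 3" using \<open>ord x dvd 4\<close> by auto
    moreover have "ord x > 0" by (rule ord_pos[OF x])
    ultimately show ?thesis by auto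
  qed
  moreover have "ord x = 1 \<longleftrightarrow> x = \<one>" by (rule ord_eq_1[OF x])
  moreover have "x [^] (2::nat) = \<one> \<longleftrightarrow> ord x dvd 2" by (rule pow_eq_id[OF x])
  ultimately show ?thesis by auto
qed

text \<open>The order of \<open>(i, j)\<close> depends only on whether \<open>i\<close> and \<open>j\<close> are zero or even, and not on \<open>e\<close>.\<close>
lemma sim6_C4_by_C4: "sim6 (C4_by_C4 0) (C4_by_C4 1)"
proof -
  have carr: "carrier (C4_by_C4 0) = carrier (C4_by_C4 1)" by (simp add: C4_by_C4_def)
  have ord: "group.ord (C4_by_C4 e) (i, j) =
      (if i = 0 \<and> j = 0 then 1 else if even i \<and> even j then 2 else 4)"
    if x: "(i, j) \<in> carrier (C4_by_C4 e)" for e i j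
  proof -
    interpret finite_grp "C4_by_C4 e" by (rule finite_grp_C4_by_C4)
    let ?y = "(2 * i * (1 + e * j) mod 4, 2 * j mod 4)"
    have sq: "(i, j) [^]\<^bsub>C4_by_C4 e\<^esub> (2::nat) = ?y" by (rule square_C4_by_C4[OF x])
    have y: "?y \<in> carrier (C4_by_C4 e)" using nat_pow_closed[OF x, of 2] unfolding sq .
    have "(i, j) [^]\<^bsub>C4_by_C4 e\<^esub> (4::nat) = ?y [^]\<^bsub>C4_by_C4 e\<^esub> (2::nat)"
      unfolding sq[symmetric] nat_pow_pow[OF x] by simp
    also have "\<dots> = \<one>\<^bsub>C4_by_C4 e\<^esub>"
    proof -
      have vanish: "2 * (2 * k mod 4) * w mod 4 = 0" for k w :: int
      proof -
        have "even (2 * k mod 4)" by presburger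
        then obtain m where "2 * k mod 4 = 2 * m" by (elim evenE)
        then show ?thesis by simp
      qed
      show ?thesis
        unfolding square_C4_by_C4[OF y]
        using vanish[of "i * (1 + e * j)"] vanish[of j 1] by (simp add: C4_by_C4_def mult.assoc)
    qed
    finally have four: "(i, j) [^]\<^bsub>C4_by_C4 e\<^esub> (4::nat) = \<one>\<^bsub>C4_by_C4 e\<^esub>" .
    have even_iff: "2 * k mod 4 = 0 \<longleftrightarrow> even k" for k :: int by presburger
    have "(i, j) [^]\<^bsub>C4_by_C4 e\<^esub> (2::nat) = \<one>\<^bsub>C4_by_C4 e\<^esub> \<longleftrightarrow> even i \<and> even j"
      unfolding sq using even_iff[of j] even_iff[of "i * (1 + e * j)"]
      by (auto simp: C4_by_C4_def mult.assoc)
    then show ?thesis using ord_of_pow_4_eq_one[OF x four] by (simp add: C4_by_C4_def)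
  qed
  have "group.ord (C4_by_C4 0) x = group.ord (C4_by_C4 1) x" if "x \<in> carrier (C4_by_C4 1)" for x
    using ord[of "fst x" "snd x" 0] ord[of "fst x" "snd x" 1] that carr by simp
  moreover have "finite (carrier (C4_by_C4 1))" by (simp add: C4_by_C4_def)
  ultimately show ?thesis unfolding sim6_def order_multiset_def carr by (intro image_mset_cong) simp
qed

text \<open>The \<open>t\<close>-th powers are the vertices of positive in-degree.\<close>
lemma card_powers_of_sim5:
  assumes "finite_grp G" "finite_grp H" "sim5 G H"
  shows "card ((\<lambda>x. x [^]\<^bsub>G\<^esub> (t::int)) ` carrier G) = card ((\<lambda>x. x [^]\<^bsub>H\<^esub> t) ` carrier H)"
proof -
  interpret G: finite_grp G by fact
  have "digraph_iso (with_proj (power_map_digraph t G)) (with_proj (power_map_digraph t H))"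
    using assms(3) unfolding sim5_def by (rule spec)
  then obtain f where f: "bij_betw f (carrier G) (carrier H) \<and>
         (\<forall>x\<in>carrier G. f (x [^]\<^bsub>G\<^esub> t) = f x [^]\<^bsub>H\<^esub> t)"
    unfolding power_map_digraph_iso_iff[OF assms(1,2)] by (rule exE)
  have bij: "bij_betw f (carrier G) (carrier H)" using f by (rule conjunct1)
  have "f ` (\<lambda>x. x [^]\<^bsub>G\<^esub> t) ` carrier G = (\<lambda>x. f x [^]\<^bsub>H\<^esub> t) ` carrier G"
    unfolding image_image by (rule image_cong[OF refl]) (rule bspec[OF conjunct2[OF f]])
  also have "\<dots> = (\<lambda>x. x [^]\<^bsub>H\<^esub> t) ` f ` carrier G" unfolding image_image by (rule refl)
  also have "\<dots> = (\<lambda>x. x [^]\<^bsub>H\<^esub> t) ` carrier H" unfolding bij_betw_imp_surj_on[OF bij] by (rule refl)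
  finally have im: "f ` (\<lambda>x. x [^]\<^bsub>G\<^esub> t) ` carrier G = (\<lambda>x. x [^]\<^bsub>H\<^esub> t) ` carrier H" .
  have "inj_on f ((\<lambda>x. x [^]\<^bsub>G\<^esub> t) ` carrier G)"
    by (rule inj_on_subset[OF bij_betw_imp_inj_on[OF bij]]) (use G.int_pow_closed in blast)
  then show ?thesis unfolding im[symmetric] by (rule card_image[symmetric])
qed

lemma card_squares_C4_by_C4:
  "card ((\<lambda>x. x [^]\<^bsub>C4_by_C4 0\<^esub> (2::int)) ` carrier (C4_by_C4 0)) \<noteq>
   card ((\<lambda>x. x [^]\<^bsub>C4_by_C4 1\<^esub> (2::int)) ` carrier (C4_by_C4 1))"
proof -
  have sq: "(\<lambda>x. x [^]\<^bsub>C4_by_C4 e\<^esub> (2::int)) ` carrier (C4_by_C4 e) =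
      (\<lambda>(i, j). (2 * i * (1 + e * j) mod 4, 2 * j mod 4)) ` ({0..<4} \<times> {0..<4})" for e
  proof -
    have "x [^]\<^bsub>C4_by_C4 e\<^esub> (2::int) = (\<lambda>(i, j). (2 * i * (1 + e * j) mod 4, 2 * j mod 4)) x"
      if x: "x \<in> carrier (C4_by_C4 e)" for x
    proof -
      obtain i j where ij: "x = (i, j)" by (cases x)
      have "x [^]\<^bsub>C4_by_C4 e\<^esub> (2::int) = x [^]\<^bsub>C4_by_C4 e\<^esub> (2::nat)"
        using int_pow_int[of "C4_by_C4 e" x 2] by simp
      then show ?thesis using square_C4_by_C4[of i j e] x unfolding ij by simp
    qed
    moreover have "carrier (C4_by_C4 e) = {0..<4} \<times> {0..<4}" by (simp add: C4_by_C4_def)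
    ultimately show ?thesis by (metis (no_types, lifting) image_cong)
  qed
  have set4: "{0..<4::int} = {0, 1, 2, 3}" by auto
  have "(\<lambda>(i, j). (2 * i * (1 + 0 * j) mod 4, 2 * j mod 4)) ` ({0..<4} \<times> {0..<4}) =
      {(0, 0), (2, 0), (0, 2), (2, 2::int)}"
    "(\<lambda>(i, j). (2 * i * (1 + 1 * j) mod 4, 2 * j mod 4)) ` ({0..<4} \<times> {0..<4}) =
      {(0, 0), (2, 0), (0, 2::int)}"
    unfolding set4 by (auto simp: image_iff)
  then show ?thesis unfolding sq by simp
qed

lemma sim2_trans:
  assumes "sim2 G H" "sim2 H K"
  shows "sim2 G K"
proof -
  obtain \<phi> where \<phi>: "bij_betw \<phi> (carrier G) (carrier H) \<and>
      (\<forall>g\<in>carrier G. \<forall>t::int. \<phi> (g [^]\<^bsub>G\<^esub> t) = \<phi> g [^]\<^bsub>H\<^esub> t)"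
    using assms(1) unfolding sim2_def by (rule exE)
  obtain \<psi> where \<psi>: "bij_betw \<psi> (carrier H) (carrier K) \<and>
      (\<forall>g\<in>carrier H. \<forall>t::int. \<psi> (g [^]\<^bsub>H\<^esub> t) = \<psi> g [^]\<^bsub>K\<^esub> t)"
    using assms(2) unfolding sim2_def by (rule exE)
  have "bij_betw (\<psi> \<circ> \<phi>) (carrier G) (carrier K)" using \<phi> \<psi> bij_betw_trans by blast
  moreover have "(\<psi> \<circ> \<phi>) (g [^]\<^bsub>G\<^esub> t) = (\<psi> \<circ> \<phi>) g [^]\<^bsub>K\<^esub> t" if g: "g \<in> carrier G" for g and t :: int
  proof -
    have "\<phi> g \<in> carrier H" using \<phi> g bij_betw_apply by metis
    then have "\<psi> (\<phi> g [^]\<^bsub>H\<^esub> t) = \<psi> (\<phi> g) [^]\<^bsub>K\<^esub> t" using \<psi> by blast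
    moreover have "\<phi> (g [^]\<^bsub>G\<^esub> t) = \<phi> g [^]\<^bsub>H\<^esub> t" using \<phi> g by blast
    ultimately show ?thesis by simp
  qed
  ultimately show ?thesis unfolding sim2_def by blast
qed

text \<open>Strictness is asserted for groups of natural numbers, into which the examples are transported.\<close>
lemma nat_copy:
  fixes G :: "'a::countable monoid"
  assumes "finite_grp G"
  defines "N \<equiv> image_group (to_nat :: 'a \<Rightarrow> nat) G"
  shows "finite_grp N" "sim1 G N" "sim1 N G"
proof -
  interpret finite_grp G by fact
  have inj: "inj_on (to_nat :: 'a \<Rightarrow> nat) (carrier G)" by (rule inj_on_subset[OF inj_to_nat]) simp
  have grp: "group N" unfolding N_def by (rule inj_imp_image_group_is_group[OF inj])
  have "finite (carrier N)" unfolding N_def image_group_carrier using fin by simp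
  then show "finite_grp N" using grp by (simp add: finite_grp_def finite_grp_axioms_def)
  have "G \<cong> N" unfolding is_iso_def N_def using inj_imp_image_group_iso[OF inj] by blast
  then show "sim1 G N" "sim1 N G" unfolding sim1_def using iso_sym by blast+
qed

lemma ex_nat_sim2_not_sim1:
  "\<exists>(G :: nat monoid) (H :: nat monoid). finite_grp G \<and> finite_grp H \<and> sim2 G H \<and> \<not> sim1 G H"
proof -
  let ?N = "\<lambda>c. image_group (to_nat :: int \<times> int \<times> int \<Rightarrow> nat) (det_extension c)"
  note N = nat_copy[OF finite_grp_det_extension]
  have "sim2 (?N 0) (det_extension 0)"
    by (rule sim1_imp_sim2[OF N(1) finite_grp_det_extension N(3)])
  then have "sim2 (?N 0) (det_extension 1)" using sim2_det_extension by (rule sim2_trans)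
  moreover have "sim2 (det_extension 1) (?N 1)"
    by (rule sim1_imp_sim2[OF finite_grp_det_extension N(1) N(2)])
  ultimately have "sim2 (?N 0) (?N 1)" by (rule sim2_trans)
  moreover have "\<not> sim1 (?N 0) (?N 1)"
  proof
    assume "sim1 (?N 0) (?N 1)"
    then have iso: "?N 0 \<cong> ?N 1" unfolding sim1_def .
    have "det_extension 0 \<cong> ?N 1" using N(2)[of 0, unfolded sim1_def] iso by (rule iso_trans)
    then have "det_extension 0 \<cong> det_extension 1" using N(3)[of 1, unfolded sim1_def] by (rule iso_trans)
    then have "det_extension 1 \<cong> det_extension 0"
      by (rule group.iso_sym[OF finite_grp.axioms(1)[OF finite_grp_det_extension]])
    then show False using not_iso_det_extension by (rule notE[rotated])
  qed
  ultimately show ?thesis using N(1)[of 0] N(1)[of 1] by blast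
qed

lemma ex_nat_sim6_not_sim5:
  "\<exists>(G :: nat monoid) (H :: nat monoid). finite_grp G \<and> finite_grp H \<and> sim6 G H \<and> \<not> sim5 G H"
proof -
  let ?N = "\<lambda>e. image_group (to_nat :: int \<times> int \<Rightarrow> nat) (C4_by_C4 e)"
  note N = nat_copy[OF finite_grp_C4_by_C4]
  have copy: "sim5 (C4_by_C4 e) (?N e)" for e
    by (rule sim2_imp_sim5[OF finite_grp_C4_by_C4 N(1)
          sim1_imp_sim2[OF finite_grp_C4_by_C4 N(1) N(2)]])
  have orders: "order_multiset (?N e) = order_multiset (C4_by_C4 e)" for e
    using sim5_imp_sim6[OF finite_grp_C4_by_C4 N(1) copy] unfolding sim6_def by (rule sym)
  have "sim6 (?N 0) (?N 1)" using sim6_C4_by_C4 unfolding sim6_def orders .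
  moreover have "\<not> sim5 (?N 0) (?N 1)"
  proof
    assume s: "sim5 (?N 0) (?N 1)"
    note card = card_powers_of_sim5[where t = 2]
    have "card ((\<lambda>x. x [^]\<^bsub>C4_by_C4 0\<^esub> (2::int)) ` carrier (C4_by_C4 0)) =
        card ((\<lambda>x. x [^]\<^bsub>C4_by_C4 1\<^esub> (2::int)) ` carrier (C4_by_C4 1))"
      by (rule trans[OF trans[OF card[OF finite_grp_C4_by_C4 N(1) copy, of 0] card[OF N(1) N(1) s]]
            card[OF finite_grp_C4_by_C4 N(1) copy, of 1, symmetric]])
    then show False using card_squares_C4_by_C4 by (rule notE[rotated])
  qed
  ultimately show ?thesis using N(1)[of 0] N(1)[of 1] by blast
qed

section \<open>Comparison of the partitions\<close>

lemma sim_comparison: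
  fixes G :: "'a monoid" and H :: "'b monoid"
  assumes fG: "finite_group G" and fH: "finite_group H"
  shows "sim1 G H \<Longrightarrow> sim2 G H" "sim2 G H \<longleftrightarrow> sim3 G H" "sim3 G H \<longleftrightarrow> sim4 G H"
    "sim4 G H \<Longrightarrow> sim5 G H" "sim5 G H \<Longrightarrow> sim6 G H"
proof -
  have f: "finite_grp G" "finite_grp H" using fG fH by (simp_all add: finite_group_iff)
  show "sim1 G H \<Longrightarrow> sim2 G H" by (rule sim1_imp_sim2[OF f])
  have s2: "sim2 G H \<longleftrightarrow> (\<exists>\<phi>. cyc_iso G H \<phi>)" and s3: "sim3 G H \<longleftrightarrow> (\<exists>\<phi>. cyc_iso G H \<phi>)"
    and s4: "sim4 G H \<longleftrightarrow> (\<exists>\<phi>. cyc_iso G H \<phi>)"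
    using sim2_imp_cyc_iso[OF f] cyc_iso_imp_sim3[OF f] cyc_iso_imp_sim4[OF f]
      sim3_imp_sim2[OF f] sim4_imp_cyc_iso[OF f] by blast+
  show "sim2 G H \<longleftrightarrow> sim3 G H" "sim3 G H \<longleftrightarrow> sim4 G H" unfolding s2 s3 s4 by (rule refl)+
  show "sim5 G H" if "sim4 G H"
    using that sim2_imp_sim5[OF f] unfolding s2 s4 by blast
  show "sim5 G H \<Longrightarrow> sim6 G H" by (rule sim5_imp_sim6[OF f])
qed

lemma P_comparison:
  "P_le (sim1 :: 'a monoid \<Rightarrow> 'b monoid \<Rightarrow> bool) sim2 \<and>
   P_eq (sim2 :: 'a monoid \<Rightarrow> 'b monoid \<Rightarrow> bool) sim3 \<and>
   P_eq (sim3 :: 'a monoid \<Rightarrow> 'b monoid \<Rightarrow> bool) sim4 \<and>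
   P_le (sim4 :: 'a monoid \<Rightarrow> 'b monoid \<Rightarrow> bool) sim5 \<and>
   P_le (sim5 :: 'a monoid \<Rightarrow> 'b monoid \<Rightarrow> bool) sim6"
  unfolding P_le_def P_eq_def
  by (intro conjI allI impI) (rule sim_comparison; assumption)+

theorem theorem1p7:
  shows
    "(P_less (sim1 :: nat monoid \<Rightarrow> nat monoid \<Rightarrow> bool) sim2 \<and>
      P_eq (sim2 :: nat monoid \<Rightarrow> nat monoid \<Rightarrow> bool) sim3 \<and>
      P_eq (sim3 :: nat monoid \<Rightarrow> nat monoid \<Rightarrow> bool) sim4 \<and>
      P_le (sim4 :: nat monoid \<Rightarrow> nat monoid \<Rightarrow> bool) sim5 \<and>
      P_less (sim5 :: nat monoid \<Rightarrow> nat monoid \<Rightarrow> bool) sim6) \<and>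
     (P_le (sim1 :: 'a monoid \<Rightarrow> 'b monoid \<Rightarrow> bool) sim2 \<and>
      P_eq (sim2 :: 'a monoid \<Rightarrow> 'b monoid \<Rightarrow> bool) sim3 \<and>
      P_eq (sim3 :: 'a monoid \<Rightarrow> 'b monoid \<Rightarrow> bool) sim4 \<and>
      P_le (sim4 :: 'a monoid \<Rightarrow> 'b monoid \<Rightarrow> bool) sim5 \<and>
      P_le (sim5 :: 'a monoid \<Rightarrow> 'b monoid \<Rightarrow> bool) sim6)"
proof -
  have "\<not> P_eq (sim1 :: nat monoid \<Rightarrow> nat monoid \<Rightarrow> bool) sim2"
    using ex_nat_sim2_not_sim1 unfolding P_eq_def finite_group_iff by blast
  moreover have "\<not> P_eq (sim5 :: nat monoid \<Rightarrow> nat monoid \<Rightarrow> bool) sim6"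
    using ex_nat_sim6_not_sim5 unfolding P_eq_def finite_group_iff by blast
  ultimately show ?thesis
    using P_comparison[where ?'a = nat and ?'b = nat] P_comparison[where ?'a = 'a and ?'b = 'b]
    unfolding P_less_def by blast
qed

end
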